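(* For all positive integers $n$ we have $\rho(S_n) \le C_\rho/n^2$, where $C_\rho = 10^2\,\rho(S_{10})$.
   Context: $S_n$ is the symmetric group of degree $n$. $\rho(S_n)$ denotes the probability that, if $\sigma,\tau\in S_n$ are chosen independently and uniformly at random, then $\sigma$ and $\tau$ have conjugates (in $S_n$) that commute; equivalently, $\sigma$ commutes with some conjugate of $\tau$. *)

theory Defs
  imports "HOL-Probability.Probability" "HOL-Algebra.Sym_Groups"
begin

definition conjugates :: "('a, 'b) monoid_scheme \<Rightarrow> 'a \<Rightarrow> 'a set"
  where "conjugates G x = {g \<otimes>\<^bsub>G\<^esub> x \<otimes>\<^bsub>G\<^esub> inv\<^bsub>G\<^esub> g | g. g \<in> carrier G}"

definition have_commuting_conjugates :: "('a, 'b) monoid_scheme \<Rightarrow> 'a \<Rightarrow> 'a \<Rightarrow> bool"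
  where "have_commuting_conjugates G x y \<longleftrightarrow>
    (\<exists>x' \<in> conjugates G x. \<exists>y' \<in> conjugates G y. x' \<otimes>\<^bsub>G\<^esub> y' = y' \<otimes>\<^bsub>G\<^esub> x')"

text \<open>
  The product measure \<open>pair_pmf\<close> expresses that the two elements are chosen independently.
  The definition is meaningful only for finite \<open>G\<close>, since \<open>pmf_of_set\<close> is unspecified on
  infinite sets.
\<close>

definition rho :: "('a, 'b) monoid_scheme \<Rightarrow> real"
  where "rho G = measure_pmf.prob
    (pair_pmf (pmf_of_set (carrier G)) (pmf_of_set (carrier G)))
    {(x, y). have_commuting_conjugates G x y}"

definition C_rho :: real
  where "C_rho = 10\<^sup>2 * rho (sym_group 10)"

end

theory Submission
  imports Defs
begin

text \<open>
  The cycle type of a permutation is the multiset of the sizes of its orbits.  A uniformly random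
  element of \<open>S\<^sub>n\<close> has cycle type \<open>M\<close> with probability \<open>weight M\<close>, the inverse of the order of
  a centralizer, and two permutations have commuting conjugates if and only if their cycle types
  \<open>M\<close> and \<open>M'\<close> are \<^emph>\<open>compatible\<close>: they can be cut into pieces of equal mass, each of which is a
  block consisting of \<open>L div a\<close> copies of \<open>a\<close> in \<open>M\<close> and of \<open>L div b\<close> copies of \<open>b\<close> in \<open>M'\<close>,
  where \<open>L = lcm a b\<close>.  Indeed, for commuting permutations the points that lie in an \<open>a\<close>-cycle of
  the first and in a \<open>b\<close>-cycle of the second form a set that is invariant under both, so that its
  size is a multiple of \<open>L\<close>; conversely, suitable powers of an \<open>L\<close>-cycle realize a block
  (\<open>have_commuting_conjugates_iff\<close>).  Hence the probability in question is a sum of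
  \<open>weight M * weight M'\<close> over compatible pairs (\<open>rho_sym_group\<close>).

  Let \<open>compatible_prob n k\<close> be the part of this sum in which all cycles have length at most \<open>k\<close>.
  A compatible pair with a long cycle contains a block with a long cycle, and after the removal of
  this block the rest is still compatible.  The union bound over the possible blocks gives
  \<open>compatible_prob_remove_block\<close>, an inequality that bounds the probability in degree \<open>n\<close> by
  probabilities in smaller degrees and by the probability that both permutations have only short
  cycles.  The dominant blocks are those with \<open>a = b = L\<close>, of weight \<open>1 / L\<^sup>2\<close>; this is where the
  rate \<open>1 / n\<^sup>2\<close> comes from.

  The constant is attained at \<open>n = 10\<close> and other degrees come within about one percent of it, so small
  degrees need sharp values.  A greedy search for blocks yields \<open>C_rho \<ge> 11.375\<close>, and for all
  other degrees it is shown that \<open>n\<^sup>2 * rho (sym_group n) \<le> 11.375\<close>.  Up to \<open>n = 12\<close> the pairs of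
  cycle types are enumerated and incompatible ones are discarded by a counting criterion
  (\<open>compatible_capacity\<close>) that misses almost none of them.  Up to \<open>n = 39\<close> the block inequality is
  iterated over \<open>n\<close> and \<open>k\<close>; since the union bound is wasteful for short cycles, the enumeration is
  also used for some pairs with cycles of length at most 4 or 6.  From \<open>n = 40\<close> on one application
  of the block inequality, with the bound 11 for short cycles, reduces the claim to smaller degrees:
  numerically up to \<open>n = 79\<close>, and by estimates that are uniform in \<open>n\<close> from there on.
\<close>

section \<open>Orbits and cycle types\<close>

text \<open>Orbits are taken under a bare function, and a set enters only through \<open>bij_betw f S S\<close>.  Cycles can
  then be split off, by passing from \<open>S\<close> to an invariant subset, without changing the function.\<close>

definition orb :: "('a \<Rightarrow> 'a) \<Rightarrow> 'a \<Rightarrow> 'a set" where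
  "orb f x = range (\<lambda>k. (f ^^ k) x)"

lemma self_in_orb [simp]: "x \<in> orb f x"
  unfolding orb_def by (metis funpow_0 rangeI)

lemma funpow_in_invariant:
  assumes "\<And>y. y \<in> S \<Longrightarrow> f y \<in> S" "x \<in> S"
  shows "(f ^^ k) x \<in> S"
  using assms by (induction k) auto

lemma orb_subset:
  assumes "\<And>y. y \<in> S \<Longrightarrow> f y \<in> S" "x \<in> S"
  shows "orb f x \<subseteq> S"
  unfolding orb_def using funpow_in_invariant[of S f x] assms by auto

lemma orb_subset_bij: "bij_betw f S S \<Longrightarrow> x \<in> S \<Longrightarrow> orb f x \<subseteq> S"
  by (rule orb_subset) (auto simp: bij_betw_def)

lemma orb_cong:
  assumes "\<And>y. y \<in> S \<Longrightarrow> f y \<in> S" "\<And>y. y \<in> S \<Longrightarrow> f y = g y" "x \<in> S"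
  shows "orb f x = orb g x"
proof -
  have "(f ^^ k) x = (g ^^ k) x" for k
  proof (induction k)
    case (Suc k)
    then show ?case using funpow_in_invariant[of S f x k] assms by auto
  qed simp
  then show ?thesis by (simp add: orb_def)
qed

lemma orb_eq_image_period:
  assumes "0 < m" "(f ^^ m) x = x"
  shows "orb f x = (\<lambda>k. (f ^^ k) x) ` {..<m}"
proof -
  have "(f ^^ k) x \<in> (\<lambda>k. (f ^^ k) x) ` {..<m}" for k
    using funpow_mod_eq[OF assms(2), of k] assms(1) by (intro image_eqI[of _ _ "k mod m"]) auto
  then show ?thesis by (auto simp: orb_def)
qed

text \<open>Two equal points among the first \<open>m\<close> iterates would, after shifting, give a period below \<open>m\<close>.\<close>

lemma card_orb_eq_period:
  assumes m: "0 < m" "(f ^^ m) x = x" "\<And>k. 0 < k \<Longrightarrow> k < m \<Longrightarrow> (f ^^ k) x \<noteq> x"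
  shows "card (orb f x) = m"
proof -
  have less: "(f ^^ i) x \<noteq> (f ^^ j) x" if "i < j" "j < m" for i j
  proof
    assume eq: "(f ^^ i) x = (f ^^ j) x"
    have "(f ^^ (m - j + i)) x = (f ^^ (m - j)) ((f ^^ i) x)" by (simp only: funpow_add o_apply)
    also have "\<dots> = (f ^^ (m - j)) ((f ^^ j) x)" by (rule arg_cong[OF eq])
    also have "\<dots> = (f ^^ (m - j + j)) x" by (simp only: funpow_add o_apply)
    also have "m - j + j = m" using that(2) by simp
    also note m(2)
    finally have "(f ^^ (m - j + i)) x = x" .
    moreover have "0 < m - j + i" "m - j + i < m" using that by linarith+
    ultimately show False using m(3)[of "m - j + i"] by simp
  qed
  have "inj_on (\<lambda>k. (f ^^ k) x) {..<m}"
    by (rule linorder_inj_onI) (use less in blast, simp add: linear)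
  then show ?thesis using orb_eq_image_period[OF m(1,2)] by (simp add: card_image)
qed

lemma orb_period:
  assumes "finite S" "bij_betw f S S" "x \<in> S"
  shows "0 < card (orb f x)" "(f ^^ card (orb f x)) x = x"
    and "0 < k \<Longrightarrow> k < card (orb f x) \<Longrightarrow> (f ^^ k) x \<noteq> x"
proof -
  have inS: "f y \<in> S" if "y \<in> S" for y using assms(2) that by (auto simp: bij_betw_def)
  have "\<exists>m>0. (f ^^ m) x = x"
  proof -
    have "range (\<lambda>k. (f ^^ k) x) \<subseteq> S" using orb_subset[of S f x] inS assms(3) by (simp add: orb_def)
    then have "\<not> inj (\<lambda>k. (f ^^ k) x)"
      using assms(1) finite_imageD[of "\<lambda>k. (f ^^ k) x" UNIV] finite_subset infinite_UNIV_nat by auto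
    then obtain i' j' where "(f ^^ i') x = (f ^^ j') x" "i' \<noteq> j'"
      unfolding inj_def by blast
    then obtain i j where ij: "(f ^^ i) x = (f ^^ j) x" "i < j"
      using that[of i' j'] that[of j' i'] by (cases "i' < j'") auto
    have "(f ^^ i) ((f ^^ (j - i)) x) = (f ^^ (i + (j - i))) x" by (simp only: funpow_add o_apply)
    also have "\<dots> = (f ^^ i) x" using ij by simp
    finally have "(f ^^ i) ((f ^^ (j - i)) x) = (f ^^ i) x" .
    moreover have "inj_on (f ^^ i) S"
      using bij_betw_funpow[OF assms(2)] by (auto simp: bij_betw_def)
    moreover have "(f ^^ (j - i)) x \<in> S" by (rule funpow_in_invariant[OF inS assms(3)])
    ultimately have "(f ^^ (j - i)) x = x" using assms(3) by (simp add: inj_on_def)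
    moreover have "0 < j - i" using ij(2) by simp
    ultimately show ?thesis by blast
  qed
  then obtain m where m: "0 < m" "(f ^^ m) x = x" "\<forall>k<m. \<not> (0 < k \<and> (f ^^ k) x = x)"
    by (subst (asm) exists_least_iff) blast
  have card: "card (orb f x) = m" by (rule card_orb_eq_period) (use m in blast)+
  show "0 < card (orb f x)" "(f ^^ card (orb f x)) x = x"
    and "0 < k \<Longrightarrow> k < card (orb f x) \<Longrightarrow> (f ^^ k) x \<noteq> x"
    unfolding card using m by blast+
qed

lemma orb_eq:
  assumes "finite S" "bij_betw f S S" "x \<in> S" "y \<in> orb f x"
  shows "orb f y = orb f x"
proof -
  define m where "m = card (orb f x)"
  have m: "0 < m" "(f ^^ m) x = x" using orb_period[OF assms(1-3)] by (auto simp: m_def)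
  obtain k where k: "y = (f ^^ k) x" "k < m"
    using assms(4) orb_eq_image_period[OF m] by auto
  have "(f ^^ (m - k)) y = (f ^^ (m - k + k)) x" by (simp only: k(1) funpow_add o_apply)
  then have "(f ^^ (m - k)) y = x" using k m by simp
  then have "(f ^^ i) x = (f ^^ (i + (m - k))) y" for i by (simp add: funpow_add)
  moreover have "(f ^^ i) y = (f ^^ (i + k)) x" for i by (simp add: k funpow_add)
  ultimately show ?thesis unfolding orb_def by auto
qed

definition orbits :: "'a set \<Rightarrow> ('a \<Rightarrow> 'a) \<Rightarrow> 'a set set" where
  "orbits S f = orb f ` S"

definition cycle_type :: "'a set \<Rightarrow> ('a \<Rightarrow> 'a) \<Rightarrow> nat multiset" where
  "cycle_type S f = image_mset card (mset_set (orbits S f))"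

lemma orbits_partition:
  assumes "finite S" "bij_betw f S S"
  shows "finite (orbits S f)" "\<Union>(orbits S f) = S"
    and "X \<in> orbits S f \<Longrightarrow> Y \<in> orbits S f \<Longrightarrow> X \<noteq> Y \<Longrightarrow> X \<inter> Y = {}"
    and "X \<in> orbits S f \<Longrightarrow> x \<in> X \<Longrightarrow> orb f x = X"
proof -
  have inS: "f y \<in> S" if "y \<in> S" for y using assms(2) that by (auto simp: bij_betw_def)
  show "finite (orbits S f)" using assms by (simp add: orbits_def)
  have sub: "orb f x \<subseteq> S" if "x \<in> S" for x by (rule orb_subset[OF inS that])
  show "\<Union>(orbits S f) = S" unfolding orbits_def using sub by (blast intro: self_in_orb)
  show *: "orb f x = X" if "X \<in> orbits S f" "x \<in> X" for X x
    using that unfolding orbits_def by (blast dest: orb_eq[OF assms])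
  show "X \<inter> Y = {}" if "X \<in> orbits S f" "Y \<in> orbits S f" "X \<noteq> Y"
    using *[OF that(1)] *[OF that(2)] that(3) by blast
qed

text \<open>A sum over points is a sum over orbits in which each orbit counts with its size.\<close>

lemma sum_card_orb:
  fixes G :: "nat \<Rightarrow> 'b :: semiring_1"
  assumes "finite S" "bij_betw f S S"
  shows "(\<Sum>x\<in>S. G (card (orb f x))) = (\<Sum>l\<in>#cycle_type S f. of_nat l * G l)"
proof -
  note part = orbits_partition[OF assms]
  have fin: "\<forall>X\<in>orbits S f. finite X" using part(2) assms(1) by (metis Union_upper finite_subset)
  have "(\<Sum>x\<in>\<Union>(orbits S f). G (card (orb f x))) = (\<Sum>X\<in>orbits S f. \<Sum>x\<in>X. G (card (orb f x)))"
    using part(3) fin by (subst sum.Union_disjoint) auto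
  also have "\<dots> = (\<Sum>X\<in>orbits S f. of_nat (card X) * G (card X))"
    using part(4) by (intro sum.cong) auto
  also have "\<dots> = (\<Sum>l\<in>#cycle_type S f. of_nat l * G l)"
    by (simp add: cycle_type_def sum_unfold_sum_mset multiset.map_comp o_def)
  finally show ?thesis using part(2) by simp
qed

lemma sum_mset_cycle_type:
  assumes "finite S" "bij_betw f S S"
  shows "sum_mset (cycle_type S f) = card S"
  using sum_card_orb[OF assms, of "\<lambda>_. 1::nat"] by simp

lemma sum_mset_indicator: "(\<Sum>l\<in>#M. l * (if l = a then 1 else 0 :: nat)) = a * count M a"
  by (induction M) auto

lemma card_orb_size:
  assumes "finite S" "bij_betw f S S"
  shows "card {x \<in> S. card (orb f x) = a} = a * count (cycle_type S f) a"
  using sum_card_orb[OF assms, of "\<lambda>l. if l = a then 1 else 0 :: nat"] assms(1)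
  by (simp add: sum_mset_indicator sum.If_cases Int_def)

lemma zero_notin_cycle_type:
  assumes "finite S" "bij_betw f S S"
  shows "0 \<notin># cycle_type S f"
proof
  assume "0 \<in># cycle_type S f"
  then obtain x where "x \<in> S" "card (orb f x) = 0"
    using orbits_partition(1)[OF assms] by (auto simp: cycle_type_def orbits_def)
  with orb_period(1)[OF assms this(1)] show False by linarith
qed

lemma cycle_type_empty [simp]: "cycle_type {} f = {#}"
  by (simp add: cycle_type_def orbits_def)

lemma cycle_type_cong:
  assumes "\<And>y. y \<in> S \<Longrightarrow> f y \<in> S" "\<And>y. y \<in> S \<Longrightarrow> f y = g y"
  shows "cycle_type S f = cycle_type S g"
proof -
  have "orbits S f = orbits S g" unfolding orbits_def using orb_cong[of S f g] assms by (intro image_cong) auto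
  then show ?thesis by (simp add: cycle_type_def)
qed

lemma cycle_type_Un:
  assumes "finite S" "bij_betw f S S" "finite T" "bij_betw f T T" "S \<inter> T = {}"
  shows "cycle_type (S \<union> T) f = cycle_type S f + cycle_type T f"
proof -
  have "orbits S f \<inter> orbits T f = {}"
  proof (rule ccontr)
    assume "orbits S f \<inter> orbits T f \<noteq> {}"
    then obtain x y where xy: "x \<in> S" "y \<in> T" "orb f x = orb f y" by (auto simp: orbits_def)
    have "orb f x \<subseteq> S" "orb f y \<subseteq> T"
      using orb_subset_bij[OF assms(2) xy(1)] orb_subset_bij[OF assms(4) xy(2)] by simp_all
    then show False using xy assms(5) self_in_orb[of x f] by auto
  qed
  moreover have "orbits (S \<union> T) f = orbits S f \<union> orbits T f" by (auto simp: orbits_def)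
  ultimately show ?thesis using assms
    by (simp add: cycle_type_def mset_set_Union orbits_def)
qed

lemma bij_betw_orb:
  assumes "finite S" "bij_betw f S S" "x \<in> S"
  shows "bij_betw f (orb f x) (orb f x)"
proof -
  have sub: "orb f x \<subseteq> S" by (rule orb_subset_bij[OF assms(2,3)])
  have "f ` orb f x \<subseteq> orb f x"
  proof
    fix z assume "z \<in> f ` orb f x"
    then obtain k where "z = (f ^^ Suc k) x" by (auto simp: orb_def)
    then show "z \<in> orb f x" unfolding orb_def by blast
  qed
  moreover have "inj_on f (orb f x)" using sub assms(2) by (auto simp: bij_betw_def inj_on_subset)
  ultimately show ?thesis
    using finite_subset[OF sub assms(1)] by (simp add: bij_betw_def endo_inj_surj)
qed

lemma bij_betw_Diff_invariant:
  assumes "bij_betw f S S" "bij_betw f T T" "T \<subseteq> S"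
  shows "bij_betw f (S - T) (S - T)"
  using assms unfolding bij_betw_def by (auto simp: inj_on_image_set_diff[of f S] inj_on_diff)

lemma cycle_type_single_orbit:
  assumes "finite S" "bij_betw f S S" "x \<in> S"
  shows "cycle_type (orb f x) f = {#card (orb f x)#}"
proof -
  have "orbits (orb f x) f = {orb f x}"
    using orb_eq[OF assms] self_in_orb[of x f] unfolding orbits_def by blast
  then show ?thesis by (simp add: cycle_type_def)
qed

lemma cycle_type_remove_orb:
  assumes "finite S" "bij_betw f S S" "x \<in> S"
  shows "cycle_type S f = add_mset (card (orb f x)) (cycle_type (S - orb f x) f)"
proof -
  have sub: "orb f x \<subseteq> S" by (rule orb_subset_bij[OF assms(2,3)])
  have bij: "bij_betw f (orb f x) (orb f x)" by (rule bij_betw_orb[OF assms])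
  have "cycle_type ((S - orb f x) \<union> orb f x) f = cycle_type (S - orb f x) f + cycle_type (orb f x) f"
    using sub bij assms bij_betw_Diff_invariant[OF assms(2) bij sub]
    by (intro cycle_type_Un) (auto intro: finite_subset)
  moreover have "(S - orb f x) \<union> orb f x = S" using sub by auto
  ultimately show ?thesis using cycle_type_single_orbit[OF assms] by simp
qed

section \<open>The distribution of the cycle type\<close>

lemma permutes_bij_betw: "p permutes S \<Longrightarrow> bij_betw p S S"
  by (rule permutes_imp_bij)

text \<open>Composing with the transposition of a new point \<open>a\<close> and an old point \<open>b\<close> inserts \<open>a\<close> into the
  cycle of \<open>b\<close>, just before \<open>b\<close>.  Every permutation of \<open>insert a S\<close> arises in this way, so that the
  distribution of the cycle type can be found by induction on the degree.\<close>

lemma orb_insert_into_cycle: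
  assumes "finite S" "q permutes S" "a \<notin> S" "b \<in> S"
  shows "orb (Transposition.transpose a b \<circ> q) a = insert a (orb q b)"
    and "card (orb (Transposition.transpose a b \<circ> q) a) = Suc (card (orb q b))"
proof -
  let ?p = "Transposition.transpose a b \<circ> q" and ?m = "card (orb q b)"
  note bij = permutes_bij_betw[OF assms(2)]
  have inS: "q y \<in> S" if "y \<in> S" for y using assms(2) that by (simp add: permutes_in_image)
  have sub: "orb q b \<subseteq> S" by (rule orb_subset_bij[OF bij assms(4)])
  have qa: "q a = a" using assms(2,3) by (simp add: permutes_def)
  note per = orb_period[OF assms(1) bij assms(4)]
  \<comment> \<open>From \<open>a\<close> on, the new permutation follows the old cycle through \<open>b\<close> until it would return to \<open>b\<close>.\<close>
  have pow: "(?p ^^ Suc k) a = (q ^^ k) b" if "k < ?m" for k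
    using that
  proof (induction k)
    case 0
    then show ?case using qa by simp
  next
    case (Suc k)
    have "(q ^^ Suc k) b \<noteq> b" using per(3)[of "Suc k"] Suc.prems by simp
    moreover have "(q ^^ Suc k) b \<in> S" by (rule funpow_in_invariant[OF _ assms(4)]) (rule inS)
    then have "(q ^^ Suc k) b \<noteq> a" using assms(3) by blast
    ultimately have "Transposition.transpose a b ((q ^^ Suc k) b) = (q ^^ Suc k) b" by (simp add: Transposition.transpose_def)
    moreover have "(?p ^^ Suc (Suc k)) a = ?p ((?p ^^ Suc k) a)" by (simp only: funpow.simps o_apply)
    ultimately show ?case using Suc.IH Suc.prems by simp
  qed
  have last: "(?p ^^ Suc ?m) a = a"
  proof -
    obtain k where k: "?m = Suc k" using per(1) by (cases "?m") auto
    have "(?p ^^ Suc ?m) a = ?p ((?p ^^ Suc k) a)" by (simp only: k funpow.simps o_apply)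
    also have "\<dots> = Transposition.transpose a b ((q ^^ ?m) b)" using pow[of k] k by simp
    also have "\<dots> = a" using per(2) by simp
    finally show ?thesis .
  qed
  have img: "orb ?p a = (\<lambda>k. (?p ^^ k) a) ` {..<Suc ?m}"
    by (rule orb_eq_image_period[OF _ last]) simp
  also have "{..<Suc ?m} = insert 0 (Suc ` {..<?m})" using lessThan_Suc_eq_insert_0 by blast
  also have "(\<lambda>k. (?p ^^ k) a) ` \<dots> = insert a ((\<lambda>k. (?p ^^ Suc k) a) ` {..<?m})"
    by (simp add: image_image)
  also have "(\<lambda>k. (?p ^^ Suc k) a) ` {..<?m} = (\<lambda>k. (q ^^ k) b) ` {..<?m}"
    using pow by (intro image_cong) auto
  also have "\<dots> = orb q b" by (rule orb_eq_image_period[symmetric, OF per(1,2)])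
  finally show eq: "orb ?p a = insert a (orb q b)" .
  have "a \<notin> orb q b" "finite (orb q b)" using sub assms(1,3) finite_subset by auto
  then show "card (orb ?p a) = Suc ?m" unfolding eq by simp
qed

lemma cycle_type_insert_fixed:
  assumes "finite S" "q permutes S" "a \<notin> S"
  shows "cycle_type (insert a S) q = add_mset 1 (cycle_type S q)"
proof -
  have "q a = a" using assms(2,3) by (simp add: permutes_def)
  then have "(q ^^ k) a = a" for k by (induction k) auto
  then have orb: "orb q a = {a}" by (auto simp: orb_def)
  have "bij_betw q (insert a S) (insert a S)"
    using permutes_subset[OF assms(2), of "insert a S"] permutes_bij_betw by blast
  then have "cycle_type (insert a S) q = add_mset (card (orb q a)) (cycle_type (insert a S - orb q a) q)"
    using assms(1) by (intro cycle_type_remove_orb) auto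
  then show ?thesis using orb assms(3) by simp
qed

lemma cycle_type_insert_into_cycle:
  assumes "finite S" "q permutes S" "a \<notin> S" "b \<in> S"
  shows "cycle_type (insert a S) (Transposition.transpose a b \<circ> q) =
    add_mset (Suc (card (orb q b))) (cycle_type S q - {#card (orb q b)#})"
proof -
  let ?p = "Transposition.transpose a b \<circ> q"
  note bij = permutes_bij_betw[OF assms(2)]
  have "?p permutes insert a S"
    using assms by (intro permutes_compose permutes_swap_id permutes_subset[OF assms(2)]) auto
  then have bijp: "bij_betw ?p (insert a S) (insert a S)" by (rule permutes_bij_betw)
  have bijR: "bij_betw q (S - orb q b) (S - orb q b)"
    using assms bij by (intro bij_betw_Diff_invariant bij_betw_orb orb_subset_bij) auto
  have stays: "q y \<in> S - orb q b" if "y \<in> S - orb q b" for y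
    by (rule bij_betwE[OF bijR, rule_format, OF that])
  have agree: "q y = ?p y" if "y \<in> S - orb q b" for y
  proof -
    note stays[OF that]
    then show ?thesis using assms(3) self_in_orb[of b q] by (auto simp: Transposition.transpose_def)
  qed
  have "cycle_type (S - orb q b) q = cycle_type (S - orb q b) ?p"
    by (rule cycle_type_cong) (erule stays, erule agree)
  moreover have "insert a S - orb ?p a = S - orb q b"
    using orb_insert_into_cycle(1)[OF assms] assms(3) by auto
  moreover have "cycle_type (insert a S) ?p = add_mset (card (orb ?p a)) (cycle_type (insert a S - orb ?p a) ?p)"
    using assms(1) bijp by (intro cycle_type_remove_orb) auto
  moreover have "cycle_type S q = add_mset (card (orb q b)) (cycle_type (S - orb q b) q)"
    by (rule cycle_type_remove_orb[OF assms(1) bij assms(4)])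
  ultimately show ?thesis using orb_insert_into_cycle(2)[OF assms] by simp
qed

definition types :: "nat \<Rightarrow> nat \<Rightarrow> nat multiset set" where
  "types n k = {M. sum_mset M = n \<and> set_mset M \<subseteq> {1..k}}"

text \<open>The inverse of the order of the centralizer of a permutation with cycle type \<open>M\<close>.\<close>

definition weight :: "nat multiset \<Rightarrow> real" where
  "weight M = (\<Prod>a\<in>set_mset M. 1 / (real a ^ count M a * fact (count M a)))"

lemma weight_superset:
  assumes "finite A" "set_mset M \<subseteq> A"
  shows "weight M = (\<Prod>a\<in>A. 1 / (real a ^ count M a * fact (count M a)))"
  unfolding weight_def using assms
  by (intro prod.mono_neutral_left) (auto simp: not_in_iff)

lemma weight_nonneg: "weight M \<ge> 0"
  by (simp add: weight_def prod_nonneg)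

lemma weight_empty [simp]: "weight {#} = 1"
  by (simp add: weight_def)

lemma weight_replicate:
  assumes "a > 0"
  shows "weight (N + replicate_mset i a) * (real a ^ i * fact (count N a + i)) = weight N * fact (count N a)"
proof -
  let ?A = "set_mset N \<union> {a}" and ?M = "N + replicate_mset i a"
  let ?f = "\<lambda>M b. 1 / (real b ^ count M b * fact (count M b))"
  have "weight ?M = (\<Prod>b\<in>?A. ?f ?M b)" by (rule weight_superset) auto
  also have "\<dots> = ?f ?M a * (\<Prod>b\<in>?A - {a}. ?f ?M b)" by (subst prod.remove[of _ a]) auto
  also have "(\<Prod>b\<in>?A - {a}. ?f ?M b) = (\<Prod>b\<in>?A - {a}. ?f N b)" by (intro prod.cong) auto
  finally have M: "weight ?M = ?f ?M a * (\<Prod>b\<in>?A - {a}. ?f N b)" .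
  have "weight N = (\<Prod>b\<in>?A. ?f N b)" by (rule weight_superset) auto
  also have "\<dots> = ?f N a * (\<Prod>b\<in>?A - {a}. ?f N b)" by (subst prod.remove[of _ a]) auto
  finally have N: "weight N = ?f N a * (\<Prod>b\<in>?A - {a}. ?f N b)" .
  show ?thesis unfolding M N using assms by (simp add: power_add field_simps)
qed

lemma weight_add_mset:
  assumes "a > 0"
  shows "weight (add_mset a N) * (real a * real (Suc (count N a))) = weight N"
proof -
  have "weight (add_mset a N) * (real a * real (Suc (count N a))) * fact (count N a) = weight N * fact (count N a)"
    using weight_replicate[OF assms, of N 1] by (simp add: mult_ac del: of_nat_Suc)
  then show ?thesis by simp
qed

lemma types_mono: "k \<le> l \<Longrightarrow> types n k \<subseteq> types n l"
  by (auto simp: types_def)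

lemma member_le_sum_mset: "a \<in># M \<Longrightarrow> (a::nat) \<le> sum_mset M"
  by (auto dest!: multi_member_split)

lemma types_large: "n \<le> k \<Longrightarrow> types n k = types n n"
  by (auto simp: types_def subset_iff intro: order_trans[OF member_le_sum_mset])

lemma finite_types: "finite (types n k)"
proof -
  have "size M \<le> sum_mset M" if "set_mset M \<subseteq> {1..k}" for M :: "nat multiset"
    using that by (induction M) auto
  then have "types n k \<subseteq> (\<Union>m\<le>n. {M. set_mset M \<subseteq> {1..k} \<and> size M = m})"
    by (auto simp: types_def)
  moreover have "finite {M. set_mset M \<subseteq> {1..k} \<and> size M = m}" for m
    using finite_multisets_of_size[of "{1..k}" m] by (simp add: multisets_of_size_def)
  ultimately show ?thesis by (auto intro: finite_subset)
qed

lemma types_0_left: "types 0 k = {{#}}"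
proof -
  have "M = {#}" if "M \<in> types 0 k" for M
    using that by (cases M) (auto simp: types_def)
  then show ?thesis by (auto simp: types_def)
qed

lemma types_0_right: "types n 0 = (if n = 0 then {{#}} else {})"
  by (auto simp: types_def)

lemma sum_mset_as_sum_count:
  fixes f :: "'a \<Rightarrow> real"
  shows "(\<Sum>a\<in>#M. f a) = (\<Sum>a\<in>set_mset M. real (count M a) * f a)"
proof (induction M)
  case (add x M)
  have "(\<Sum>a\<in>set_mset (add_mset x M). real (count (add_mset x M) a) * f a)
      = (\<Sum>a\<in>set_mset (add_mset x M). real (count M a) * f a + (if a = x then f x else 0))"
    by (intro sum.cong) (auto simp: algebra_simps)
  also have "\<dots> = (\<Sum>a\<in>set_mset (add_mset x M). real (count M a) * f a) + f x"
    by (simp add: sum.distrib sum.delta)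
  also have "(\<Sum>a\<in>set_mset (add_mset x M). real (count M a) * f a) = (\<Sum>a\<in>set_mset M. real (count M a) * f a)"
    by (intro sum.mono_neutral_right) (auto simp: not_in_iff)
  finally show ?case using add.IH by simp
qed simp

text \<open>Choosing a random type together with a part, weighted by its size, amounts to choosing the rest
  of the type first: the weight of \<open>add_mset a N\<close> times the mass of its parts \<open>a\<close> is the weight
  of \<open>N\<close>.\<close>

lemma sum_types_remove_part:
  fixes G :: "nat multiset \<Rightarrow> nat \<Rightarrow> real"
  shows "(\<Sum>M\<in>types n k. weight M * (\<Sum>a\<in>#M. real a * G (M - {#a#}) a))
    = (\<Sum>a=1..min n k. \<Sum>N\<in>types (n - a) k. weight N * G N a)"
proof -
  have "(\<Sum>M\<in>types n k. weight M * (\<Sum>a\<in>#M. real a * G (M - {#a#}) a))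
    = (\<Sum>M\<in>types n k. \<Sum>a\<in>set_mset M. weight M * (real a * real (count M a)) * G (M - {#a#}) a)"
    by (simp add: sum_mset_as_sum_count sum_distrib_left mult_ac)
  also have "\<dots> = (\<Sum>(M, a)\<in>Sigma (types n k) set_mset. weight M * (real a * real (count M a)) * G (M - {#a#}) a)"
    by (rule sum.Sigma) (auto simp: finite_types)
  also have "\<dots> = (\<Sum>(a, N)\<in>Sigma {1..min n k} (\<lambda>a. types (n - a) k). weight N * G N a)"
  proof -
    have part: "a > 0" "a \<le> n" "a \<le> k" if "M \<in> types n k" "a \<in># M" for M a
      using that member_le_sum_mset[of a M] by (auto simp: types_def)
    show ?thesis
    proof (rule sum.reindex_bij_witness[of _ "\<lambda>(a, N). (add_mset a N, a)" "\<lambda>(M, a). (a, M - {#a#})"], goal_cases)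
      case (2 x)
      then obtain M a where x: "x = (M, a)" "M \<in> types n k" "a \<in># M" by auto
      then obtain N where M: "M = add_mset a N" by (auto dest!: multi_member_split)
      show ?case using part[OF x(2,3)] x by (auto simp: types_def M)
    next
      case (4 x)
      then show ?case by (auto simp: types_def)
    next
      case (5 x)
      then obtain M a where x: "x = (M, a)" "M \<in> types n k" "a \<in># M" by auto
      then obtain N where M: "M = add_mset a N" by (auto dest!: multi_member_split)
      have "weight M * (real a * real (count M a)) = weight N"
        using weight_add_mset[of a N] part[OF x(2,3)] by (simp add: M)
      then show ?case by (simp add: x(1) M)
    qed auto
  qed
  also have "\<dots> = (\<Sum>a=1..min n k. \<Sum>N\<in>types (n - a) k. weight N * G N a)"
    by (rule sum.Sigma[symmetric]) (auto simp: finite_types)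
  finally show ?thesis .
qed

text \<open>Both sides satisfy the same recursion in the degree.  Inserting a point into a cycle of length
  \<open>l\<close> replaces a part \<open>l\<close> by \<open>Suc l\<close> and can be done in \<open>l\<close> ways for each such cycle; on the side of
  the weights this is matched by removing a part in two ways with \<open>sum_types_remove_part\<close>.\<close>

lemma sum_permutations_cycle_type:
  fixes F :: "nat multiset \<Rightarrow> real"
  assumes "finite S"
  shows "(\<Sum>p | p permutes S. F (cycle_type S p))
    = fact (card S) * (\<Sum>M\<in>types (card S) (card S). weight M * F M)"
  using assms
proof (induction S arbitrary: F rule: finite_induct)
  case empty
  then show ?case by (simp add: types_0_left)
next
  case (insert a S)
  define n where "n = card S"
  define H where "H M = F (add_mset 1 M) + (\<Sum>l\<in>#M. real l * F (add_mset (Suc l) (M - {#l#})))" for M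
  have H: "(\<Sum>b\<in>insert a S. F (cycle_type (insert a S) (Transposition.transpose a b \<circ> q))) = H (cycle_type S q)"
    if q: "q permutes S" for q
  proof -
    have "(\<Sum>b\<in>S. F (cycle_type (insert a S) (Transposition.transpose a b \<circ> q)))
      = (\<Sum>b\<in>S. F (add_mset (Suc (card (orb q b))) (cycle_type S q - {#card (orb q b)#})))"
      using insert.hyps q by (intro sum.cong) (simp_all add: cycle_type_insert_into_cycle)
    also have "\<dots> = (\<Sum>l\<in>#cycle_type S q. real l * F (add_mset (Suc l) (cycle_type S q - {#l#})))"
      by (rule sum_card_orb) (use insert.hyps q in \<open>simp_all add: permutes_bij_betw\<close>)
    finally show ?thesis
      using insert.hyps q by (simp add: H_def cycle_type_insert_fixed)
  qed
  have "(\<Sum>p | p permutes insert a S. F (cycle_type (insert a S) p))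
    = (\<Sum>b\<in>insert a S. \<Sum>q | q permutes S. F (cycle_type (insert a S) (Transposition.transpose a b \<circ> q)))"
    by (rule sum_over_permutations_insert) (use insert.hyps in auto)
  also have "\<dots> = (\<Sum>q | q permutes S. H (cycle_type S q))"
    by (subst sum.swap) (intro sum.cong, use H in auto)
  also have "\<dots> = fact n * (\<Sum>M\<in>types n n. weight M * H M)"
    using insert.IH[of H] by (simp add: n_def)
  also have "(\<Sum>M\<in>types n n. weight M * H M) = (\<Sum>M\<in>types n n. weight M * F (add_mset 1 M))
      + (\<Sum>M\<in>types n n. weight M * (\<Sum>l\<in>#M. real l * F (add_mset (Suc l) (M - {#l#}))))"
    by (simp add: H_def distrib_left sum.distrib)
  also have "\<dots> = (\<Sum>M\<in>types n n. weight M * F (add_mset 1 M))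
      + (\<Sum>l=1..n. \<Sum>N\<in>types (n - l) n. weight N * F (add_mset (Suc l) N))"
    by (subst sum_types_remove_part[where G = "\<lambda>N l. F (add_mset (Suc l) N)"]) simp
  also have "\<dots> = (\<Sum>l=0..n. \<Sum>N\<in>types (n - l) n. weight N * F (add_mset (Suc l) N))"
    by (subst (2) sum.atLeast_Suc_atMost) simp_all
  also have "\<dots> = (\<Sum>l=0..n. \<Sum>N\<in>types (Suc n - Suc l) (Suc n). weight N * F (add_mset (Suc l) N))"
  proof (intro sum.cong refl)
    fix l show "types (n - l) n = types (Suc n - Suc l) (Suc n)"
      using types_large[of "n - l" n] types_large[of "n - l" "Suc n"] by simp
  qed
  also have "\<dots> = (\<Sum>l=1..Suc n. \<Sum>N\<in>types (Suc n - l) (Suc n). weight N * F (add_mset l N))"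
    using sum.shift_bounds_cl_Suc_ivl[of "\<lambda>l. \<Sum>N\<in>types (Suc n - l) (Suc n). weight N * F (add_mset l N)" 0 n]
    by simp
  also have "\<dots> = (\<Sum>M\<in>types (Suc n) (Suc n). weight M * (\<Sum>l\<in>#M. real l * F (add_mset l (M - {#l#}))))"
    by (subst sum_types_remove_part[where G = "\<lambda>N l. F (add_mset l N)"]) simp
  also have "\<dots> = (\<Sum>M\<in>types (Suc n) (Suc n). real (Suc n) * (weight M * F M))"
  proof (intro sum.cong refl)
    fix M assume M: "M \<in> types (Suc n) (Suc n)"
    have "(\<Sum>l\<in>#M. real l * F (add_mset l (M - {#l#}))) = (\<Sum>l\<in>#M. real l * F M)"
      by (intro arg_cong[of _ _ sum_mset] image_mset_cong) simp
    also have "\<dots> = real (sum_mset M) * F M" by (simp add: sum_mset_distrib_right)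
    also have "sum_mset M = Suc n" using M by (simp add: types_def)
    finally show "weight M * (\<Sum>l\<in>#M. real l * F (add_mset l (M - {#l#}))) = real (Suc n) * (weight M * F M)"
      by simp
  qed
  also have "fact n * \<dots> = fact (Suc n) * (\<Sum>M\<in>types (Suc n) (Suc n). weight M * F M)"
    unfolding sum_distrib_left[symmetric] fact_Suc by (simp add: mult_ac del: of_nat_Suc)
  finally show ?case using insert.hyps by (simp add: n_def del: fact_Suc)
qed

section \<open>Conjugacy\<close>

lemma bij_betw_funpow_orb:
  assumes "finite S" "bij_betw f S S" "x \<in> S"
  shows "bij_betw (\<lambda>k. (f ^^ k) x) {..<card (orb f x)} (orb f x)"
proof -
  note per = orb_period[OF assms]
  have img: "orb f x = (\<lambda>k. (f ^^ k) x) ` {..<card (orb f x)}"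
    by (rule orb_eq_image_period[OF per(1,2)])
  have "inj_on (\<lambda>k. (f ^^ k) x) {..<card (orb f x)}"
    by (rule eq_card_imp_inj_on) (simp_all add: img[symmetric])
  then show ?thesis using img by (simp add: bij_betw_def)
qed

lemma single_orbits_isomorphic:
  assumes "finite S" "bij_betw f S S" "x \<in> S" "finite T" "bij_betw g T T" "y \<in> T"
    and eq: "card (orb f x) = card (orb g y)"
  obtains h where "bij_betw h (orb f x) (orb g y)" "\<And>z. z \<in> orb f x \<Longrightarrow> h (f z) = g (h z)"
proof -
  define m where "m = card (orb f x)"
  let ?u = "\<lambda>k. (f ^^ k) x" and ?v = "\<lambda>k. (g ^^ k) y"
  have u: "bij_betw ?u {..<m} (orb f x)" unfolding m_def by (rule bij_betw_funpow_orb[OF assms(1-3)])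
  have v: "bij_betw ?v {..<m} (orb g y)" unfolding m_def eq by (rule bij_betw_funpow_orb[OF assms(4-6)])
  have m: "0 < m" "?u m = x" "?v m = y"
    using orb_period(1,2)[OF assms(1-3)] orb_period(2)[OF assms(4-6)] eq by (simp_all add: m_def)
  define h where "h = ?v \<circ> inv_into {..<m} ?u"
  have bij: "bij_betw h (orb f x) (orb g y)"
    unfolding h_def by (rule bij_betw_trans[OF bij_betw_inv_into[OF u] v])
  have hk: "h (?u k) = ?v k" if "k < m" for k
    using bij_betw_inv_into_left[OF u, of k] that by (simp add: h_def)
  have "h (f z) = g (h z)" if "z \<in> orb f x" for z
  proof -
    obtain k where k: "k < m" "z = ?u k" using u \<open>z \<in> orb f x\<close> by (auto simp: bij_betw_def)
    have fz: "f z = ?u (Suc k)" and gz: "g (h z) = ?v (Suc k)" using k hk by simp_all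
    show ?thesis
    proof (cases "Suc k < m")
      case True
      then show ?thesis unfolding fz gz by (rule hk)
    next
      case False
      then have "Suc k = m" using k by simp
      then show ?thesis unfolding fz gz using m hk[of 0] by simp
    qed
  qed
  with bij show ?thesis by (rule that)
qed

text \<open>Orbits of equal size are matched one by one; two different sets are needed since after the first
  step the remaining points differ.\<close>

lemma same_cycle_type_isomorphic:
  assumes "finite S" "bij_betw f S S" "finite T" "bij_betw g T T" "cycle_type S f = cycle_type T g"
  shows "\<exists>h. bij_betw h S T \<and> (\<forall>x\<in>S. h (f x) = g (h x))"
  using assms
proof (induction "card S" arbitrary: S T rule: less_induct)
  case less
  note fS = less.prems(1,2) and gT = less.prems(3,4)
  show ?case
  proof (cases "S = {}")
    case True
    then have "card T = 0" using sum_mset_cycle_type[OF gT] less.prems(5) by simp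
    then show ?thesis using True less.prems(3) by (auto simp: bij_betw_def)
  next
    case False
    then obtain x where x: "x \<in> S" by auto
    have "card (orb f x) \<in># cycle_type T g"
      unfolding less.prems(5)[symmetric] cycle_type_remove_orb[OF fS x] by simp
    then obtain y where y: "y \<in> T" "card (orb f x) = card (orb g y)"
      using less.prems(3) by (auto simp: cycle_type_def orbits_def)
    obtain h1 where h1: "bij_betw h1 (orb f x) (orb g y)" "\<And>z. z \<in> orb f x \<Longrightarrow> h1 (f z) = g (h1 z)"
      by (rule single_orbits_isomorphic[OF fS x gT y]) blast
    have sub: "orb f x \<subseteq> S" "orb g y \<subseteq> T" using orb_subset_bij[OF fS(2) x] orb_subset_bij[OF gT(2) y(1)] .
    have bijf: "bij_betw f (S - orb f x) (S - orb f x)"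
      by (rule bij_betw_Diff_invariant[OF fS(2) bij_betw_orb[OF fS x] sub(1)])
    have bijg: "bij_betw g (T - orb g y) (T - orb g y)"
      by (rule bij_betw_Diff_invariant[OF gT(2) bij_betw_orb[OF gT y(1)] sub(2)])
    have eq: "cycle_type (S - orb f x) f = cycle_type (T - orb g y) g"
      using less.prems(5) cycle_type_remove_orb[OF fS x] cycle_type_remove_orb[OF gT y(1)] y(2) by simp
    have less_card: "card (S - orb f x) < card S"
      by (rule psubset_card_mono[OF fS(1)]) (use x self_in_orb[of x f] in blast)
    obtain h0 where h0: "bij_betw h0 (S - orb f x) (T - orb g y)" "\<forall>z\<in>S - orb f x. h0 (f z) = g (h0 z)"
      using less.hyps[OF less_card _ bijf _ bijg eq] fS(1) gT(1) by blast
    define h where "h = (\<lambda>z. if z \<in> orb f x then h1 z else h0 z)"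
    have "bij_betw h (orb f x \<union> (S - orb f x)) (orb g y \<union> (T - orb g y))"
      unfolding h_def by (rule bij_betw_disjoint_Un[OF h1(1) h0(1)]) auto
    then have "bij_betw h S T" using sub by (simp add: Un_absorb1)
    moreover have "h (f z) = g (h z)" if "z \<in> S" for z
    proof (cases "z \<in> orb f x")
      case True
      then have "f z \<in> orb f x" using bij_betw_orb[OF fS x] by (auto simp: bij_betw_def)
      then show ?thesis using True h1(2) by (simp add: h_def)
    next
      case False
      then have "f z \<notin> orb f x" using bijf that by (auto simp: bij_betw_def)
      then show ?thesis using False h0(2) that by (simp add: h_def)
    qed
    ultimately show ?thesis by blast
  qed
qed

lemma same_cycle_type_conjugate:
  assumes "finite S" "p permutes S" "q permutes S" "cycle_type S p = cycle_type S q"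
  shows "\<exists>g. g permutes S \<and> q = g \<circ> p \<circ> inv' g"
proof -
  obtain h where h: "bij_betw h S S" "\<forall>x\<in>S. h (p x) = q (h x)"
    using same_cycle_type_isomorphic[OF assms(1) permutes_bij_betw[OF assms(2)] assms(1)
        permutes_bij_betw[OF assms(3)] assms(4)] by blast
  define g where "g x = (if x \<in> S then h x else x)" for x
  have "bij_betw g S S" using h(1) by (subst bij_betw_cong[of _ _ h]) (simp_all add: g_def)
  then have g: "g permutes S" by (rule bij_imp_permutes) (simp add: g_def)
  have comm: "g (p x) = q (g x)" for x
  proof (cases "x \<in> S")
    case True
    then have "p x \<in> S" using assms(2) by (simp add: permutes_in_image)
    then show ?thesis using True h(2) by (simp add: g_def)
  next
    case False
    then have "p x = x" "q x = x" using assms(2,3) by (simp_all add: permutes_not_in)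
    then show ?thesis using False by (simp add: g_def)
  qed
  have "q z = g (p (inv' g z))" for z
    using comm[of "inv' g z"] permutes_inverses(1)[OF g, of z] by simp
  then have "q = g \<circ> p \<circ> inv' g" by (simp add: fun_eq_iff)
  with g show ?thesis by blast
qed

lemma cycle_type_conjugate:
  assumes "finite S" "p permutes S" "g permutes S"
  shows "cycle_type S (g \<circ> p \<circ> inv' g) = cycle_type S p"
proof -
  let ?q = "g \<circ> p \<circ> inv' g"
  have pow: "(?q ^^ k) (g x) = g ((p ^^ k) x)" for k x
    by (induction k) (simp_all add: permutes_inverses(2)[OF assms(3)])
  have "orb ?q (g x) = g ` orb p x" for x unfolding orb_def pow by auto
  moreover have "S = g ` S" using permutes_image[OF assms(3)] by simp
  ultimately have "orbits S ?q = (\<lambda>X. g ` X) ` orbits S p"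
    unfolding orbits_def by (metis (no_types, lifting) image_cong image_image)
  moreover have "inj_on ((`) g) (orbits S p)"
    using permutes_inj[OF assms(3)] by (simp add: inj_on_image inj_on_subset[OF _ subset_UNIV])
  ultimately have "mset_set (orbits S ?q) = image_mset ((`) g) (mset_set (orbits S p))"
    by (simp add: image_mset_mset_set)
  moreover have "card (g ` X) = card X" for X
    using permutes_inj[OF assms(3)] by (simp add: card_image inj_on_subset[OF _ subset_UNIV])
  ultimately show ?thesis by (simp add: cycle_type_def multiset.map_comp o_def)
qed

section \<open>Compatible cycle types\<close>

text \<open>A multiset of pairs describes a joint decomposition: a pair \<open>(a, b)\<close> stands for a set of \<open>lcm a b\<close>
  points on which the first permutation has only \<open>a\<close>-cycles and the second one only \<open>b\<close>-cycles.
  Larger invariant sets with this property split into several such blocks.\<close>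

definition left_type :: "(nat \<times> nat) multiset \<Rightarrow> nat multiset" where
  "left_type B = (\<Sum>(a, b)\<in>#B. replicate_mset (lcm a b div a) a)"

definition right_type :: "(nat \<times> nat) multiset \<Rightarrow> nat multiset" where
  "right_type B = (\<Sum>(a, b)\<in>#B. replicate_mset (lcm a b div b) b)"

definition compatible :: "nat multiset \<Rightarrow> nat multiset \<Rightarrow> bool" where
  "compatible M M' \<longleftrightarrow> (\<exists>B. (\<forall>(a, b)\<in>#B. 0 < a \<and> 0 < b) \<and> M = left_type B \<and> M' = right_type B)"

lemma left_type_simps [simp]:
  "left_type {#} = {#}"
  "left_type (add_mset (a, b) B) = replicate_mset (lcm a b div a) a + left_type B"
  "left_type (B + C) = left_type B + left_type C"
  by (simp_all add: left_type_def)

lemma right_type_simps [simp]: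
  "right_type {#} = {#}"
  "right_type (add_mset (a, b) B) = replicate_mset (lcm a b div b) b + right_type B"
  "right_type (B + C) = right_type B + right_type C"
  by (simp_all add: right_type_def)

lemma left_type_replicate: "left_type (replicate_mset k (a, b)) = replicate_mset (k * (lcm a b div a)) a"
  by (induction k) (auto simp: multiset_eq_iff)

lemma right_type_replicate: "right_type (replicate_mset k (a, b)) = replicate_mset (k * (lcm a b div b)) b"
  by (induction k) (auto simp: multiset_eq_iff)

lemma left_type_swap: "left_type (image_mset prod.swap B) = right_type B"
  by (induction B) (auto simp: lcm.commute)

lemma right_type_swap: "right_type (image_mset prod.swap B) = left_type B"
  by (induction B) (auto simp: lcm.commute)

lemma compatible_sym: "compatible M M' \<Longrightarrow> compatible M' M"
  unfolding compatible_def
proof (elim exE conjE)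
  fix B assume B: "\<forall>(a, b)\<in>#B. 0 < a \<and> 0 < b" "M = left_type B" "M' = right_type B"
  show "\<exists>B. (\<forall>(a, b)\<in>#B. 0 < a \<and> 0 < b) \<and> M' = left_type B \<and> M = right_type B"
    by (rule exI[of _ "image_mset prod.swap B"])
      (use B in \<open>auto simp: left_type_swap right_type_swap\<close>)
qed

lemma compatible_commute: "compatible M M' \<longleftrightarrow> compatible M' M"
  using compatible_sym by blast

lemma compatible_empty: "compatible {#} {#}"
  unfolding compatible_def by (intro exI[of _ "{#}"]) simp

lemma compatible_add:
  assumes "compatible M M'" "compatible N N'"
  shows "compatible (M + N) (M' + N')"
proof -
  obtain B C where "\<forall>(a, b)\<in>#B. 0 < a \<and> 0 < b" "M = left_type B" "M' = right_type B"
    "\<forall>(a, b)\<in>#C. 0 < a \<and> 0 < b" "N = left_type C" "N' = right_type C"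
    using assms unfolding compatible_def by blast
  then show ?thesis unfolding compatible_def by (intro exI[of _ "B + C"]) auto
qed

lemma compatible_block:
  assumes "0 < a" "0 < b"
  shows "compatible (replicate_mset (lcm a b div a) a) (replicate_mset (lcm a b div b) b)"
  unfolding compatible_def using assms by (intro exI[of _ "{#(a, b)#}"]) simp

lemma compatible_blocks:
  assumes "0 < a" "0 < b"
  shows "compatible (replicate_mset (k * (lcm a b div a)) a) (replicate_mset (k * (lcm a b div b)) b)"
  unfolding compatible_def using assms
  by (intro exI[of _ "replicate_mset k (a, b)"]) (auto simp: left_type_replicate right_type_replicate)

lemma cycle_type_const:
  assumes "finite T" "bij_betw f T T" "\<And>y. y \<in> T \<Longrightarrow> card (orb f y) = a" "0 < a"
  shows "cycle_type T f = replicate_mset (card T div a) a" "a dvd card T"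
proof -
  have cnt: "c * count (cycle_type T f) c = card {y \<in> T. a = c}" for c
    unfolding card_orb_size[OF assms(1,2), symmetric] using assms(3) by (intro arg_cong[of _ _ card]) auto
  have a: "a * count (cycle_type T f) a = card T" using cnt[of a] by simp
  then show "a dvd card T" by (metis dvd_triv_left)
  show "cycle_type T f = replicate_mset (card T div a) a"
  proof (rule multiset_eqI)
    fix c
    show "count (cycle_type T f) c = count (replicate_mset (card T div a) a) c"
    proof (cases "c = a")
      case True
      have "card T div a = count (cycle_type T f) a" unfolding a[symmetric] using assms(4) by simp
      then show ?thesis using True by simp
    next
      case False
      then have "c * count (cycle_type T f) c = 0" using cnt[of c] by simp
      then show ?thesis using False zero_notin_cycle_type[OF assms(1,2)] by (auto simp: not_in_iff)
    qed
  qed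
qed

lemma orb_commuting_image:
  assumes "bij_betw s S S" "bij_betw t S S" "\<And>x. x \<in> S \<Longrightarrow> s (t x) = t (s x)" "y \<in> S"
  shows "orb t (s y) = s ` orb t y"
proof -
  have inS: "t z \<in> S" if "z \<in> S" for z by (rule bij_betwE[OF assms(2), rule_format, OF that])
  have "(t ^^ k) (s y) = s ((t ^^ k) y)" for k
  proof (induction k)
    case (Suc k)
    have "(t ^^ k) y \<in> S" by (rule funpow_in_invariant[OF inS assms(4)])
    then show ?case using Suc assms(3) by simp
  qed simp
  then show ?thesis by (auto simp: orb_def)
qed

text \<open>The points with the same pair of orbit sizes as a given point \<open>x\<close> form a set \<open>T\<close> that both
  permutations preserve.  Its size is divisible by both orbit sizes and hence by their least
  common multiple, so that \<open>T\<close> consists of blocks; the complement of \<open>T\<close> is treated by induction.\<close>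

lemma commuting_imp_compatible:
  assumes "finite S" "bij_betw s S S" "bij_betw t S S" "\<And>x. x \<in> S \<Longrightarrow> s (t x) = t (s x)"
  shows "compatible (cycle_type S s) (cycle_type S t)"
  using assms
proof (induction "card S" arbitrary: S rule: less_induct)
  case less
  note s = less.prems(1,2) and t = less.prems(1,3) and comm = less.prems(4)
  show ?case
  proof (cases "S = {}")
    case True
    then show ?thesis by (simp add: compatible_empty)
  next
    case False
    then obtain x where x: "x \<in> S" by auto
    define a b where "a = card (orb s x)" and "b = card (orb t x)"
    have ab: "0 < a" "0 < b" using orb_period(1)[OF s x] orb_period(1)[OF t x] by (simp_all add: a_def b_def)
    define T where "T = {y \<in> S. card (orb s y) = a \<and> card (orb t y) = b}"
    have finT: "finite T" and subT: "T \<subseteq> S" using s(1) by (auto simp: T_def)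
    have size: "card (orb f (g y)) = card (orb f y)"
      if "bij_betw f S S" "bij_betw g S S" "\<And>x. x \<in> S \<Longrightarrow> f (g x) = g (f x)" "y \<in> S" for f g y
    proof -
      have "orb f (g y) = g ` orb f y" by (rule orb_commuting_image[OF that(2,1)]) (use that in simp_all)
      moreover have "inj_on g (orb f y)"
        using that(2) orb_subset_bij[OF that(1,4)] by (auto simp: bij_betw_def intro: inj_on_subset)
      ultimately show ?thesis by (simp add: card_image)
    qed
    have inv: "bij_betw g T T" if g: "bij_betw g S S"
      and size_s: "\<And>y. y \<in> S \<Longrightarrow> card (orb s (g y)) = card (orb s y)"
      and size_t: "\<And>y. y \<in> S \<Longrightarrow> card (orb t (g y)) = card (orb t y)" for g
    proof -
      have "g ` T \<subseteq> T" using bij_betwE[OF g] size_s size_t by (auto simp: T_def)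
      moreover have "inj_on g T" using g subT by (auto simp: bij_betw_def intro: inj_on_subset)
      ultimately show ?thesis using finT by (simp add: bij_betw_def endo_inj_surj)
    qed
    have sT: "bij_betw s T T" by (rule inv[OF s(2)]; rule size) (use s t comm in simp_all)
    have tT: "bij_betw t T T" by (rule inv[OF t(2)]; rule size) (use s t comm in simp_all)
    have types: "cycle_type T s = replicate_mset (card T div a) a" "a dvd card T"
      "cycle_type T t = replicate_mset (card T div b) b" "b dvd card T"
      using cycle_type_const[OF finT sT _ ab(1)] cycle_type_const[OF finT tT _ ab(2)] by (auto simp: T_def)
    have "lcm a b dvd card T" using types by simp
    then obtain k where k: "card T = k * lcm a b" by (metis dvd_def mult.commute)
    have "card T div a = k * (lcm a b div a)" "card T div b = k * (lcm a b div b)"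
      unfolding k by (simp_all add: div_mult_swap)
    then have T: "compatible (cycle_type T s) (cycle_type T t)"
      using compatible_blocks[OF ab, of k] types by simp
    have sR: "bij_betw s (S - T) (S - T)" by (rule bij_betw_Diff_invariant[OF s(2) sT subT])
    have tR: "bij_betw t (S - T) (S - T)" by (rule bij_betw_Diff_invariant[OF t(2) tT subT])
    have "x \<in> T" using x by (simp add: T_def a_def b_def)
    then have "card (S - T) < card S"
      by (intro psubset_card_mono[OF s(1)]) (use x in blast)
    from less.hyps[OF this _ sR tR] s(1) comm
    have R: "compatible (cycle_type (S - T) s) (cycle_type (S - T) t)" by simp
    have "cycle_type (T \<union> (S - T)) s = cycle_type T s + cycle_type (S - T) s"
      by (rule cycle_type_Un) (use finT s(1) sT sR in auto)
    moreover have "cycle_type (T \<union> (S - T)) t = cycle_type T t + cycle_type (S - T) t"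
      by (rule cycle_type_Un) (use finT s(1) tT tR in auto)
    moreover have "T \<union> (S - T) = S" using subT by auto
    ultimately show ?thesis using compatible_add[OF T R] by simp
  qed
qed

text \<open>The probability of the type is its weight, which is positive.\<close>

lemma ex_permutation_cycle_type:
  assumes "finite S" "M \<in> types (card S) (card S)"
  shows "\<exists>p. p permutes S \<and> cycle_type S p = M"
proof (rule ccontr)
  assume none: "\<not> ?thesis"
  define F where "F N = (if N = M then 1 else 0 :: real)" for N
  have "(\<Sum>p | p permutes S. F (cycle_type S p)) = 0"
    using none by (intro sum.neutral) (auto simp: F_def)
  moreover have "(\<Sum>N\<in>types (card S) (card S). weight N * F N) = weight M"
    unfolding F_def using assms(2) by (simp add: finite_types if_distrib[of "\<lambda>x. _ * x"] cong: if_cong)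
  moreover have "weight M > 0"
    unfolding weight_def using assms(2) by (intro prod_pos) (auto simp: types_def)
  ultimately show False using sum_permutations_cycle_type[OF assms(1), of F] by simp
qed

lemma ex_full_cycle:
  assumes "finite T" "T \<noteq> {}"
  shows "\<exists>r. r permutes T \<and> (\<forall>x\<in>T. \<forall>m. (r ^^ m) x = x \<longleftrightarrow> card T dvd m)"
proof -
  have "card T > 0" using assms by (simp add: card_gt_0_iff)
  then have "{#card T#} \<in> types (card T) (card T)" by (auto simp: types_def)
  then obtain r where r: "r permutes T" "cycle_type T r = {#card T#}"
    using ex_permutation_cycle_type[OF assms(1)] by blast
  note bij = permutes_bij_betw[OF r(1)]
  have "(r ^^ m) x = x \<longleftrightarrow> card T dvd m" if x: "x \<in> T" for x m
  proof -
    have card: "card (orb r x) = card T"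
      using cycle_type_remove_orb[OF assms(1) bij x] r(2) by simp
    have "(r ^^ m) x = (r ^^ (m mod card T)) x"
      using funpow_mod_eq[of "card T" r x m] orb_period(2)[OF assms(1) bij x] card by simp
    then show ?thesis
      using orb_period(3)[OF assms(1) bij x, of "m mod card T"] card \<open>card T > 0\<close>
      by (cases "m mod card T = 0") (auto simp: dvd_eq_mod_eq_0)
  qed
  with r(1) show ?thesis by blast
qed

text \<open>Both permutations are powers of one cycle of length \<open>lcm a b\<close>.\<close>

lemma commuting_on_block:
  assumes "finite T" "card T = lcm a b" "0 < a" "0 < b"
  shows "\<exists>s t. s permutes T \<and> t permutes T \<and> (\<forall>x. s (t x) = t (s x)) \<and>
    cycle_type T s = replicate_mset (lcm a b div a) a \<and> cycle_type T t = replicate_mset (lcm a b div b) b"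
proof -
  have "T \<noteq> {}" using assms(2-4) by auto
  obtain r where r: "r permutes T" "\<And>x m. x \<in> T \<Longrightarrow> (r ^^ m) x = x \<longleftrightarrow> card T dvd m"
    using ex_full_cycle[OF assms(1) \<open>T \<noteq> {}\<close>] by auto
  have power: "(r ^^ (card T div c)) permutes T \<and> cycle_type T (r ^^ (card T div c)) = replicate_mset (card T div c) c"
    if c: "0 < c" "c dvd card T" for c
  proof
    let ?d = "card T div c"
    have d: "card T = c * ?d" "?d > 0" using c \<open>T \<noteq> {}\<close> assms(1) by (auto simp: card_gt_0_iff)
    show per: "(r ^^ ?d) permutes T" by (rule permutes_funpow[OF r(1)])
    have fix_iff: "((r ^^ ?d) ^^ k) x = x \<longleftrightarrow> c dvd k" if "x \<in> T" for x k
    proof -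
      have "((r ^^ ?d) ^^ k) x = (r ^^ (?d * k)) x" by (simp add: funpow_mult mult.commute)
      also have "\<dots> = x \<longleftrightarrow> ?d * c dvd ?d * k" using r(2)[OF that, of "?d * k"] d(1) by (simp add: mult.commute)
      also have "\<dots> \<longleftrightarrow> c dvd k" using d(2) by simp
      finally show ?thesis .
    qed
    have "card (orb (r ^^ ?d) x) = c" if "x \<in> T" for x
      by (rule card_orb_eq_period) (use fix_iff[OF that] c in \<open>auto dest: dvd_imp_le\<close>)
    then show "cycle_type T (r ^^ ?d) = replicate_mset ?d c"
      using cycle_type_const(1)[OF assms(1) permutes_bij_betw[OF per]] c(1) by blast
  qed
  have "(r ^^ (card T div a)) ((r ^^ (card T div b)) x) = (r ^^ (card T div b)) ((r ^^ (card T div a)) x)" for x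
    by (metis add.commute comp_apply funpow_add)
  then show ?thesis using power[of a] power[of b] assms(2-4) by auto
qed

lemma permutes_disjoint_commute:
  assumes "p permutes A" "q permutes B" "A \<inter> B = {}"
  shows "p (q x) = q (p x)"
proof -
  have "x \<notin> A \<or> x \<notin> B" using assms(3) by auto
  then show ?thesis
  proof
    assume "x \<notin> A"
    moreover from this have "q x \<notin> A" using assms
      using permutes_in_image[OF assms(2), of x] by (cases "x \<in> B") (auto simp: permutes_not_in)
    ultimately show ?thesis using assms(1) by (simp add: permutes_not_in)
  next
    assume "x \<notin> B"
    moreover from this have "p x \<notin> B" using assms
      using permutes_in_image[OF assms(1), of x] by (cases "x \<in> A") (auto simp: permutes_not_in)
    ultimately show ?thesis using assms(2) by (simp add: permutes_not_in)
  qed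
qed

lemma cycle_type_comp_disjoint:
  assumes "finite A" "finite B" "p permutes A" "q permutes B" "A \<inter> B = {}"
  shows "p \<circ> q permutes A \<union> B" "cycle_type (A \<union> B) (p \<circ> q) = cycle_type A p + cycle_type B q"
proof -
  show "p \<circ> q permutes A \<union> B"
    using assms by (intro permutes_compose) (auto intro: permutes_subset)
  have A: "(p \<circ> q) y = p y" if "y \<in> A" for y
    using that assms(5) permutes_not_in[OF assms(4), of y] by (auto simp: disjoint_iff)
  have B: "(p \<circ> q) y = q y" if "y \<in> B" for y
  proof -
    have "q y \<notin> A" using that assms(5) permutes_in_image[OF assms(4), of y] by blast
    then show ?thesis using permutes_not_in[OF assms(3)] by simp
  qed
  have bA: "bij_betw (p \<circ> q) A A" using permutes_bij_betw[OF assms(3)] A by (simp cong: bij_betw_cong)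
  have bB: "bij_betw (p \<circ> q) B B" using permutes_bij_betw[OF assms(4)] B by (simp cong: bij_betw_cong)
  have "cycle_type A (p \<circ> q) = cycle_type A p"
    by (rule cycle_type_cong) (use bij_betwE[OF bA] A in auto)
  moreover have "cycle_type B (p \<circ> q) = cycle_type B q"
    by (rule cycle_type_cong) (use bij_betwE[OF bB] B in auto)
  ultimately show "cycle_type (A \<union> B) (p \<circ> q) = cycle_type A p + cycle_type B q"
    using cycle_type_Un[OF assms(1) bA assms(2) bB assms(5)] by simp
qed

lemma blocks_realized_by_commuting:
  assumes "finite S" "card S = (\<Sum>(a, b)\<in>#B. lcm a b)" "\<forall>(a, b)\<in>#B. 0 < a \<and> 0 < b"
  shows "\<exists>s t. s permutes S \<and> t permutes S \<and> (\<forall>x. s (t x) = t (s x)) \<and>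
    cycle_type S s = left_type B \<and> cycle_type S t = right_type B"
  using assms
proof (induction B arbitrary: S)
  case empty
  then have "S = {}" by simp
  then show ?case by (intro exI[of _ id]) (simp add: fun_eq_iff)
next
  case (add ab B)
  obtain a b where ab: "ab = (a, b)" by (cases ab)
  have pos: "0 < a" "0 < b" using add.prems(3) by (auto simp: ab)
  have "lcm a b \<le> card S" using add.prems(2) by (simp add: ab)
  then obtain T where T: "T \<subseteq> S" "card T = lcm a b" "finite T"
    by (rule obtain_subset_with_card_n)
  obtain s1 t1 where 1: "s1 permutes T" "t1 permutes T" "\<And>x. s1 (t1 x) = t1 (s1 x)"
    "cycle_type T s1 = replicate_mset (lcm a b div a) a" "cycle_type T t1 = replicate_mset (lcm a b div b) b"
    using commuting_on_block[OF T(3,2) pos] by auto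
  have "card (S - T) = (\<Sum>(a, b)\<in>#B. lcm a b)"
    using add.prems(1,2) T by (simp add: card_Diff_subset ab)
  then obtain s0 t0 where 0: "s0 permutes S - T" "t0 permutes S - T" "\<And>x. s0 (t0 x) = t0 (s0 x)"
    "cycle_type (S - T) s0 = left_type B" "cycle_type (S - T) t0 = right_type B"
    using add.IH[of "S - T"] add.prems(1,3) by auto
  have S: "T \<union> (S - T) = S" "T \<inter> (S - T) = {}" using T by auto
  have fin: "finite (S - T)" using add.prems(1) by simp
  note s = cycle_type_comp_disjoint[OF T(3) fin 1(1) 0(1) S(2), unfolded S(1)]
  note t = cycle_type_comp_disjoint[OF T(3) fin 1(2) 0(2) S(2), unfolded S(1)]
  have c1: "t1 (s0 x) = s0 (t1 x)" for x by (rule permutes_disjoint_commute[OF 1(2) 0(1) S(2)])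
  have c2: "s1 (t0 x) = t0 (s1 x)" for x by (rule permutes_disjoint_commute[OF 1(1) 0(2) S(2)])
  have "(s1 \<circ> s0) ((t1 \<circ> t0) x) = (t1 \<circ> t0) ((s1 \<circ> s0) x)" for x
    by (simp add: c1[symmetric] c2[symmetric] 1(3)) (simp add: c1 c2 0(3) 1(3)[symmetric])
  moreover have "cycle_type S (s1 \<circ> s0) = left_type (add_mset ab B)"
    "cycle_type S (t1 \<circ> t0) = right_type (add_mset ab B)"
    using s(2) t(2) 0(4,5) 1(4,5) by (simp_all add: ab)
  ultimately show ?case using s(1) t(1) by blast
qed

lemma sum_mset_left_type:
  "\<forall>(a, b)\<in>#B. 0 < a \<and> 0 < b \<Longrightarrow> sum_mset (left_type B) = (\<Sum>(a, b)\<in>#B. lcm a b)"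
  by (induction B) auto

lemma compatible_imp_commuting:
  assumes "finite S" "sum_mset M = card S" "compatible M M'"
  shows "\<exists>s t. s permutes S \<and> t permutes S \<and> (\<forall>x. s (t x) = t (s x)) \<and> cycle_type S s = M \<and> cycle_type S t = M'"
proof -
  obtain B where B: "\<forall>(a, b)\<in>#B. 0 < a \<and> 0 < b" "M = left_type B" "M' = right_type B"
    using assms(3) unfolding compatible_def by blast
  then show ?thesis
    using blocks_realized_by_commuting[OF assms(1) _ B(1)] sum_mset_left_type[OF B(1)] assms(2) by simp
qed

lemma conjugates_sym_group:
  "conjugates (sym_group n) p = {g \<circ> p \<circ> inv' g | g. g permutes {1..n}}"
proof -
  have "(x = g \<otimes>\<^bsub>sym_group n\<^esub> p \<otimes>\<^bsub>sym_group n\<^esub> inv\<^bsub>sym_group n\<^esub> g \<and> g \<in> carrier (sym_group n))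
    \<longleftrightarrow> (x = g \<circ> p \<circ> inv' g \<and> g permutes {1..n})" for x g
    using sym_group_inv_equality[of g n] by (auto simp: sym_group_carrier sym_group_mult)
  then show ?thesis unfolding conjugates_def by simp
qed

text \<open>Conjugates have the same cycle type, and conversely all permutations of one type are conjugate, so
  commuting representatives may be replaced by conjugates of the given permutations.\<close>

lemma have_commuting_conjugates_iff:
  assumes "p permutes {1..n}" "q permutes {1..n}"
  shows "have_commuting_conjugates (sym_group n) p q
    \<longleftrightarrow> compatible (cycle_type {1..n} p) (cycle_type {1..n} q)"
proof
  assume "have_commuting_conjugates (sym_group n) p q"
  then obtain g h where gh: "g permutes {1..n}" "h permutes {1..n}"
    "(g \<circ> p \<circ> inv' g) \<circ> (h \<circ> q \<circ> inv' h) = (h \<circ> q \<circ> inv' h) \<circ> (g \<circ> p \<circ> inv' g)"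
    unfolding have_commuting_conjugates_def conjugates_sym_group sym_group_mult by blast
  let ?p = "g \<circ> p \<circ> inv' g" and ?q = "h \<circ> q \<circ> inv' h"
  have "?p permutes {1..n}" "?q permutes {1..n}"
    using gh(1,2) assms by (simp_all add: permutes_compose permutes_inv)
  then have "compatible (cycle_type {1..n} ?p) (cycle_type {1..n} ?q)"
    using gh(3) by (intro commuting_imp_compatible permutes_bij_betw) (auto simp: fun_eq_iff)
  then show "compatible (cycle_type {1..n} p) (cycle_type {1..n} q)"
    using cycle_type_conjugate[OF _ assms(1) gh(1)] cycle_type_conjugate[OF _ assms(2) gh(2)] by simp
next
  assume comp: "compatible (cycle_type {1..n} p) (cycle_type {1..n} q)"
  have "sum_mset (cycle_type {1..n} p) = card {1..n}"
    by (rule sum_mset_cycle_type) (use assms permutes_bij_betw in auto)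
  from compatible_imp_commuting[OF _ this comp]
  obtain s t where st: "s permutes {1..n}" "t permutes {1..n}" "\<forall>x. s (t x) = t (s x)"
    "cycle_type {1..n} s = cycle_type {1..n} p" "cycle_type {1..n} t = cycle_type {1..n} q" by auto
  obtain g where g: "g permutes {1..n}" "s = g \<circ> p \<circ> inv' g"
    using same_cycle_type_conjugate[OF _ assms(1) st(1)] st(4) by auto
  obtain h where h: "h permutes {1..n}" "t = h \<circ> q \<circ> inv' h"
    using same_cycle_type_conjugate[OF _ assms(2) st(2)] st(5) by auto
  have "s \<in> conjugates (sym_group n) p" "t \<in> conjugates (sym_group n) q"
    unfolding conjugates_sym_group using g h by blast+
  moreover have "s \<circ> t = t \<circ> s" using st(3) by (simp add: fun_eq_iff)
  ultimately show "have_commuting_conjugates (sym_group n) p q"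
    unfolding have_commuting_conjugates_def sym_group_mult by blast
qed



section \<open>Probabilities of compatibility and the removal of a block\<close>

definition compatible_pairs :: "nat \<Rightarrow> nat \<Rightarrow> (nat multiset \<times> nat multiset) set" where
  "compatible_pairs n k = {(M, M'). M \<in> types n k \<and> M' \<in> types n k \<and> compatible M M'}"

definition compatible_prob :: "nat \<Rightarrow> nat \<Rightarrow> real" where
  "compatible_prob n k = (\<Sum>(M, M')\<in>compatible_pairs n k. weight M * weight M')"

text \<open>The probability that all cycles of a random permutation have length at most \<open>k\<close>.\<close>

definition bounded_prob :: "nat \<Rightarrow> nat \<Rightarrow> real" where
  "bounded_prob n k = (\<Sum>M\<in>types n k. weight M)"

lemma compatible_pairs_subset: "compatible_pairs n k \<subseteq> types n k \<times> types n k"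
  by (auto simp: compatible_pairs_def)

lemma finite_compatible_pairs: "finite (compatible_pairs n k)"
  by (rule finite_subset[OF compatible_pairs_subset]) (simp add: finite_types)

lemma weight_pair_nonneg: "0 \<le> (case x of (M, M') \<Rightarrow> weight M * weight M')"
  by (cases x) (simp add: weight_nonneg)

lemma compatible_prob_nonneg: "0 \<le> compatible_prob n k"
  unfolding compatible_prob_def by (intro sum_nonneg) (rule weight_pair_nonneg)

lemma bounded_prob_nonneg: "0 \<le> bounded_prob n k"
  unfolding bounded_prob_def by (intro sum_nonneg) (rule weight_nonneg)

lemma compatible_prob_mono: "k \<le> l \<Longrightarrow> compatible_prob n k \<le> compatible_prob n l"
  unfolding compatible_prob_def
  using types_mono[of k l n] weight_pair_nonneg
  by (intro sum_mono2 finite_compatible_pairs) (auto simp: compatible_pairs_def)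

lemma compatible_prob_large: "n \<le> k \<Longrightarrow> compatible_prob n k = compatible_prob n n"
  by (simp add: compatible_prob_def compatible_pairs_def types_large[of n k])

lemma compatible_prob_le_square: "compatible_prob n k \<le> (bounded_prob n k)\<^sup>2"
proof -
  have "compatible_prob n k \<le> (\<Sum>(M, M')\<in>types n k \<times> types n k. weight M * weight M')"
    unfolding compatible_prob_def using compatible_pairs_subset weight_pair_nonneg
    by (intro sum_mono2) (auto simp: finite_types)
  also have "\<dots> = (bounded_prob n k)\<^sup>2"
    by (simp add: bounded_prob_def power2_eq_square sum_product sum.cartesian_product)
  finally show ?thesis .
qed

text \<open>Mark a point and remove its cycle.\<close>

lemma bounded_prob_rec: "real n * bounded_prob n k = (\<Sum>a=1..min n k. bounded_prob (n - a) k)"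
proof -
  have "real n * bounded_prob n k = (\<Sum>M\<in>types n k. weight M * (\<Sum>a\<in>#M. real a * 1))"
    unfolding bounded_prob_def sum_distrib_left
    by (intro sum.cong refl) (auto simp: types_def)
  also have "\<dots> = (\<Sum>a=1..min n k. \<Sum>N\<in>types (n - a) k. weight N * 1)"
    by (rule sum_types_remove_part[of "\<lambda>_ _. 1"])
  finally show ?thesis by (simp add: bounded_prob_def)
qed

lemma bounded_prob_0: "bounded_prob 0 k = 1"
  by (simp add: bounded_prob_def types_0_left)

lemma compatible_prob_0: "compatible_prob 0 k = 1"
proof -
  have "compatible_pairs 0 k = {({#}, {#})}"
    using compatible_empty by (auto simp: compatible_pairs_def types_0_left)
  then show ?thesis by (simp add: compatible_prob_def)
qed

lemma compatible_prob_0_right: "0 < n \<Longrightarrow> compatible_prob n 0 = 0"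
  by (simp add: compatible_prob_def compatible_pairs_def types_0_right)

text \<open>Compatibility depends on the cycle types only, so the distribution of the cycle type is applied
  to each of the two independent permutations.\<close>

theorem rho_sym_group: "rho (sym_group n) = compatible_prob n n"
proof -
  define A where "A = {p. p permutes {1..n}}"
  define F where "F M M' = (if compatible M M' then 1 else 0 :: real)" for M M'
  let ?ct = "cycle_type {1..n}"
  have carrier: "carrier (sym_group n) = A" by (simp add: A_def sym_group_def)
  have finA: "finite A" by (simp add: A_def finite_permutations)
  have cardA: "card A = fact n" unfolding A_def using card_permutations[of "{1..n}" n] by simp
  have "id \<in> A" by (simp add: A_def permutes_id)
  then have "A \<noteq> {}" by blast
  have distr: "(\<Sum>p\<in>A. G (?ct p)) = fact n * (\<Sum>M\<in>types n n. weight M * G M)" for G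
    using sum_permutations_cycle_type[of "{1..n}" G] by (simp add: A_def)
  let ?X = "{(x, y). have_commuting_conjugates (sym_group n) x y}"
  have "rho (sym_group n) = measure_pmf.prob (pmf_of_set (A \<times> A)) ?X"
  proof -
    have "pair_pmf (pmf_of_set A) (pmf_of_set A) = pmf_of_set (A \<times> A)"
    proof (rule pmf_eqI)
      fix z show "pmf (pair_pmf (pmf_of_set A) (pmf_of_set A)) z = pmf (pmf_of_set (A \<times> A)) z"
        using finA \<open>A \<noteq> {}\<close>
        by (cases z) (auto simp: pmf_pair pmf_of_set indicator_def card_cartesian_product)
    qed
    then show ?thesis unfolding rho_def carrier by simp
  qed
  also have "\<dots> = card ((A \<times> A) \<inter> ?X) / card (A \<times> A)"
    using finA \<open>A \<noteq> {}\<close> by (intro measure_pmf_of_set) auto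
  also have "real (card ((A \<times> A) \<inter> ?X)) = (\<Sum>z\<in>A \<times> A. if z \<in> ?X then 1 else 0)"
    using finA by (simp add: sum.If_cases)
  also have "\<dots> = (\<Sum>p\<in>A. \<Sum>q\<in>A. F (?ct p) (?ct q))"
    unfolding sum.cartesian_product
    by (intro sum.cong refl) (auto simp: F_def A_def have_commuting_conjugates_iff)
  also have "\<dots> = (\<Sum>p\<in>A. fact n * (\<Sum>M'\<in>types n n. weight M' * F (?ct p) M'))"
    by (intro sum.cong refl distr)
  also have "\<dots> = fact n * (\<Sum>M\<in>types n n. weight M * (fact n * (\<Sum>M'\<in>types n n. weight M' * F M M')))"
    by (rule distr)
  also have "\<dots> = (fact n)\<^sup>2 * (\<Sum>(M, M')\<in>types n n \<times> types n n. weight M * weight M' * F M M')"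
    unfolding sum.cartesian_product[symmetric]
    by (simp add: sum_distrib_left power2_eq_square mult_ac)
  also have "(\<Sum>(M, M')\<in>types n n \<times> types n n. weight M * weight M' * F M M') = compatible_prob n n"
    unfolding compatible_prob_def
    by (rule sum.mono_neutral_cong_right)
      (auto simp: compatible_pairs_def F_def finite_types split: if_splits)
  finally show ?thesis by (simp add: cardA card_cartesian_product power2_eq_square)
qed

definition block_weight :: "nat \<Rightarrow> nat \<Rightarrow> real" where
  "block_weight a b = 1 / (real a ^ (lcm a b div a) * fact (lcm a b div a) *
    (real b ^ (lcm a b div b) * fact (lcm a b div b)))"

lemma block_weight_nonneg: "0 \<le> block_weight a b"
  by (simp add: block_weight_def)

lemma block_weight_commute: "block_weight a b = block_weight b a"
  by (simp add: block_weight_def lcm.commute mult_ac)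

text \<open>Equality holds if \<open>N\<close> has no part \<open>a\<close>; otherwise \<open>fact c * fact i \<le> fact (c + i)\<close> is used.\<close>

lemma weight_add_replicate_le:
  assumes "a > 0"
  shows "weight (N + replicate_mset i a) \<le> weight N / (real a ^ i * fact i)"
proof -
  let ?c = "count N a"
  have "fact ?c * fact i \<le> (fact (?c + i) :: real)"
    using binomial_fact_lemma[of i "?c + i"]
    by (metis fact_fact_dvd_fact dvd_imp_le fact_gt_zero of_nat_fact of_nat_le_iff of_nat_mult)
  have "weight (N + replicate_mset i a) * (real a ^ i * fact i) * fact ?c
      \<le> weight (N + replicate_mset i a) * (real a ^ i * fact (?c + i))"
    using \<open>fact ?c * fact i \<le> fact (?c + i)\<close> weight_nonneg[of "N + replicate_mset i a"]
    by (simp add: mult.assoc mult_left_mono mult.commute[of "fact i"])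
  also have "\<dots> = weight N * fact ?c" by (rule weight_replicate[OF assms])
  finally have "weight (N + replicate_mset i a) * (real a ^ i * fact i) \<le> weight N" by simp
  then show ?thesis using assms by (simp add: field_simps)
qed

lemma left_type_member_block:
  assumes "x \<in># left_type B"
  obtains y where "(x, y) \<in># B"
proof -
  have "\<exists>y. (x, y) \<in># B" using assms by (induction B) (fastforce split: if_splits)+
  then show ?thesis using that by blast
qed

lemma right_type_member_block:
  assumes "y \<in># right_type B"
  obtains x where "(x, y) \<in># B"
proof -
  have "\<exists>x. (x, y) \<in># B" using assms by (induction B) (fastforce split: if_splits)+
  then show ?thesis using that by blast
qed

lemma sum_UNION_le:
  fixes f :: "'b \<Rightarrow> real"
  assumes "finite I" "\<And>i. i \<in> I \<Longrightarrow> finite (A i)" "\<And>x. 0 \<le> f x"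
  shows "sum f (\<Union>i\<in>I. A i) \<le> (\<Sum>i\<in>I. sum f (A i))"
  using assms(1,2)
proof (induction I rule: finite_induct)
  case (insert i I)
  have "sum f (A i \<union> (\<Union>i\<in>I. A i)) \<le> sum f (A i) + sum f (\<Union>i\<in>I. A i)"
    using insert.prems insert.hyps assms(3) by (subst sum_Un) (auto intro!: sum_nonneg)
  then show ?case using insert by fastforce
qed simp

definition large_blocks :: "nat \<Rightarrow> nat \<Rightarrow> nat \<Rightarrow> (nat \<times> nat) set" where
  "large_blocks n k K = {(a, b). a \<in> {1..k} \<and> b \<in> {1..k} \<and> K < max a b \<and> lcm a b \<le> n}"

lemma finite_large_blocks: "finite (large_blocks n k K)"
  by (rule finite_subset[of _ "{1..k} \<times> {1..k}"]) (auto simp: large_blocks_def)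

text \<open>A compatible pair that is not counted by \<open>compatible_prob n K\<close> has a part above \<open>K\<close>, which belongs
  to some block \<open>(a, b)\<close> of a decomposition.  Removing this block leaves a compatible pair of degree
  \<open>n - lcm a b\<close>, from which the original pair is recovered by adding the block; the weight of the
  block bounds the loss.  The inequality is the union bound over all such blocks.\<close>

theorem compatible_prob_remove_block:
  "compatible_prob n k \<le> compatible_prob n K
    + (\<Sum>(a, b)\<in>large_blocks n k K. block_weight a b * compatible_prob (n - lcm a b) k)"
proof -
  let ?f = "\<lambda>(M, M'). weight M * weight M'"
  define \<phi> where "\<phi> = (\<lambda>(a, b) (N, N'). (N + replicate_mset (lcm a b div a) a, N' + replicate_mset (lcm a b div b) b))"
  define A where "A = (\<lambda>(a, b). \<phi> (a, b) ` compatible_pairs (n - lcm a b) k)"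
  have fA: "finite (A i)" for i by (cases i) (simp add: A_def finite_compatible_pairs)
  have cover: "compatible_pairs n k \<subseteq> compatible_pairs n K \<union> (\<Union>i\<in>large_blocks n k K. A i)"
  proof
    fix x assume "x \<in> compatible_pairs n k"
    then obtain M M' where x: "x = (M, M')" "M \<in> types n k" "M' \<in> types n k" "compatible M M'"
      by (auto simp: compatible_pairs_def)
    then obtain B where B: "\<forall>(a, b)\<in>#B. 0 < a \<and> 0 < b" "M = left_type B" "M' = right_type B"
      unfolding compatible_def by blast
    show "x \<in> compatible_pairs n K \<union> (\<Union>i\<in>large_blocks n k K. A i)"
    proof (cases "M \<in> types n K \<and> M' \<in> types n K")
      case True
      then show ?thesis using x by (simp add: compatible_pairs_def)
    next
      case False
      have "\<exists>a b. (a, b) \<in># B \<and> K < max a b"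
      proof (cases "M \<in> types n K")
        case False
        then obtain a where "a \<in># M" "K < a" using x(2) by (auto simp: types_def subset_iff not_le)
        then show ?thesis using B(2) left_type_member_block[of a B] by (metis less_max_iff_disj)
      next
        case True
        then obtain b where "b \<in># M'" "K < b" using False x(3) by (auto simp: types_def subset_iff not_le)
        then show ?thesis using B(3) right_type_member_block[of b B] by (metis less_max_iff_disj)
      qed
      then obtain a b C where ab: "B = add_mset (a, b) C" "K < max a b"
        by (metis insert_DiffM)
      have pos: "0 < a" "0 < b" using B(1) ab(1) by auto
      have M: "M = left_type C + replicate_mset (lcm a b div a) a"
        "M' = right_type C + replicate_mset (lcm a b div b) b"
        using B ab by simp_all
      have "lcm a b div a > 0" "lcm a b div b > 0" using pos by (simp_all add: div_greater_zero_iff dvd_imp_le lcm_pos_nat)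
      then have k: "a \<le> k" "b \<le> k" using x(2,3) M by (auto simp: types_def)
      have L: "sum_mset (left_type C) + lcm a b = n" "sum_mset (right_type C) + lcm a b = n"
        using x(2,3) M by (auto simp: types_def)
      have "(left_type C, right_type C) \<in> compatible_pairs (n - lcm a b) k"
        using L x(2,3) M B(1) ab(1) unfolding compatible_pairs_def compatible_def types_def by auto
      then have "x \<in> A (a, b)" unfolding A_def \<phi>_def x(1) M by auto
      moreover have "(a, b) \<in> large_blocks n k K" using pos k ab(2) L(1) by (auto simp: large_blocks_def)
      ultimately show ?thesis by blast
    qed
  qed
  have block: "sum ?f (A (a, b)) \<le> block_weight a b * compatible_prob (n - lcm a b) k"
    if "(a, b) \<in> large_blocks n k K" for a b
  proof -
    have pos: "0 < a" "0 < b" using that by (auto simp: large_blocks_def)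
    have "inj_on (\<phi> (a, b)) (compatible_pairs (n - lcm a b) k)" by (auto simp: \<phi>_def inj_on_def)
    then have "sum ?f (A (a, b)) = (\<Sum>x\<in>compatible_pairs (n - lcm a b) k. ?f (\<phi> (a, b) x))"
      by (simp add: A_def sum.reindex)
    also have "\<dots> \<le> (\<Sum>x\<in>compatible_pairs (n - lcm a b) k. block_weight a b * ?f x)"
    proof (intro sum_mono)
      fix x :: "nat multiset \<times> nat multiset"
      obtain N N' where x: "x = (N, N')" by (cases x)
      have "weight (N + replicate_mset (lcm a b div a) a) * weight (N' + replicate_mset (lcm a b div b) b)
        \<le> (weight N / (real a ^ (lcm a b div a) * fact (lcm a b div a))) *
          (weight N' / (real b ^ (lcm a b div b) * fact (lcm a b div b)))"
        using pos by (intro mult_mono weight_add_replicate_le weight_nonneg divide_nonneg_nonneg) auto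
      then show "?f (\<phi> (a, b) x) \<le> block_weight a b * ?f x"
        by (simp add: x \<phi>_def block_weight_def mult_ac)
    qed
    also have "\<dots> = block_weight a b * compatible_prob (n - lcm a b) k"
      by (simp add: compatible_prob_def sum_distrib_left)
    finally show ?thesis .
  qed
  have "compatible_prob n k \<le> sum ?f (compatible_pairs n K \<union> (\<Union>i\<in>large_blocks n k K. A i))"
    unfolding compatible_prob_def using cover weight_pair_nonneg
    by (intro sum_mono2) (auto simp: finite_compatible_pairs finite_large_blocks fA)
  also have "\<dots> \<le> sum ?f (compatible_pairs n K) + sum ?f (\<Union>i\<in>large_blocks n k K. A i)"
    using weight_pair_nonneg
    by (subst sum_Un) (auto simp: finite_compatible_pairs finite_large_blocks fA intro!: sum_nonneg)
  also have "sum ?f (\<Union>i\<in>large_blocks n k K. A i) \<le> (\<Sum>i\<in>large_blocks n k K. sum ?f (A i))"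
    by (rule sum_UNION_le) (auto simp: finite_large_blocks fA weight_pair_nonneg)
  also have "\<dots> \<le> (\<Sum>(a, b)\<in>large_blocks n k K. block_weight a b * compatible_prob (n - lcm a b) k)"
    using block by (intro sum_mono) auto
  finally show ?thesis by (simp add: compatible_prob_def)
qed

lemma mult_count_left_type:
  assumes "finite J" "\<forall>(x, y)\<in>#B. x = a \<longrightarrow> y \<in> J" "a > 0"
  shows "a * count (left_type B) a = (\<Sum>b\<in>J. lcm a b * count B (a, b))"
  using assms(2)
proof (induction B)
  case (add xy B)
  obtain x y where xy: "xy = (x, y)" by (cases xy)
  have "(\<Sum>b\<in>J. lcm a b * count (add_mset xy B) (a, b))
      = (\<Sum>b\<in>J. lcm a b * count B (a, b) + (if b = y then (if x = a then lcm a y else 0) else 0))"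
    by (intro sum.cong) (auto simp: xy)
  also have "\<dots> = (\<Sum>b\<in>J. lcm a b * count B (a, b)) + (if x = a then lcm a y else 0)"
    using add.prems assms(1) by (auto simp: sum.distrib xy)
  also have "(\<Sum>b\<in>J. lcm a b * count B (a, b)) = a * count (left_type B) a"
    using add by auto
  finally show ?case using assms(3) by (auto simp: xy algebra_simps)
qed simp

lemma mult_count_right_type:
  assumes "finite J" "\<forall>(x, y)\<in>#B. y = b \<longrightarrow> x \<in> J" "b > 0"
  shows "b * count (right_type B) b = (\<Sum>a\<in>J. lcm a b * count B (a, b))"
proof -
  have "b * count (left_type (image_mset prod.swap B)) b = (\<Sum>a\<in>J. lcm b a * count (image_mset prod.swap B) (b, a))"
    by (rule mult_count_left_type) (use assms in auto)
  moreover have "count (image_mset prod.swap B) (b, a) = count B (a, b)" for a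
    by (induction B) auto
  ultimately show ?thesis by (simp add: left_type_swap lcm.commute)
qed

text \<open>The largest mass that parts \<open>a\<close> of total mass \<open>s\<close> and parts \<open>b\<close> of total mass \<open>t\<close> can share, as
  this mass comes in units of \<open>lcm a b\<close>.\<close>

definition capacity :: "nat \<Rightarrow> nat \<Rightarrow> nat \<Rightarrow> nat \<Rightarrow> nat" where
  "capacity a s b t = min s t - min s t mod lcm a b"

text \<open>The mass of the parts \<open>a\<close> has to be distributed over blocks with parts of \<open>M'\<close>.  This necessary
  condition looks at one \<open>a\<close> at a time and ignores that different \<open>a\<close> compete for the same parts of
  \<open>M'\<close>, but it can be tested without any search.\<close>

lemma compatible_capacity:
  assumes "compatible M M'" "a > 0"
  shows "a * count M a \<le> (\<Sum>b\<in>set_mset M'. capacity a (a * count M a) b (b * count M' b))"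
proof -
  obtain B where B: "\<forall>(a, b)\<in>#B. 0 < a \<and> 0 < b" "M = left_type B" "M' = right_type B"
    using assms(1) unfolding compatible_def by blast
  have mem: "x \<in># M" "y \<in># M'" if "(x, y) \<in># B" for x y
  proof -
    obtain C where C: "B = add_mset (x, y) C" using multi_member_split[OF \<open>(x, y) \<in># B\<close>] by blast
    then have "0 < x" "0 < y" using B(1) by auto
    then have "lcm x y div x > 0" "lcm x y div y > 0" by (simp_all add: div_greater_zero_iff dvd_imp_le lcm_pos_nat)
    then show "x \<in># M" "y \<in># M'" using B(2,3) C by auto
  qed
  have left: "a * count M a = (\<Sum>b\<in>set_mset M'. lcm a b * count B (a, b))"
    unfolding B(2) by (rule mult_count_left_type) (use mem assms(2) in auto)
  also have "\<dots> \<le> (\<Sum>b\<in>set_mset M'. capacity a (a * count M a) b (b * count M' b))"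
  proof (intro sum_mono)
    fix b assume b: "b \<in> set_mset M'"
    then obtain x where "(x, b) \<in># B" using B(3) right_type_member_block by blast
    then have "b > 0" using B(1) by auto
    have "b * count M' b = (\<Sum>x\<in>set_mset M \<union> {a}. lcm x b * count B (x, b))"
      unfolding B(3) by (rule mult_count_right_type) (use mem B(2) \<open>b > 0\<close> in auto)
    then have 1: "lcm a b * count B (a, b) \<le> b * count M' b"
      using member_le_sum[of a "set_mset M \<union> {a}" "\<lambda>x. lcm x b * count B (x, b)"] by simp
    have 2: "lcm a b * count B (a, b) \<le> a * count M a"
      unfolding left using member_le_sum[of b "set_mset M'" "\<lambda>b. lcm a b * count B (a, b)"] b by simp
    let ?m = "min (a * count M a) (b * count M' b)"
    have "lcm a b > 0" using assms(2) \<open>b > 0\<close> by (simp add: lcm_pos_nat)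
    then have "count B (a, b) \<le> ?m div lcm a b" using 1 2 by (simp add: less_eq_div_iff_mult_less_eq mult.commute)
    then have "lcm a b * count B (a, b) \<le> lcm a b * (?m div lcm a b)" by (rule mult_le_mono2)
    also have "\<dots> = ?m - ?m mod lcm a b" by (simp add: minus_mod_eq_mult_div)
    finally show "lcm a b * count B (a, b) \<le> capacity a (a * count M a) b (b * count M' b)"
      by (simp add: capacity_def)
  qed
  finally show ?thesis .
qed

section \<open>Enumerating cycle types\<close>

text \<open>Split a type according to the multiplicity of its largest admissible part.\<close>

lemma types_Suc_sum:
  fixes G :: "nat multiset \<Rightarrow> real"
  shows "(\<Sum>M\<in>types n (Suc k). weight M * G M) = (\<Sum>m\<le>n div Suc k.
    \<Sum>N\<in>types (n - Suc k * m) k. weight N / (real (Suc k) ^ m * fact m) * G (N + replicate_mset m (Suc k)))"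
proof -
  let ?a = "Suc k"
  have "(\<Sum>M\<in>types n ?a. weight M * G M) = (\<Sum>(m, N)\<in>Sigma {..n div ?a} (\<lambda>m. types (n - ?a * m) k).
    weight N / (real ?a ^ m * fact m) * G (N + replicate_mset m ?a))"
  proof (rule sum.reindex_bij_witness[of _ "\<lambda>(m, N). N + replicate_mset m ?a"
        "\<lambda>M. (count M ?a, M - replicate_mset (count M ?a) ?a)"], goal_cases)
    case (1 M)
    then show ?case by (simp add: multiset_eq_iff)
  next
    case (2 M)
    define m where "m = count M ?a"
    define N where "N = M - replicate_mset m ?a"
    have M: "M = N + replicate_mset m ?a" by (simp add: N_def m_def multiset_eq_iff)
    have "count N ?a = 0" by (simp add: N_def m_def)
    then have "?a \<notin># N" by (simp add: not_in_iff)
    moreover have "set_mset N \<subseteq> {1..?a}" using 2 by (auto simp: types_def N_def dest: in_diffD)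
    ultimately have "set_mset N \<subseteq> {1..k}" by (auto simp: subset_iff le_Suc_eq)
    moreover have "sum_mset N + m * ?a = n" using 2 by (auto simp: types_def M)
    moreover from this have "m \<le> n div ?a" by (auto simp: less_eq_div_iff_mult_less_eq)
    ultimately show ?case unfolding m_def[symmetric] N_def[symmetric] by (auto simp: types_def mult.commute)
  next
    case (3 x)
    then obtain m N where x: "x = (m, N)" "N \<in> types (n - ?a * m) k" by auto
    then have "?a \<notin># N" by (auto simp: types_def)
    then show ?case by (simp add: x(1) not_in_iff)
  next
    case (4 x)
    then obtain m N where x: "x = (m, N)" "m \<le> n div ?a" "N \<in> types (n - ?a * m) k" by auto
    then have "m * ?a \<le> n" by (simp add: less_eq_div_iff_mult_less_eq)
    then have "n - ?a * m + m * ?a = n" by (simp add: mult.commute)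
    then show ?case using x(3) by (auto simp: x(1) types_def le_SucI split: if_splits)
  next
    case (5 M)
    define m where "m = count M ?a"
    define N where "N = M - replicate_mset m ?a"
    have M: "M = N + replicate_mset m ?a" by (simp add: N_def m_def multiset_eq_iff)
    have "count N ?a = 0" by (simp add: N_def m_def)
    then have "weight M * (real ?a ^ m * fact m) = weight N"
      using weight_replicate[of ?a N m] by (simp add: M)
    then have "weight N / (real ?a ^ m * fact m) = weight M" by (simp add: field_simps)
    then show ?case unfolding m_def[symmetric] N_def[symmetric] prod.case M[symmetric] by (simp only:)
  qed
  also have "\<dots> = (\<Sum>m\<le>n div ?a. \<Sum>N\<in>types (n - ?a * m) k.
      weight N / (real ?a ^ m * fact m) * G (N + replicate_mset m ?a))"
    by (rule sum.Sigma[symmetric]) (auto simp: finite_types)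
  finally show ?thesis .
qed

text \<open>For evaluation by rewriting, a type is a list of its distinct parts, each with the sum of its
  copies, which is what the capacity criterion needs.  Parts stay small and are unary numbers; masses
  and weights are binary integers.\<close>

type_synonym mass_list = "(nat \<times> int) list"

primrec copies_factor :: "nat \<Rightarrow> nat \<Rightarrow> int" where
  "copies_factor a 0 = 1"
| "copies_factor a (Suc m) = copies_factor a m * (int a * int (Suc m))"

definition add_copies :: "nat \<Rightarrow> nat \<Rightarrow> int \<times> mass_list \<Rightarrow> int \<times> mass_list" where
  "add_copies a m zp = (case zp of (z, p) \<Rightarrow>
    (z * copies_factor a m, if m = 0 then p else (a, int a * int m) # p))"

text \<open>Each type is listed with the inverse of its weight.\<close>

primrec list_types :: "nat \<Rightarrow> nat \<Rightarrow> (int \<times> mass_list) list" where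
  "list_types 0 n = (if n = 0 then [(1, [])] else [])"
| "list_types (Suc k) n = concat (map (\<lambda>m. map (add_copies (Suc k) m) (list_types k (n - Suc k * m)))
    [0..<Suc (n div Suc k)])"

definition mset_of :: "mass_list \<Rightarrow> nat multiset" where
  "mset_of p = sum_list (map (\<lambda>(a, A). replicate_mset (nat A div a) a) p)"

definition valid_masses :: "nat \<Rightarrow> mass_list \<Rightarrow> bool" where
  "valid_masses k p \<longleftrightarrow> distinct (map fst p) \<and> (\<forall>(a, A)\<in>set p. 0 < a \<and> a \<le> k \<and> 0 < A \<and> int a dvd A)"

lemma mset_of_simps [simp]:
  "mset_of [] = {#}" "mset_of ((a, A) # p) = replicate_mset (nat A div a) a + mset_of p"
  by (simp_all add: mset_of_def)

lemma copies_factor: "of_int (copies_factor a m) = (real a ^ m * fact m :: real)"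
  by (induction m) (simp_all add: algebra_simps)

lemma copies_factor_pos: "0 < a \<Longrightarrow> 0 < copies_factor a m"
  by (induction m) simp_all

lemma list_types_valid:
  "(z, p) \<in> set (list_types k n) \<Longrightarrow> 0 < z \<and> valid_masses k p"
proof (induction k arbitrary: n z p)
  case 0
  then show ?case by (auto simp: valid_masses_def split: if_splits)
next
  case (Suc k)
  then obtain m y q where q: "(y, q) \<in> set (list_types k (n - Suc k * m))" "(z, p) = add_copies (Suc k) m (y, q)"
    by auto
  from Suc.IH[OF q(1)] have y: "0 < y" "valid_masses k q" by auto
  have z: "z = y * copies_factor (Suc k) m" using q(2) by (simp add: add_copies_def)
  have "0 < z" unfolding z using y(1) copies_factor_pos[of "Suc k" m] by simp
  moreover have "valid_masses (Suc k) p"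
  proof (cases "m = 0")
    case True
    then show ?thesis using q(2) y(2) by (auto simp: add_copies_def valid_masses_def)
  next
    case False
    then have p: "p = (Suc k, int (Suc k) * int m) # q" using q(2) by (simp add: add_copies_def)
    have "Suc k \<notin> fst ` set q" using y(2) by (auto simp: valid_masses_def)
    then show ?thesis using y(2) False unfolding p valid_masses_def
      by (auto simp del: of_nat_Suc intro: le_SucI)
  qed
  ultimately show ?case by simp
qed

lemma sum_list_concat_map:
  "sum_list (map f (concat (map g xs))) = sum_list (map (\<lambda>x. sum_list (map f (g x))) xs)"
  by (induction xs) simp_all

lemma sum_types_list:
  fixes G :: "nat multiset \<Rightarrow> real"
  shows "(\<Sum>M\<in>types n k. weight M * G M) = (\<Sum>(z, p)\<leftarrow>list_types k n. G (mset_of p) / of_int z)"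
proof (induction k arbitrary: n G)
  case 0
  then show ?case by (simp add: types_0_right)
next
  case (Suc k)
  let ?a = "Suc k"
  have "(\<Sum>M\<in>types n ?a. weight M * G M) = (\<Sum>m\<le>n div ?a.
    \<Sum>N\<in>types (n - ?a * m) k. weight N * (G (N + replicate_mset m ?a) / (real ?a ^ m * fact m)))"
    unfolding types_Suc_sum by (simp del: of_nat_Suc)
  also have "\<dots> = (\<Sum>m\<le>n div ?a. \<Sum>(z, p)\<leftarrow>list_types k (n - ?a * m).
      (G (mset_of p + replicate_mset m ?a) / (real ?a ^ m * fact m)) / of_int z)"
    by (simp only: Suc.IH[where G = "\<lambda>N. G (N + replicate_mset m ?a) / (real ?a ^ m * fact m)" for m])
  also have "\<dots> = (\<Sum>m\<le>n div ?a. \<Sum>(z, p)\<leftarrow>map (add_copies ?a m) (list_types k (n - ?a * m)).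
      G (mset_of p) / of_int z)"
  proof (intro sum.cong refl)
    fix m
    have "G (mset_of p + replicate_mset m ?a) / (real ?a ^ m * fact m) / of_int z
      = (case add_copies ?a m (z, p) of (z, p) \<Rightarrow> G (mset_of p) / of_int z)" for z p
    proof -
      have "nat (int ?a * int m) div ?a = m"
        by (metis mult.commute nat_int nonzero_mult_div_cancel_right of_nat_mult Zero_neq_Suc)
      then have "mset_of (snd (add_copies ?a m (z, p))) = mset_of p + replicate_mset m ?a"
        by (simp add: add_copies_def add.commute del: of_nat_Suc)
      then show ?thesis by (simp add: add_copies_def copies_factor mult.commute del: of_nat_Suc)
    qed
    then show "(\<Sum>(z, p)\<leftarrow>list_types k (n - ?a * m).
        G (mset_of p + replicate_mset m ?a) / (real ?a ^ m * fact m) / of_int z)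
      = (\<Sum>(z, p)\<leftarrow>map (add_copies ?a m) (list_types k (n - ?a * m)). G (mset_of p) / of_int z)"
      unfolding map_map by (intro arg_cong[of _ _ sum_list] map_cong) auto
  qed
  also have "\<dots> = (\<Sum>(z, p)\<leftarrow>list_types ?a n. G (mset_of p) / of_int z)"
    unfolding list_types.simps sum_list_concat_map
    by (simp only: sum_list_distinct_conv_sum_set distinct_upt set_upt atLeast0LessThan lessThan_Suc_atMost)
  finally show ?case .
qed

section \<open>Exact sums over pairs of cycle types\<close>

definition pair_term :: "int \<times> mass_list \<Rightarrow> int \<times> mass_list \<Rightarrow> real" where
  "pair_term x y = (if compatible (mset_of (snd x)) (mset_of (snd y)) then 1 / (of_int (fst x) * of_int (fst y)) else 0)"

lemma pair_term_commute: "pair_term x y = pair_term y x"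
  by (simp add: pair_term_def compatible_commute mult.commute)

lemma compatible_prob_list:
  "compatible_prob n k = (\<Sum>x\<leftarrow>list_types k n. \<Sum>y\<leftarrow>list_types k n. pair_term x y)"
proof -
  have "compatible_prob n k = (\<Sum>(M, M')\<in>types n k \<times> types n k. if compatible M M' then weight M * weight M' else 0)"
    unfolding compatible_prob_def
    by (rule sum.mono_neutral_cong_left) (auto simp: compatible_pairs_def finite_types split: if_splits)
  also have "\<dots> = (\<Sum>M\<in>types n k. weight M * (\<Sum>M'\<in>types n k. weight M' * (if compatible M M' then 1 else 0)))"
    unfolding sum.cartesian_product[symmetric] sum_distrib_left
    by (intro sum.cong refl) simp
  also have "\<dots> = (\<Sum>(z, p)\<leftarrow>list_types k n.
      (\<Sum>(z', q)\<leftarrow>list_types k n. (if compatible (mset_of p) (mset_of q) then 1 else 0) / of_int z') / of_int z)"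
    by (simp only: sum_types_list)
  also have "\<dots> = (\<Sum>x\<leftarrow>list_types k n. \<Sum>y\<leftarrow>list_types k n. pair_term x y)"
    unfolding pair_term_def
    by (intro arg_cong[of _ _ sum_list] map_cong refl)
      (auto simp: sum_list_mult_const[symmetric] divide_inverse intro!: arg_cong[of _ _ sum_list])
  finally show ?thesis .
qed

primrec row_sum :: "(mass_list \<Rightarrow> mass_list \<Rightarrow> bool) \<Rightarrow> mass_list \<Rightarrow> (int \<times> mass_list) list \<Rightarrow> int" where
  "row_sum f p [] = 0"
| "row_sum f p (y # ys) = (case y of (w, q) \<Rightarrow> if f p q then w + row_sum f p ys else row_sum f p ys)"

text \<open>A symmetric double sum in which all diagonal pairs are counted, every type being compatible with
  itself.\<close>

primrec pair_sum :: "(mass_list \<Rightarrow> mass_list \<Rightarrow> bool) \<Rightarrow> (int \<times> mass_list) list \<Rightarrow> int" where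
  "pair_sum f [] = 0"
| "pair_sum f (x # xs) = (case x of (w, p) \<Rightarrow> w * (w + 2 * row_sum f p xs) + pair_sum f xs)"

lemma sum_pairs_Cons:
  fixes c :: "'a \<Rightarrow> 'a \<Rightarrow> real"
  assumes "\<And>x y. c x y = c y x"
  shows "(\<Sum>x\<leftarrow>a # l. \<Sum>y\<leftarrow>a # l. c x y) = c a a + 2 * (\<Sum>y\<leftarrow>l. c a y) + (\<Sum>x\<leftarrow>l. \<Sum>y\<leftarrow>l. c x y)"
proof -
  have "(\<Sum>x\<leftarrow>l. c x a) = (\<Sum>y\<leftarrow>l. c a y)" by (simp add: assms[of _ a])
  then show ?thesis by (simp add: sum_list_addf)
qed

text \<open>Weights are scaled by \<open>D\<close> and rounded to integers.  In the applications \<open>D\<close> is the factorial of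
  the degree, for which the rounding is exact.\<close>

lemma pair_sum_upper:
  fixes D :: int
  assumes D: "0 < D" and "\<And>z p. (z, p) \<in> set l \<Longrightarrow> 0 < z"
    and f: "\<And>z p z' q. (z, p) \<in> set l \<Longrightarrow> (z', q) \<in> set l \<Longrightarrow> compatible (mset_of p) (mset_of q) \<Longrightarrow> f p q"
  shows "(\<Sum>x\<leftarrow>l. \<Sum>y\<leftarrow>l. pair_term x y) * of_int (D\<^sup>2)
    \<le> of_int (pair_sum f (map (\<lambda>(z, p). (- ((- D) div z), p)) l))"
  using assms(2,3)
proof (induction l)
  case (Cons x l)
  obtain z p where x: "x = (z, p)" by (cases x)
  define up where "up z = - ((- D) div z)" for z
  have up: "of_int D / of_int z \<le> (of_int (up z) :: real)" "0 \<le> up z" if "0 < z" for z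
  proof -
    have "of_int D / of_int z \<le> (of_int \<lceil>of_int D / of_int z :: real\<rceil> :: real)" by simp
    then show "of_int D / of_int z \<le> (of_int (up z) :: real)" by (simp add: up_def ceiling_divide_eq_div)
    have "(- D) div z \<le> 0" using that D by (simp add: div_nonpos_pos_le0)
    then show "0 \<le> up z" by (simp add: up_def)
  qed
  have z: "0 < z" using Cons.prems(1) by (auto simp: x)
  have row: "(\<Sum>y\<leftarrow>l'. pair_term x y) * of_int (D\<^sup>2)
      \<le> of_int (up z) * of_int (row_sum f p (map (\<lambda>(z, p). (up z, p)) l'))"
    if "set l' \<subseteq> set l" for l'
    using that
  proof (induction l')
    case (Cons y l')
    obtain z' q where y: "y = (z', q)" by (cases y)
    have z': "0 < z'" using Cons.prems \<open>\<And>z p. (z, p) \<in> set (x # l) \<Longrightarrow> 0 < z\<close> by (auto simp: y)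
    have "pair_term x y * of_int (D\<^sup>2) \<le> (if f p q then of_int (up z) * of_int (up z') else 0)"
    proof (cases "compatible (mset_of p) (mset_of q)")
      case True
      then have "f p q" using Cons.prems \<open>\<And>z p z' q. (z, p) \<in> set (x # l) \<Longrightarrow> (z', q) \<in> set (x # l) \<Longrightarrow>
          compatible (mset_of p) (mset_of q) \<Longrightarrow> f p q\<close>[of z p z' q] by (auto simp: x y)
      moreover have "pair_term x y * of_int (D\<^sup>2) = (of_int D / of_int z) * (of_int D / of_int z')"
        using True by (simp add: x y pair_term_def power2_eq_square)
      moreover have "\<dots> \<le> of_int (up z) * of_int (up z')"
        using up[OF z] up[OF z'] D z z' by (intro mult_mono) auto
      ultimately show ?thesis by simp
    next
      case False
      then show ?thesis using up(2)[OF z] up(2)[OF z'] by (simp add: x y pair_term_def)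
    qed
    moreover have "(\<Sum>y\<leftarrow>l'. pair_term x y) * of_int (D\<^sup>2)
      \<le> of_int (up z) * of_int (row_sum f p (map (\<lambda>(z, p). (up z, p)) l'))"
      using Cons by auto
    ultimately show ?case by (auto simp: y algebra_simps)
  qed simp
  have diag: "pair_term x x * of_int (D\<^sup>2) \<le> of_int (up z) * of_int (up z)"
  proof -
    have "pair_term x x * of_int (D\<^sup>2) \<le> (of_int D / of_int z) * (of_int D / of_int z)"
      by (simp add: x pair_term_def power2_eq_square)
    also have "\<dots> \<le> of_int (up z) * of_int (up z)"
      using up[OF z] D z by (intro mult_mono) auto
    finally show ?thesis .
  qed
  have "(\<Sum>x\<leftarrow>l. \<Sum>y\<leftarrow>l. pair_term x y) * of_int (D\<^sup>2)
      \<le> of_int (pair_sum f (map (\<lambda>(z, p). (up z, p)) l))"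
    unfolding up_def
  proof (rule Cons.IH)
    show "0 < z" if "(z, p) \<in> set l" for z p using Cons.prems(1)[of z p] that by simp
    show "f p q" if "(z, p) \<in> set l" "(z', q) \<in> set l" "compatible (mset_of p) (mset_of q)" for z p z' q
      using Cons.prems(2)[of z p z' q] that by simp
  qed
  then show ?case
    using row[OF order_refl] diag
    unfolding sum_pairs_Cons[of pair_term, OF pair_term_commute]
    by (simp add: x up_def[symmetric] algebra_simps)
qed simp

lemma compatible_refl:
  assumes "0 \<notin># M"
  shows "compatible M M"
  using assms
proof (induction M)
  case (add a M)
  have "compatible {#a#} {#a#}" using compatible_block[of a a] add.prems by simp
  then show ?case using compatible_add[of M M "{#a#}" "{#a#}"] add by simp
qed (simp add: compatible_empty)

lemma pair_sum_lower:
  fixes D :: int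
  assumes D: "0 < D" and "\<And>z p. (z, p) \<in> set l \<Longrightarrow> 0 < z \<and> 0 \<notin># mset_of p"
    and f: "\<And>z p z' q. (z, p) \<in> set l \<Longrightarrow> (z', q) \<in> set l \<Longrightarrow> f p q \<Longrightarrow> compatible (mset_of p) (mset_of q)"
  shows "of_int (pair_sum f (map (\<lambda>(z, p). (D div z, p)) l))
    \<le> (\<Sum>x\<leftarrow>l. \<Sum>y\<leftarrow>l. pair_term x y) * of_int (D\<^sup>2)"
  using assms(2,3)
proof (induction l)
  case (Cons x l)
  obtain z p where x: "x = (z, p)" by (cases x)
  have lo: "of_int (D div z) \<le> (of_int D / of_int z :: real)" "0 \<le> D div z" if "0 < z" for z
  proof -
    have "of_int \<lfloor>of_int D / of_int z :: real\<rfloor> \<le> (of_int D / of_int z :: real)" by simp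
    then show "of_int (D div z) \<le> (of_int D / of_int z :: real)" by (simp add: floor_divide_of_int_eq)
    show "0 \<le> D div z" using that D by (simp add: pos_imp_zdiv_nonneg_iff)
  qed
  have z: "0 < z" using Cons.prems(1) by (auto simp: x)
  have row: "of_int (D div z) * of_int (row_sum f p (map (\<lambda>(z, p). (D div z, p)) l'))
      \<le> (\<Sum>y\<leftarrow>l'. pair_term x y) * of_int (D\<^sup>2)"
    if "set l' \<subseteq> set l" for l'
    using that
  proof (induction l')
    case (Cons y l')
    obtain z' q where y: "y = (z', q)" by (cases y)
    have z': "0 < z'" using Cons.prems \<open>\<And>z p. (z, p) \<in> set (x # l) \<Longrightarrow> 0 < z \<and> 0 \<notin># mset_of p\<close> by (auto simp: y)
    have "(if f p q then of_int (D div z) * of_int (D div z') else 0) \<le> pair_term x y * of_int (D\<^sup>2)"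
    proof (cases "f p q")
      case True
      then have "compatible (mset_of p) (mset_of q)"
        using Cons.prems \<open>\<And>z p z' q. (z, p) \<in> set (x # l) \<Longrightarrow> (z', q) \<in> set (x # l) \<Longrightarrow>
          f p q \<Longrightarrow> compatible (mset_of p) (mset_of q)\<close>[of z p z' q] by (auto simp: x y)
      then have "pair_term x y * of_int (D\<^sup>2) = (of_int D / of_int z) * (of_int D / of_int z')"
        by (simp add: x y pair_term_def power2_eq_square)
      moreover have "of_int (D div z) * of_int (D div z') \<le> (of_int D / of_int z) * (of_int D / of_int z' :: real)"
        using lo[OF z] lo[OF z'] D z z' by (intro mult_mono) auto
      ultimately show ?thesis using True by simp
    next
      case False
      then show ?thesis using z z' by (simp add: x y pair_term_def)
    qed
    moreover have "of_int (D div z) * of_int (row_sum f p (map (\<lambda>(z, p). (D div z, p)) l'))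
      \<le> (\<Sum>y\<leftarrow>l'. pair_term x y) * of_int (D\<^sup>2)"
      using Cons by auto
    ultimately show ?case by (auto simp: y algebra_simps)
  qed simp
  have diag: "of_int (D div z) * of_int (D div z) \<le> pair_term x x * of_int (D\<^sup>2)"
  proof -
    have "of_int (D div z) * of_int (D div z) \<le> (of_int D / of_int z) * (of_int D / of_int z :: real)"
      using lo[OF z] D z by (intro mult_mono) auto
    also have "\<dots> = pair_term x x * of_int (D\<^sup>2)"
      using compatible_refl[of "mset_of p"] Cons.prems(1)[of z p]
      by (simp add: x pair_term_def power2_eq_square)
    finally show ?thesis .
  qed
  have "of_int (pair_sum f (map (\<lambda>(z, p). (D div z, p)) l))
      \<le> (\<Sum>x\<leftarrow>l. \<Sum>y\<leftarrow>l. pair_term x y) * of_int (D\<^sup>2)"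
  proof (rule Cons.IH)
    show "0 < z \<and> 0 \<notin># mset_of p" if "(z, p) \<in> set l" for z p using Cons.prems(1)[of z p] that by simp
    show "compatible (mset_of p) (mset_of q)" if "(z, p) \<in> set l" "(z', q) \<in> set l" "f p q" for z p z' q
      using Cons.prems(2)[of z p z' q] that by simp
  qed
  then show ?case
    using row[OF order_refl] diag
    unfolding sum_pairs_Cons[of pair_term, OF pair_term_commute]
    by (simp add: x algebra_simps)
qed simp

text \<open>Computing a least common multiple by rewriting is slow, so those up to 12 are tabulated.  The first
  row and column only shift the indices.  The diagonal entries are 1, which makes \<open>room m 1 = m\<close>
  available without a division: masses of equal parts are multiples of the part.\<close>

definition lcm_table :: "int list list" where
  "lcm_table =
    [[],
     [0, 1, 2, 3, 4, 5, 6, 7, 8, 9, 10, 11, 12],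
     [0, 2, 1, 6, 4, 10, 6, 14, 8, 18, 10, 22, 12],
     [0, 3, 6, 1, 12, 15, 6, 21, 24, 9, 30, 33, 12],
     [0, 4, 4, 12, 1, 20, 12, 28, 8, 36, 20, 44, 12],
     [0, 5, 10, 15, 20, 1, 30, 35, 40, 45, 10, 55, 60],
     [0, 6, 6, 6, 12, 30, 1, 42, 24, 18, 30, 66, 12],
     [0, 7, 14, 21, 28, 35, 42, 1, 56, 63, 70, 77, 84],
     [0, 8, 8, 24, 8, 40, 24, 56, 1, 72, 40, 88, 24],
     [0, 9, 18, 9, 36, 45, 18, 63, 72, 1, 90, 99, 36],
     [0, 10, 10, 30, 20, 10, 30, 70, 40, 90, 1, 110, 60],
     [0, 11, 22, 33, 44, 55, 66, 77, 88, 99, 110, 1, 132],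
     [0, 12, 12, 12, 12, 60, 12, 84, 24, 36, 60, 132, 1]]"

lemma lcm_table:
  assumes "a \<in> {1..12}" "b \<in> {1..12}"
  shows "lcm_table ! a ! b = (if a = b then 1 else int (lcm a b))"
proof -
  have "list_all (\<lambda>a. list_all (\<lambda>b. lcm_table ! a ! b = (if a = b then 1 else lcm (int a) (int b)))
    [1..<13]) [1..<13]"
    by code_simp
  then have "lcm_table ! a ! b = (if a = b then 1 else lcm (int a) (int b))"
    using assms unfolding list_all_iff by simp
  then show ?thesis by simp
qed

text \<open>The cases before the last one avoid the remainder, which is costly to compute by rewriting.\<close>

definition room :: "int \<Rightarrow> int \<Rightarrow> int" where
  "room m L = (if L = 1 then m else if m < L then 0 else if m < L + L then L else m - m mod L)"

primrec row_room :: "int list \<Rightarrow> int \<Rightarrow> mass_list \<Rightarrow> int" where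
  "row_room Ls A [] = 0"
| "row_room Ls A (x # q) = (case x of (b, B) \<Rightarrow> room (if A \<le> B then A else B) (Ls ! b) + row_room Ls A q)"

primrec rows_fit :: "mass_list \<Rightarrow> mass_list \<Rightarrow> bool" where
  "rows_fit [] q = True"
| "rows_fit (x # p) q = (case x of (a, A) \<Rightarrow> if A \<le> row_room (lcm_table ! a) A q then rows_fit p q else False)"

definition fits :: "mass_list \<Rightarrow> mass_list \<Rightarrow> bool" where
  "fits p q = (if rows_fit p q then rows_fit q p else False)"

lemma count_mset_of:
  "distinct (map fst p) \<Longrightarrow> (a, A) \<in> set p \<Longrightarrow> count (mset_of p) a = nat A div a"
  "a \<notin> fst ` set p \<Longrightarrow> count (mset_of p) a = 0"
proof -
  show 0: "count (mset_of p) a = 0" if "a \<notin> fst ` set p" for p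
    using that by (induction p) auto
  show "distinct (map fst p) \<Longrightarrow> (a, A) \<in> set p \<Longrightarrow> count (mset_of p) a = nat A div a"
  proof (induction p)
    case (Cons x p)
    obtain b B where x: "x = (b, B)" by (cases x)
    show ?case
    proof (cases "(a, A) = x")
      case True
      then have "a \<notin> fst ` set p" using Cons.prems x by auto
      then show ?thesis using 0[of p] True x by auto
    next
      case False
      then have mem: "(a, A) \<in> set p" using Cons.prems by simp
      then have "a \<noteq> b" using Cons.prems x by force
      then show ?thesis using Cons mem x by simp
    qed
  qed simp
qed

lemma valid_masses_count:
  assumes "valid_masses k p" "(a, A) \<in> set p"
  shows "a * count (mset_of p) a = nat A"
proof -
  have A: "0 < A" "int a dvd A" using assms by (auto simp: valid_masses_def)
  then have "a dvd nat A" by (simp add: nat_dvd_iff int_dvd_int_iff[symmetric] del: int_dvd_int_iff)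
  then show ?thesis using count_mset_of(1)[of p a A] assms by (simp add: valid_masses_def)
qed

lemma set_mset_of:
  assumes "valid_masses k p"
  shows "set_mset (mset_of p) = fst ` set p"
proof (rule Set.set_eqI)
  fix a
  show "a \<in># mset_of p \<longleftrightarrow> a \<in> fst ` set p"
  proof (cases "a \<in> fst ` set p")
    case True
    then obtain A where A: "(a, A) \<in> set p" by auto
    then have "0 < nat A" using assms by (auto simp: valid_masses_def)
    then have "0 < count (mset_of p) a" using valid_masses_count[OF assms A] by (metis gr0I mult_0_right)
    then show ?thesis using True by simp
  next
    case False
    then show ?thesis using count_mset_of(2) by (auto simp: not_in_iff)
  qed
qed

lemma capacity_le_room:
  assumes "a \<in> {1..12}" "b \<in> {1..12}" "0 \<le> A" "0 \<le> B"
  shows "int (capacity a (nat A) b (nat B)) \<le> room (if A \<le> B then A else B) (lcm_table ! a ! b)"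
proof -
  define m where "m = min (nat A) (nat B)"
  have m: "(if A \<le> B then A else B) = int m" using assms by (auto simp: m_def min_def)
  have cap: "int (capacity a (nat A) b (nat B)) = int m - int m mod int (lcm a b)"
    by (simp add: capacity_def m_def[symmetric] of_nat_diff of_nat_mod)
  show ?thesis
  proof (cases "a = b")
    case True
    have "0 \<le> int m mod int (lcm a b)" by (metis of_nat_0_le_iff of_nat_mod)
    then show ?thesis using True lcm_table[OF assms(1,2)] unfolding cap m by (simp add: room_def)
  next
    case False
    define L where "L = int (lcm a b)"
    have L: "lcm_table ! a ! b = L" "0 < L"
      using lcm_table[OF assms(1,2)] False assms(1,2) by (auto simp: L_def lcm_pos_nat)
    have "int m mod L = int m - L" if "L \<le> int m" "int m < L + L"
    proof -
      have "int m mod L = (int m - L + L) mod L" by simp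
      also have "\<dots> = (int m - L) mod L" by (rule mod_add_self2)
      also have "\<dots> = int m - L" by (rule mod_pos_pos_trivial) (use that in auto)
      finally show ?thesis .
    qed
    then show ?thesis unfolding cap m L(1) L_def[symmetric] room_def by auto
  qed
qed

lemma sum_capacity_le_row_room:
  assumes "valid_masses 12 q" "a \<in> {1..12}" "0 \<le> A"
  shows "int (\<Sum>b\<in>set_mset (mset_of q). capacity a (nat A) b (b * count (mset_of q) b)) \<le> row_room (lcm_table ! a) A q"
proof -
  have "(\<Sum>b\<in>set_mset (mset_of q). capacity a (nat A) b (b * count (mset_of q) b))
    = (\<Sum>b\<leftarrow>map fst q. capacity a (nat A) b (b * count (mset_of q) b))"
    unfolding set_mset_of[OF assms(1)] set_map[symmetric]
    by (rule sum.distinct_set_conv_list) (use assms(1) in \<open>simp add: valid_masses_def\<close>)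
  also have "\<dots> = (\<Sum>(b, B)\<leftarrow>q. capacity a (nat A) b (nat B))"
    unfolding map_map using valid_masses_count[OF assms(1)] by (intro arg_cong[of _ _ sum_list] map_cong) auto
  also have "int \<dots> \<le> row_room (lcm_table ! a) A q"
  proof -
    have "int (\<Sum>(b, B)\<leftarrow>q'. capacity a (nat A) b (nat B)) \<le> row_room (lcm_table ! a) A q'"
      if "set q' \<subseteq> set q" for q'
      using that
    proof (induction q')
      case (Cons x q')
      obtain b B where x: "x = (b, B)" by (cases x)
      have "b \<in> {1..12}" "0 \<le> B" using Cons.prems assms(1) by (auto simp: x valid_masses_def)
      then show ?case using capacity_le_room[OF assms(2) _ assms(3), of b B] Cons by (auto simp: x)
    qed simp
    then show ?thesis by simp
  qed
  finally show ?thesis .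
qed

lemma compatible_imp_rows_fit:
  assumes "valid_masses 12 p" "valid_masses 12 q" "compatible (mset_of p) (mset_of q)"
  shows "rows_fit p q"
proof -
  have "rows_fit p' q" if "set p' \<subseteq> set p" for p'
    using that
  proof (induction p')
    case (Cons x p')
    obtain a A where x: "x = (a, A)" by (cases x)
    have mem: "(a, A) \<in> set p" using Cons.prems by (simp add: x)
    then have a: "a \<in> {1..12}" "0 \<le> A" using assms(1) by (auto simp: valid_masses_def)
    have "nat A \<le> (\<Sum>b\<in>set_mset (mset_of q). capacity a (nat A) b (b * count (mset_of q) b))"
      using compatible_capacity[OF assms(3), of a] valid_masses_count[OF assms(1) mem] a(1) by simp
    then have "A \<le> row_room (lcm_table ! a) A q"
      using sum_capacity_le_row_room[OF assms(2) a] a(2) by linarith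
    then show ?case using Cons by (simp add: x)
  qed simp
  then show ?thesis by simp
qed

lemma compatible_imp_fits:
  assumes "valid_masses 12 p" "valid_masses 12 q" "compatible (mset_of p) (mset_of q)"
  shows "fits p q"
  using compatible_imp_rows_fit[OF assms] compatible_imp_rows_fit[OF assms(2,1)] assms(3)
  by (simp add: fits_def compatible_commute)

definition pair_sum_above :: "nat \<Rightarrow> nat \<Rightarrow> int \<Rightarrow> int" where
  "pair_sum_above n k D = pair_sum fits (map (\<lambda>(z, p). (- ((- D) div z), p)) (list_types k n))"

text \<open>All numerical bounds are stated in units of \<open>1 / 1000000000\<close>.\<close>

lemma compatible_prob_enumerated:
  assumes "k \<le> 12" "0 < D" "pair_sum_above n k D * 1000000000 \<le> v * D\<^sup>2"
  shows "compatible_prob n k * 1000000000 \<le> of_int v"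
proof -
  have valid: "0 < z \<and> valid_masses 12 p" if "(z, p) \<in> set (list_types k n)" for z p
    using list_types_valid[OF that] assms(1) by (auto simp: valid_masses_def)
  have "compatible_prob n k * of_int (D\<^sup>2) \<le> of_int (pair_sum_above n k D)"
    unfolding compatible_prob_list pair_sum_above_def
    by (rule pair_sum_upper[OF assms(2)]) (use valid compatible_imp_fits in blast)+
  then have "compatible_prob n k * of_int (D\<^sup>2) * 1000000000 \<le> of_int (pair_sum_above n k D * 1000000000)" by simp
  also have "\<dots> \<le> of_int (v * D\<^sup>2)" using assms(3) by (simp only: of_int_le_iff)
  finally have "(compatible_prob n k * 1000000000) * of_int (D\<^sup>2) \<le> of_int v * of_int (D\<^sup>2)" by (simp add: mult_ac)
  then show ?thesis using assms(2) by simp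
qed

section \<open>The lower bound in degree ten\<close>

text \<open>Remove the block that matches a single part \<open>a\<close> with copies of a divisor of \<open>a\<close>, namely of the
  first divisor in the list that has enough mass.\<close>

primrec take_mass :: "nat \<Rightarrow> mass_list \<Rightarrow> mass_list option" where
  "take_mass a [] = None"
| "take_mass a (x # q) = (case x of (b, B) \<Rightarrow>
    if a mod b = 0 \<and> int a \<le> B then Some (if B = int a then q else (b, B - int a) # q)
    else map_option (Cons (b, B)) (take_mass a q))"

text \<open>Repeatedly match the largest part of both lists.  The search never backtracks and finds only
  blocks in which one part divides the other, but it recognizes enough compatible pairs in degree 10.
  The first argument bounds the number of steps.\<close>

primrec greedy :: "nat \<Rightarrow> mass_list \<Rightarrow> mass_list \<Rightarrow> bool" where
  "greedy 0 p q = (case p of [] \<Rightarrow> (case q of [] \<Rightarrow> True | _ \<Rightarrow> False) | _ \<Rightarrow> False)"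
| "greedy (Suc t) p q = (case p of [] \<Rightarrow> (case q of [] \<Rightarrow> True | _ \<Rightarrow> False) | (a, A) # p' \<Rightarrow>
    (case q of [] \<Rightarrow> False | (b, B) # q' \<Rightarrow>
      if b \<le> a then (case take_mass a q of None \<Rightarrow> False
        | Some q'' \<Rightarrow> greedy t (if A = int a then p' else (a, A - int a) # p') q'')
      else (case take_mass b p of None \<Rightarrow> False
        | Some p'' \<Rightarrow> greedy t p'' (if B = int b then q' else (b, B - int b) # q'))))"

definition good_masses :: "mass_list \<Rightarrow> bool" where
  "good_masses p \<longleftrightarrow> (\<forall>(a, A)\<in>set p. 0 < a \<and> 0 < A \<and> int a dvd A)"

text \<open>Taking the mass \<open>a\<close> away from the parts \<open>b\<close> removes \<open>a div b\<close> copies.\<close>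

lemma replicate_mass_split:
  assumes "0 < b" "int b dvd B" "b dvd a" "int a \<le> B"
  shows "replicate_mset (nat B div b) b = replicate_mset (a div b) b + replicate_mset (nat (B - int a) div b) b"
    and "int b dvd B - int a"
proof -
  obtain k where k: "B = int b * int k"
    using assms(2,4) by (metis dvdE int_nat_eq nonneg_int_cases of_nat_0_le_iff order_trans zero_le_mult_iff
        assms(1) of_nat_0_less_iff order_less_imp_not_less linorder_not_le)
  obtain j where j: "a = b * j" using assms(3) by auto
  have "j \<le> k" using assms(1,4) by (simp add: k j)
  have "int (b * (k - j)) = int (b * k) - int (b * j)" unfolding diff_mult_distrib2
    by (rule of_nat_diff) (use \<open>j \<le> k\<close> in simp)
  then have "B - int a = int (b * (k - j))" by (simp only: k j of_nat_mult)
  then have "nat (B - int a) = b * (k - j)" by (simp only: nat_int)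
  moreover have "nat B = b * k" unfolding k of_nat_mult[symmetric] by (rule nat_int)
  ultimately
  show "replicate_mset (nat B div b) b = replicate_mset (a div b) b + replicate_mset (nat (B - int a) div b) b"
    using assms(1) \<open>j \<le> k\<close> by (simp add: j multiset_eq_iff)
  show "int b dvd B - int a" by (simp add: k j)
qed

lemma take_mass:
  assumes "take_mass a q = Some q'" "good_masses q" "0 < a"
  obtains b where "0 < b" "b dvd a" "mset_of q = replicate_mset (a div b) b + mset_of q'" "good_masses q'"
proof -
  have "\<exists>b. 0 < b \<and> b dvd a \<and> mset_of q = replicate_mset (a div b) b + mset_of q' \<and> good_masses q'"
    using assms(1,2)
  proof (induction q arbitrary: q')
    case (Cons x q)
    obtain b B where x: "x = (b, B)" by (cases x)
    have b: "0 < b" "int b dvd B" "good_masses q" using Cons.prems(2) by (auto simp: x good_masses_def)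
    show ?case
    proof (cases "a mod b = 0 \<and> int a \<le> B")
      case True
      then have q': "q' = (if B = int a then q else (b, B - int a) # q)" using Cons.prems(1) by (simp add: x)
      have dvd: "b dvd a" using True by auto
      note split = replicate_mass_split[OF b(1,2) dvd, OF conjunct2[OF True]]
      have "mset_of (x # q) = replicate_mset (a div b) b + mset_of q'"
        using split(1) by (simp add: x q')
      moreover have "good_masses q'" using b split(2) True by (auto simp: q' good_masses_def)
      ultimately show ?thesis using b(1) dvd by blast
    next
      case False
      then obtain q'' where q'': "take_mass a q = Some q''" "q' = (b, B) # q''"
        using Cons.prems(1) by (auto simp: x)
      from Cons.IH[OF q''(1) b(3)] obtain c where
        "0 < c" "c dvd a" "mset_of q = replicate_mset (a div c) c + mset_of q''" "good_masses q''" by blast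
      then show ?thesis using Cons.prems(2) by (intro exI[of _ c]) (auto simp: x q''(2) good_masses_def)
    qed
  qed simp
  then show ?thesis using that by blast
qed

lemma compatible_take:
  assumes "0 < a" "0 < b" "b dvd a" "compatible M M'"
  shows "compatible (replicate_mset 1 a + M) (replicate_mset (a div b) b + M')"
proof -
  have "lcm a b = a" using assms(3) by (simp add: lcm_proj1_if_dvd_nat)
  then show ?thesis using compatible_add[OF compatible_block[OF assms(1,2)] assms(4)] assms(1) by simp
qed

lemma greedy_step:
  assumes "take_mass a q = Some q'" "good_masses ((a, A) # p)" "good_masses q"
  obtains N N' where "compatible N N'"
    "mset_of ((a, A) # p) = N + mset_of (if A = int a then p else (a, A - int a) # p)"
    "mset_of q = N' + mset_of q'" "good_masses (if A = int a then p else (a, A - int a) # p)" "good_masses q'"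
proof -
  have a: "0 < a" "int a dvd A" "0 < A" "good_masses p" using assms(2) by (auto simp: good_masses_def)
  then have "int a \<le> A" by (simp add: zdvd_imp_le)
  note split = replicate_mass_split[OF a(1,2) dvd_refl this]
  obtain b where b: "0 < b" "b dvd a" "mset_of q = replicate_mset (a div b) b + mset_of q'" "good_masses q'"
    by (rule take_mass[OF assms(1,3) a(1)])
  have "compatible (replicate_mset 1 a) (replicate_mset (a div b) b)"
    using compatible_take[OF a(1) b(1,2) compatible_empty] by simp
  moreover have "mset_of ((a, A) # p) = replicate_mset 1 a + mset_of (if A = int a then p else (a, A - int a) # p)"
    using split(1) a(1) by simp
  moreover have "good_masses (if A = int a then p else (a, A - int a) # p)"
    using a split(2) \<open>int a \<le> A\<close> by (auto simp: good_masses_def)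
  ultimately show ?thesis using that b(3,4) by blast
qed

text \<open>Each step removes a block.\<close>

lemma greedy_imp_compatible:
  "greedy t p q \<Longrightarrow> good_masses p \<Longrightarrow> good_masses q \<Longrightarrow> compatible (mset_of p) (mset_of q)"
proof (induction t arbitrary: p q)
  case 0
  then show ?case by (auto split: list.splits simp: compatible_empty)
next
  case (Suc t)
  show ?case
  proof (cases p)
    case Nil
    then show ?thesis using Suc.prems by (auto split: list.splits simp: compatible_empty)
  next
    case p: (Cons x p')
    obtain a A where x: "x = (a, A)" by (cases x)
    obtain b B q' where q: "q = (b, B) # q'" using Suc.prems(1) by (cases q) (auto simp: p x)
    show ?thesis
    proof (cases "b \<le> a")
      case True
      then obtain q'' where q'': "take_mass a q = Some q''"
        "greedy t (if A = int a then p' else (a, A - int a) # p') q''"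
        using Suc.prems(1) by (auto simp: p x q split: option.splits)
      obtain N N' where N: "compatible N N'"
        "mset_of p = N + mset_of (if A = int a then p' else (a, A - int a) # p')"
        "mset_of q = N' + mset_of q''" "good_masses (if A = int a then p' else (a, A - int a) # p')" "good_masses q''"
        using greedy_step[OF q''(1), of A p'] Suc.prems(2,3) unfolding p x by metis
      show ?thesis unfolding N(2,3) by (rule compatible_add[OF N(1) Suc.IH[OF q''(2) N(4,5)]])
    next
      case False
      then obtain p'' where p'': "take_mass b p = Some p''"
        "greedy t p'' (if B = int b then q' else (b, B - int b) # q')"
        using Suc.prems(1) by (auto simp: p x q split: option.splits)
      obtain N N' where N: "compatible N N'"
        "mset_of q = N + mset_of (if B = int b then q' else (b, B - int b) # q')"
        "mset_of p = N' + mset_of p''" "good_masses (if B = int b then q' else (b, B - int b) # q')" "good_masses p''"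
        using greedy_step[OF p''(1), of B q'] Suc.prems(2,3) unfolding q by metis
      show ?thesis unfolding N(2,3) using compatible_add[OF compatible_sym[OF N(1)] Suc.IH[OF p''(2) N(5,4)]] .
    qed
  qed
qed

definition pair_sum_below :: "nat \<Rightarrow> nat \<Rightarrow> int \<Rightarrow> int" where
  "pair_sum_below n k D = pair_sum (greedy n) (map (\<lambda>(z, p). (D div z, p)) (list_types k n))"

lemma compatible_prob_below:
  assumes "0 < D" "v * D\<^sup>2 \<le> pair_sum_below n k D * 100000"
  shows "of_int v \<le> compatible_prob n k * 100000"
proof -
  have good: "0 < z \<and> 0 \<notin># mset_of p" "good_masses p" if "(z, p) \<in> set (list_types k n)" for z p
    using list_types_valid[OF that] set_mset_of[of k p] by (auto simp: valid_masses_def good_masses_def)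
  have "of_int (pair_sum_below n k D) \<le> compatible_prob n k * of_int (D\<^sup>2)"
    unfolding compatible_prob_list pair_sum_below_def
    by (rule pair_sum_lower[OF assms(1)]) (use good greedy_imp_compatible in blast)+
  then have "of_int (pair_sum_below n k D * 100000) \<le> compatible_prob n k * of_int (D\<^sup>2) * 100000" by simp
  moreover have "(of_int (v * D\<^sup>2) :: real) \<le> of_int (pair_sum_below n k D * 100000)"
    using assms(2) by (simp only: of_int_le_iff)
  ultimately have "of_int v * of_int (D\<^sup>2) \<le> (compatible_prob n k * 100000) * of_int (D\<^sup>2)" by (simp add: mult_ac)
  then show ?thesis using assms(1) by simp
qed

text \<open>Sums over the pairs that pass the capacity criterion, rounded up.\<close>

lemma enumerated_1_1: "compatible_prob 1 1 * 1000000000 \<le> 1000000000"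
proof -
  have "pair_sum_above 1 1 1 * 1000000000 \<le> 1000000000 * 1\<^sup>2" by code_simp
  from compatible_prob_enumerated[OF _ _ this] show ?thesis by simp
qed

lemma enumerated_2_2: "compatible_prob 2 2 * 1000000000 \<le> 1000000000"
proof -
  have "pair_sum_above 2 2 2 * 1000000000 \<le> 1000000000 * 2\<^sup>2" by code_simp
  from compatible_prob_enumerated[OF _ _ this] show ?thesis by simp
qed

lemma enumerated_3_3: "compatible_prob 3 3 * 1000000000 \<le> 666666667"
proof -
  have "pair_sum_above 3 3 6 * 1000000000 \<le> 666666667 * 6\<^sup>2" by code_simp
  from compatible_prob_enumerated[OF _ _ this] show ?thesis by simp
qed

lemma enumerated_4_4: "compatible_prob 4 4 * 1000000000 \<le> 458333334"
proof -
  have "pair_sum_above 4 4 24 * 1000000000 \<le> 458333334 * 24\<^sup>2" by code_simp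
  from compatible_prob_enumerated[OF _ _ this] show ?thesis by simp
qed

lemma enumerated_5_5: "compatible_prob 5 5 * 1000000000 \<le> 391666667"
proof -
  have "pair_sum_above 5 5 120 * 1000000000 \<le> 391666667 * 120\<^sup>2" by code_simp
  from compatible_prob_enumerated[OF _ _ this] show ?thesis by simp
qed

lemma enumerated_6_6: "compatible_prob 6 6 * 1000000000 \<le> 291666667"
proof -
  have "pair_sum_above 6 6 720 * 1000000000 \<le> 291666667 * 720\<^sup>2" by code_simp
  from compatible_prob_enumerated[OF _ _ this] show ?thesis by simp
qed

lemma enumerated_7_7: "compatible_prob 7 7 * 1000000000 \<le> 225297620"
proof -
  have "pair_sum_above 7 7 5040 * 1000000000 \<le> 225297620 * 5040\<^sup>2" by code_simp
  from compatible_prob_enumerated[OF _ _ this] show ?thesis by simp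
qed

lemma enumerated_8_8: "compatible_prob 8 8 * 1000000000 \<le> 173998016"
proof -
  have "pair_sum_above 8 8 40320 * 1000000000 \<le> 173998016 * 40320\<^sup>2" by code_simp
  from compatible_prob_enumerated[OF _ _ this] show ?thesis by simp
qed

lemma enumerated_9_9: "compatible_prob 9 9 * 1000000000 \<le> 139512787"
proof -
  have "pair_sum_above 9 9 362880 * 1000000000 \<le> 139512787 * 362880\<^sup>2" by code_simp
  from compatible_prob_enumerated[OF _ _ this] show ?thesis by simp
qed

lemma enumerated_10_10: "compatible_prob 10 10 * 1000000000 \<le> 114467652"
proof -
  have "pair_sum_above 10 10 3628800 * 1000000000 \<le> 114467652 * 3628800\<^sup>2" by code_simp
  from compatible_prob_enumerated[OF _ _ this] show ?thesis by simp
qed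

lemma enumerated_11_11: "compatible_prob 11 11 * 1000000000 \<le> 93560109"
proof -
  have "pair_sum_above 11 11 39916800 * 1000000000 \<le> 93560109 * 39916800\<^sup>2" by code_simp
  from compatible_prob_enumerated[OF _ _ this] show ?thesis by simp
qed

lemma enumerated_12_12: "compatible_prob 12 12 * 1000000000 \<le> 78505815"
proof -
  have "pair_sum_above 12 12 479001600 * 1000000000 \<le> 78505815 * 479001600\<^sup>2" by code_simp
  from compatible_prob_enumerated[OF _ _ this] show ?thesis by simp
qed

lemma enumerated_8_4: "compatible_prob 8 4 * 1000000000 \<le> 51194374"
proof -
  have "pair_sum_above 8 4 40320 * 1000000000 \<le> 51194374 * 40320\<^sup>2" by code_simp
  from compatible_prob_enumerated[OF _ _ this] show ?thesis by simp
qed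

lemma enumerated_9_4: "compatible_prob 9 4 * 1000000000 \<le> 30422585"
proof -
  have "pair_sum_above 9 4 362880 * 1000000000 \<le> 30422585 * 362880\<^sup>2" by code_simp
  from compatible_prob_enumerated[OF _ _ this] show ?thesis by simp
qed

lemma enumerated_10_4: "compatible_prob 10 4 * 1000000000 \<le> 12610844"
proof -
  have "pair_sum_above 10 4 3628800 * 1000000000 \<le> 12610844 * 3628800\<^sup>2" by code_simp
  from compatible_prob_enumerated[OF _ _ this] show ?thesis by simp
qed

lemma enumerated_11_4: "compatible_prob 11 4 * 1000000000 \<le> 5524818"
proof -
  have "pair_sum_above 11 4 39916800 * 1000000000 \<le> 5524818 * 39916800\<^sup>2" by code_simp
  from compatible_prob_enumerated[OF _ _ this] show ?thesis by simp
qed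

lemma enumerated_12_4: "compatible_prob 12 4 * 1000000000 \<le> 2284192"
proof -
  have "pair_sum_above 12 4 479001600 * 1000000000 \<le> 2284192 * 479001600\<^sup>2" by code_simp
  from compatible_prob_enumerated[OF _ _ this] show ?thesis by simp
qed

lemma enumerated_13_6: "compatible_prob 13 6 * 1000000000 \<le> 11049582"
proof -
  have "pair_sum_above 13 6 6227020800 * 1000000000 \<le> 11049582 * 6227020800\<^sup>2" by code_simp
  from compatible_prob_enumerated[OF _ _ this] show ?thesis by simp
qed

lemma enumerated_14_6: "compatible_prob 14 6 * 1000000000 \<le> 5984320"
proof -
  have "pair_sum_above 14 6 87178291200 * 1000000000 \<le> 5984320 * 87178291200\<^sup>2" by code_simp
  from compatible_prob_enumerated[OF _ _ this] show ?thesis by simp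
qed

lemma enumerated_15_6: "compatible_prob 15 6 * 1000000000 \<le> 3386318"
proof -
  have "pair_sum_above 15 6 1307674368000 * 1000000000 \<le> 3386318 * 1307674368000\<^sup>2" by code_simp
  from compatible_prob_enumerated[OF _ _ this] show ?thesis by simp
qed

lemma enumerated_16_6: "compatible_prob 16 6 * 1000000000 \<le> 1842703"
proof -
  have "pair_sum_above 16 6 20922789888000 * 1000000000 \<le> 1842703 * 20922789888000\<^sup>2" by code_simp
  from compatible_prob_enumerated[OF _ _ this] show ?thesis by simp
qed

text \<open>The exact value is about 0.114275; the bound has to exceed only what is needed for the other degrees.\<close>

lemma compatible_prob_10_lower: "11375 \<le> compatible_prob 10 10 * 100000"
proof -
  have "11375 * 3628800\<^sup>2 \<le> pair_sum_below 10 10 3628800 * 100000" by code_simp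
  from compatible_prob_below[OF _ this] show ?thesis by simp
qed


section \<open>Degrees up to 39\<close>

definition div_up :: "int \<Rightarrow> int \<Rightarrow> int" where
  "div_up x y = - ((- x) div y)"

lemma div_up_ge: "0 < y \<Longrightarrow> of_int x / of_int y \<le> (of_int (div_up x y) :: real)"
proof -
  have "of_int x / of_int y \<le> (of_int \<lceil>of_int x / of_int y :: real\<rceil> :: real)" by simp
  then show ?thesis by (simp add: div_up_def ceiling_divide_eq_div)
qed

text \<open>A list of scaled upper bounds for consecutive values of \<open>f\<close>, starting with \<open>f 0\<close>.\<close>

definition bounds :: "(nat \<Rightarrow> real) \<Rightarrow> int list \<Rightarrow> bool" where
  "bounds f c \<longleftrightarrow> (\<forall>n<length c. f n * 1000000000 \<le> of_int (c ! n))"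

lemma bounds_rev_Cons:
  "bounds f (rev (x # acc)) \<longleftrightarrow> bounds f (rev acc) \<and> f (length acc) * 1000000000 \<le> of_int x"
  by (auto simp: bounds_def nth_append less_Suc_eq)

lemma bounds_rev_nth:
  assumes "bounds f (rev acc)" "0 < L" "L \<le> length acc"
  shows "f (length acc - L) * 1000000000 \<le> of_int (acc ! (L - 1))"
proof -
  have less: "length acc - L < length acc" using assms(2,3) by simp
  then have "f (length acc - L) * 1000000000 \<le> of_int (rev acc ! (length acc - L))"
    using assms(1) by (simp add: bounds_def)
  also have "rev acc ! (length acc - L) = acc ! (length acc - Suc (length acc - L))" by (rule rev_nth[OF less])
  also have "length acc - Suc (length acc - L) = L - 1" using assms(2,3) by simp
  finally show ?thesis .
qed

text \<open>The latest value comes first, so that the window of the last \<open>k\<close> values in the recursion is a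
  prefix of the list.\<close>

primrec bounded_column_rev :: "nat \<Rightarrow> nat \<Rightarrow> int list" where
  "bounded_column_rev k 0 = [1000000000]"
| "bounded_column_rev k (Suc n) =
    (let acc = bounded_column_rev k n in div_up (sum_list (take k acc)) (int (Suc n)) # acc)"

lemma length_bounded_column_rev [simp]: "length (bounded_column_rev k n) = Suc n"
  by (induction n) (simp_all add: Let_def)

lemma bounded_column_rev: "bounds (\<lambda>n. bounded_prob n k) (rev (bounded_column_rev k n))"
proof (induction n)
  case 0
  then show ?case by (simp add: bounds_def bounded_prob_0)
next
  case (Suc n)
  define acc where "acc = bounded_column_rev k n"
  have len: "length acc = Suc n" by (simp add: acc_def)
  have IH: "bounds (\<lambda>n. bounded_prob n k) (rev acc)" using Suc by (simp add: acc_def)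
  have "real (Suc n) * bounded_prob (Suc n) k = (\<Sum>a=1..min (Suc n) k. bounded_prob (Suc n - a) k)"
    by (rule bounded_prob_rec)
  then have "real (Suc n) * bounded_prob (Suc n) k * 1000000000
    = (\<Sum>a=1..min (Suc n) k. bounded_prob (Suc n - a) k * 1000000000)" by (simp add: sum_distrib_right)
  also have "\<dots> \<le> (\<Sum>a=1..min (Suc n) k. of_int (acc ! (a - 1)))"
    using bounds_rev_nth[OF IH] len by (intro sum_mono) auto
  also have "\<dots> = (\<Sum>i<min (Suc n) k. of_int (acc ! i))"
    by (rule sum.reindex_bij_witness[of _ Suc "\<lambda>a. a - 1"]) auto
  also have "\<dots> = of_int (sum_list (take k acc))"
    by (simp add: sum_list_sum_nth len atLeast0LessThan)
  finally have "bounded_prob (Suc n) k * 1000000000 \<le> of_int (sum_list (take k acc)) / of_int (int (Suc n))"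
    by (simp add: field_simps)
  also have "\<dots> \<le> of_int (div_up (sum_list (take k acc)) (int (Suc n)))" by (rule div_up_ge) simp
  finally show ?case using IH
    unfolding bounded_column_rev.simps Let_def acc_def[symmetric] bounds_rev_Cons len by blast
qed

text \<open>The blocks with larger part \<open>k\<close> as triples of their size, their multiplicity and the inverse of
  their weight.  A block with \<open>b < k\<close> occurs twice, as \<open>(k, b)\<close> and as \<open>(b, k)\<close>.\<close>

definition block_list :: "nat \<Rightarrow> nat \<Rightarrow> (nat \<times> int \<times> int) list" where
  "block_list N k = concat (map (\<lambda>b. let L = lcm (int k) (int b) in
    if L \<le> int N then [(nat L, if b = k then 1 else 2,
      copies_factor k (nat (L div int k)) * copies_factor b (nat (L div int b)))] else []) [1..<Suc k])"

definition block_sum :: "(nat \<times> int \<times> int) list \<Rightarrow> nat \<Rightarrow> int list \<Rightarrow> int" where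
  "block_sum bl n acc = sum_list (map (\<lambda>(L, c, d). if L \<le> n then div_up (c * acc ! (L - 1)) d else 0) bl)"

text \<open>The list \<open>acc\<close> holds the bounds for degrees \<open>n - 1\<close> down to 0.  An entry of the second argument consists of
  a bound that is known otherwise and of the bound for the next smaller \<open>k\<close>.\<close>

primrec extend_column :: "(nat \<times> int \<times> int) list \<Rightarrow> (int \<times> int) list \<Rightarrow> nat \<Rightarrow> int list \<Rightarrow> int list" where
  "extend_column bl [] n acc = acc"
| "extend_column bl (x # xs) n acc =
    extend_column bl xs (Suc n) (min (fst x) (snd x + block_sum bl n acc) # acc)"

lemma sum_large_blocks_max:
  fixes g :: "nat \<Rightarrow> nat \<Rightarrow> real"
  assumes "\<And>a b. g a b = g b a" "0 < k"
  shows "(\<Sum>(a, b)\<in>large_blocks n k (k - 1). g a b)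
    = (\<Sum>b\<in>{b\<in>{1..k}. lcm k b \<le> n}. (if b = k then 1 else 2) * g k b)"
proof -
  define J where "J = {b\<in>{1..k}. lcm k b \<le> n}"
  have fin: "finite J" by (simp add: J_def)
  have "(a, b) \<in> large_blocks n k (k - 1) \<longleftrightarrow> a = k \<and> b \<in> J \<or> b = k \<and> a \<in> J - {k}" for a b
  proof -
    have "k - 1 < max a b \<longleftrightarrow> k \<le> a \<or> k \<le> b" using assms(2) by auto
    then show ?thesis using assms(2) lcm.commute[of a k]
      by (cases "a = k"; cases "b = k") (auto simp: large_blocks_def J_def)
  qed
  then have "large_blocks n k (k - 1) = Pair k ` J \<union> (\<lambda>b. (b, k)) ` (J - {k})"
    by auto
  then have "(\<Sum>(a, b)\<in>large_blocks n k (k - 1). g a b)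
    = (\<Sum>(a, b)\<in>Pair k ` J. g a b) + (\<Sum>(a, b)\<in>(\<lambda>b. (b, k)) ` (J - {k}). g a b)"
    using fin by (simp only:) (rule sum.union_disjoint, auto)
  also have "(\<Sum>(a, b)\<in>Pair k ` J. g a b) = (\<Sum>b\<in>J. g k b)"
    by (subst sum.reindex) (auto simp: inj_on_def)
  also have "(\<Sum>(a, b)\<in>(\<lambda>b. (b, k)) ` (J - {k}). g a b) = (\<Sum>b\<in>J - {k}. g k b)"
    by (subst sum.reindex) (auto simp: inj_on_def assms(1)[of _ k])
  also have "(\<Sum>b\<in>J - {k}. g k b) = (\<Sum>b\<in>J. if b = k then 0 else g k b)"
    using fin by (intro sum.mono_neutral_cong_left) auto
  also have "(\<Sum>b\<in>J. g k b) + \<dots> = (\<Sum>b\<in>J. (if b = k then 1 else 2) * g k b)"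
    unfolding sum.distrib[symmetric] by (intro sum.cong) auto
  finally show ?thesis by (simp add: J_def)
qed

lemma block_sum:
  assumes "bounds (\<lambda>n. compatible_prob n k) (rev acc)" "length acc = n" "n \<le> N" "0 < k"
  shows "(\<Sum>(a, b)\<in>large_blocks n k (k - 1). block_weight a b * compatible_prob (n - lcm a b) k) * 1000000000
    \<le> of_int (block_sum (block_list N k) n acc)"
proof -
  define h where "h = (\<lambda>(L, c, d). if L \<le> n then div_up (c * acc ! (L - 1)) d else 0)"
  define e where "e b = (let L = lcm (int k) (int b) in
    if L \<le> int N then [(nat L, if b = k then 1 else 2 :: int,
      copies_factor k (nat (L div int k)) * copies_factor b (nat (L div int b)))] else [])" for b
  define T where "T b = sum_list (map h (e b))" for b
  have "block_sum (block_list N k) n acc = (\<Sum>b\<leftarrow>[1..<Suc k]. T b)"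
    unfolding block_sum_def block_list_def h_def[symmetric] T_def e_def[symmetric] sum_list_concat_map ..
  also have "\<dots> = (\<Sum>b\<in>{1..k}. T b)"
    by (simp only: sum_list_distinct_conv_sum_set distinct_upt set_upt atLeastLessThanSuc_atLeastAtMost)
  also have "\<dots> = (\<Sum>b\<in>{b\<in>{1..k}. lcm k b \<le> n}. T b)"
  proof (rule sum.mono_neutral_right)
    show "\<forall>b\<in>{1..k} - {b \<in> {1..k}. lcm k b \<le> n}. T b = 0"
      by (auto simp: T_def e_def h_def Let_def)
  qed auto
  finally have T: "of_int (block_sum (block_list N k) n acc) = (\<Sum>b\<in>{b\<in>{1..k}. lcm k b \<le> n}. of_int (T b) :: real)"
    by simp
  have "(\<Sum>(a, b)\<in>large_blocks n k (k - 1). block_weight a b * compatible_prob (n - lcm a b) k)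
    = (\<Sum>b\<in>{b\<in>{1..k}. lcm k b \<le> n}. (if b = k then 1 else 2) * (block_weight k b * compatible_prob (n - lcm k b) k))"
    using assms(4) by (intro sum_large_blocks_max) (simp_all add: block_weight_commute lcm.commute)
  then have "(\<Sum>(a, b)\<in>large_blocks n k (k - 1). block_weight a b * compatible_prob (n - lcm a b) k) * 1000000000
    = (\<Sum>b\<in>{b\<in>{1..k}. lcm k b \<le> n}.
      (if b = k then 1 else 2) * (block_weight k b * compatible_prob (n - lcm k b) k) * 1000000000)"
    by (simp only: sum_distrib_right)
  also have "\<dots> \<le> (\<Sum>b\<in>{b\<in>{1..k}. lcm k b \<le> n}. of_int (T b))"
  proof (rule sum_mono)
    fix b assume b: "b \<in> {b\<in>{1..k}. lcm k b \<le> n}"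
    define L where "L = lcm k b"
    have "0 < b" "L \<le> n" using b by (simp_all add: L_def)
    then have L: "0 < L" "L \<le> n" "L \<le> N" using assms(3,4) lcm_pos_nat[of k b] by (simp_all only: L_def)
    define c where "c = (if b = k then 1 else 2 :: int)"
    define d where "d = copies_factor k (L div k) * copies_factor b (L div b)"
    have d: "0 < d" unfolding d_def using copies_factor_pos assms(4) \<open>0 < b\<close> by (intro mult_pos_pos)
    have weight: "block_weight k b = 1 / of_int d"
      unfolding block_weight_def d_def L_def of_int_mult copies_factor by (rule refl)
    have "lcm (int k) (int b) = int L" by (simp add: L_def)
    moreover have "nat (int L div int x) = L div x" for x by (simp flip: of_nat_div)
    ultimately have Tb: "T b = div_up (c * acc ! (L - 1)) d"
      using L by (simp only: T_def e_def h_def c_def d_def Let_def) simp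
    have "compatible_prob (n - L) k * 1000000000 \<le> of_int (acc ! (L - 1))"
      using bounds_rev_nth[OF assms(1), of L] L assms(2) by simp
    then have "of_int c * (compatible_prob (n - L) k * 1000000000) / of_int d \<le> of_int c * of_int (acc ! (L - 1)) / of_int d"
      using d by (intro divide_right_mono mult_left_mono) (simp_all add: c_def)
    also have "\<dots> \<le> of_int (T b)" unfolding Tb using div_up_ge[OF d, of "c * acc ! (L - 1)"] by simp
    finally show "(if b = k then 1 else 2) * (block_weight k b * compatible_prob (n - lcm k b) k) * 1000000000 \<le> of_int (T b)"
      unfolding weight L_def[symmetric] by (simp add: c_def split: if_splits)
  qed
  finally show ?thesis unfolding T .
qed

lemma extend_column:
  assumes "bounds (\<lambda>n. compatible_prob n k) (rev acc)" "length acc = n" "n + length xs \<le> Suc N" "0 < k"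
    and "\<And>i. i < length xs \<Longrightarrow> compatible_prob (n + i) k * 1000000000 \<le> of_int (fst (xs ! i))"
    and "\<And>i. i < length xs \<Longrightarrow> compatible_prob (n + i) (k - 1) * 1000000000 \<le> of_int (snd (xs ! i))"
  shows "bounds (\<lambda>n. compatible_prob n k) (rev (extend_column (block_list N k) xs n acc))"
    and "length (extend_column (block_list N k) xs n acc) = n + length xs"
proof -
  have "bounds (\<lambda>n. compatible_prob n k) (rev (extend_column (block_list N k) xs n acc)) \<and>
    length (extend_column (block_list N k) xs n acc) = n + length xs"
    using assms
  proof (induction xs arbitrary: n acc)
    case (Cons x xs)
    obtain u t where x: "x = (u, t)" by (cases x)
    define v where "v = t + block_sum (block_list N k) n acc"
    have "compatible_prob n k * 1000000000 \<le> of_int u" using Cons.prems(5)[of 0] by (simp add: x)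
    moreover have "compatible_prob n k * 1000000000 \<le> of_int v"
    proof -
      have "compatible_prob n k * 1000000000 \<le> (compatible_prob n (k - 1) +
        (\<Sum>(a, b)\<in>large_blocks n k (k - 1). block_weight a b * compatible_prob (n - lcm a b) k)) * 1000000000"
        using compatible_prob_remove_block[of n k "k - 1"] by simp
      also have "\<dots> \<le> of_int t + of_int (block_sum (block_list N k) n acc)"
        using Cons.prems(6)[of 0] block_sum[OF Cons.prems(1,2) _ Cons.prems(4)] Cons.prems(3)
        by (simp add: x distrib_right add_mono)
      finally show ?thesis by (simp add: v_def)
    qed
    moreover define w where "w = min u v"
    ultimately have "bounds (\<lambda>n. compatible_prob n k) (rev (w # acc))"
      unfolding bounds_rev_Cons using Cons.prems(1,2) by (simp add: min_def)
    moreover have "compatible_prob (Suc n + i) k * 1000000000 \<le> of_int (fst (xs ! i))" if "i < length xs" for i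
      using Cons.prems(5)[of "Suc i"] that by simp
    moreover have "compatible_prob (Suc n + i) (k - 1) * 1000000000 \<le> of_int (snd (xs ! i))" if "i < length xs" for i
      using Cons.prems(6)[of "Suc i"] that by simp
    moreover have "extend_column (block_list N k) (x # xs) n acc = extend_column (block_list N k) xs (Suc n) (w # acc)"
      by (simp add: x v_def w_def)
    ultimately show ?case
      using Cons.IH[of "w # acc" "Suc n"] Cons.prems(2,3,4) by simp
  qed simp
  then show "bounds (\<lambda>n. compatible_prob n k) (rev (extend_column (block_list N k) xs n acc))"
    "length (extend_column (block_list N k) xs n acc) = n + length xs" by auto
qed

definition enumerated :: "(nat \<times> nat \<times> int) list" where
  "enumerated = [(1, 1, 1000000000), (2, 2, 1000000000), (3, 3, 666666667), (4, 4, 458333334), (5, 5, 391666667), (6, 6, 291666667), (7, 7, 225297620), (8, 8, 173998016), (9, 9, 139512787), (10, 10, 114467652), (11, 11, 93560109), (12, 12, 78505815), (8, 4, 51194374), (9, 4, 30422585), (10, 4, 12610844), (11, 4, 5524818), (12, 4, 2284192), (13, 6, 11049582), (14, 6, 5984320), (15, 6, 3386318), (16, 6, 1842703)]"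

lemma enumerated:
  "\<forall>(n, k, v)\<in>set enumerated. compatible_prob n k * 1000000000 \<le> of_int v"
  using enumerated_1_1 enumerated_2_2 enumerated_3_3 enumerated_4_4 enumerated_5_5 enumerated_6_6 enumerated_7_7 enumerated_8_8 enumerated_9_9 enumerated_10_10 enumerated_11_11 enumerated_12_12 enumerated_8_4 enumerated_9_4 enumerated_10_4 enumerated_11_4 enumerated_12_4 enumerated_13_6 enumerated_14_6 enumerated_15_6 enumerated_16_6
  by (simp add: enumerated_def)

lemma compatible_prob_enumerated_le:
  assumes "(n, l, v) \<in> set enumerated" "k \<le> l \<or> n = l"
  shows "compatible_prob n k * 1000000000 \<le> of_int v"
proof -
  have "compatible_prob n k \<le> compatible_prob n l"
    using assms(2) compatible_prob_mono[of k l n] compatible_prob_large[of n k] by (cases "k \<le> l") auto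
  then show ?thesis using enumerated assms(1) by fastforce
qed

text \<open>Enumerated bounds for degrees 1, 2, and so on.  A bound for cycles of length at most 4 or 6 applies to smaller \<open>k\<close>
  and is then better than the one for all cycle types.\<close>

definition caps :: "nat \<Rightarrow> int list" where
  "caps k = (if k \<le> 4 then
      [1000000000, 1000000000, 666666667, 458333334, 391666667, 291666667, 225297620, 51194374, 30422585, 12610844, 5524818, 2284192, 11049582, 5984320, 3386318, 1842703]
    else if k \<le> 6 then
      [1000000000, 1000000000, 666666667, 458333334, 391666667, 291666667, 225297620, 173998016, 139512787, 114467652, 93560109, 78505815, 11049582, 5984320, 3386318, 1842703]
    else
      [1000000000, 1000000000, 666666667, 458333334, 391666667, 291666667, 225297620, 173998016, 139512787, 114467652, 93560109, 78505815])"

lemma caps: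
  assumes "i < length (caps k)"
  shows "compatible_prob (Suc i) k * 1000000000 \<le> of_int (caps k ! i)"
proof -
  have "list_all2 (\<lambda>n v. \<exists>x\<in>set enumerated. case x of (m, l, w) \<Rightarrow> m = n \<and> w = v \<and> (k \<le> l \<or> m = l))
    [1..<Suc (length (caps k))] (caps k)"
    by (simp add: caps_def enumerated_def)
  then obtain l where "(Suc i, l, caps k ! i) \<in> set enumerated" "k \<le> l \<or> Suc i = l"
    using assms by (fastforce simp: list_all2_conv_all_nth nth_upt simp del: upt_Suc)
  then show ?thesis by (rule compatible_prob_enumerated_le)
qed

primrec simple_bounds :: "int list \<Rightarrow> int list \<Rightarrow> int list" where
  "simple_bounds [] cs = []"
| "simple_bounds (s # ss) cs = (case cs of [] \<Rightarrow> div_up (s * s) 1000000000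
    | c # _ \<Rightarrow> min c (div_up (s * s) 1000000000)) # simple_bounds ss (tl cs)"

lemma simple_bounds:
  "length (simple_bounds ss cs) = length ss"
  "i < length ss \<Longrightarrow> simple_bounds ss cs ! i = (if i < length cs then min (cs ! i) (div_up (ss ! i * ss ! i) 1000000000)
    else div_up (ss ! i * ss ! i) 1000000000)"
proof -
  show "length (simple_bounds ss cs) = length ss"
    by (induction ss arbitrary: cs) simp_all
  show "i < length ss \<Longrightarrow> simple_bounds ss cs ! i = (if i < length cs then min (cs ! i) (div_up (ss ! i * ss ! i) 1000000000)
    else div_up (ss ! i * ss ! i) 1000000000)"
  proof (induction ss arbitrary: cs i)
    case (Cons s ss)
    then show ?case by (cases i; cases cs) auto
  qed simp
qed

text \<open>Bounds for degrees 0 to \<open>N\<close> and cycles of length at most \<open>k\<close>: the minimum of the enumerated bound,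
  of the square of the probability that one permutation has only short cycles, and of the block
  inequality with \<open>K = k - 1\<close>.\<close>

primrec column :: "nat \<Rightarrow> nat \<Rightarrow> int list" where
  "column N 0 = 1000000000 # replicate N 0"
| "column N (Suc k) = rev (extend_column (block_list N (Suc k))
    (zip (simple_bounds (tl (rev (bounded_column_rev (Suc k) N))) (caps (Suc k))) (tl (column N k))) 1 [1000000000])"

lemma column: "bounds (\<lambda>n. compatible_prob n k) (column N k) \<and> length (column N k) = Suc N"
proof (induction k)
  case 0
  have "compatible_prob n 0 * 1000000000 \<le> of_int ((1000000000 # replicate N 0) ! n)" if "n < Suc N" for n
    using that compatible_prob_0_right[of n] by (cases n) (simp_all add: compatible_prob_0)
  then show ?case by (simp add: bounds_def)
next
  case (Suc k)
  define us where "us = simple_bounds (tl (rev (bounded_column_rev (Suc k) N))) (caps (Suc k))"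
  have len: "length us = N" "length (tl (column N k)) = N" using Suc by (simp_all add: us_def simple_bounds(1))
  have "compatible_prob (1 + i) (Suc k) * 1000000000 \<le> of_int (us ! i)" if "i < N" for i
  proof -
    define s where "s = rev (bounded_column_rev (Suc k) N) ! Suc i"
    have us: "us ! i = (if i < length (caps (Suc k)) then min (caps (Suc k) ! i) (div_up (s * s) 1000000000)
        else div_up (s * s) 1000000000)"
      using that unfolding us_def s_def by (subst simple_bounds(2)) (simp_all add: nth_tl)
    have s: "bounded_prob (1 + i) (Suc k) * 1000000000 \<le> of_int s"
      using bounded_column_rev[of "Suc k" N] that by (simp add: bounds_def s_def)
    have "compatible_prob (1 + i) (Suc k) * 1000000000 \<le> (bounded_prob (1 + i) (Suc k))\<^sup>2 * 1000000000"
      using compatible_prob_le_square[of "1 + i" "Suc k"] by simp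
    also have "\<dots> = (bounded_prob (1 + i) (Suc k) * 1000000000) * (bounded_prob (1 + i) (Suc k) * 1000000000) / 1000000000"
      by (simp add: power2_eq_square)
    also have "\<dots> \<le> of_int s * of_int s / 1000000000"
      using s bounded_prob_nonneg[of "1 + i" "Suc k"] by (intro divide_right_mono mult_mono) auto
    also have "\<dots> \<le> of_int (div_up (s * s) 1000000000)"
      using div_up_ge[of 1000000000 "s * s"] by simp
    finally show ?thesis using caps[of i "Suc k"] by (simp add: us min_def)
  qed
  moreover have "compatible_prob (1 + i) k * 1000000000 \<le> of_int (tl (column N k) ! i)" if "i < N" for i
    using Suc that by (simp add: bounds_def nth_tl)
  moreover have base: "bounds (\<lambda>n. compatible_prob n (Suc k)) (rev [1000000000])"
    by (simp add: bounds_def compatible_prob_0)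
  moreover define res where "res = extend_column (block_list N (Suc k)) (zip us (tl (column N k))) 1 [1000000000]"
  ultimately have "bounds (\<lambda>n. compatible_prob n (Suc k)) (rev res) \<and> length res = 1 + length (zip us (tl (column N k)))"
    unfolding res_def using len by (intro conjI extend_column) simp_all
  then have "bounds (\<lambda>n. compatible_prob n (Suc k)) (rev res) \<and> length res = Suc N" using len by simp
  moreover have "column N (Suc k) = rev res"
    unfolding column.simps res_def us_def ..
  ultimately show ?case by simp
qed

lemma column_nth: "n \<le> N \<Longrightarrow> compatible_prob n k * 1000000000 \<le> of_int (column N k ! n)"
  using column[of k N] by (auto simp: bounds_def)

text \<open>The exception is the degree 10, in which the constant is attained.\<close>

lemma column_39_small:
  "list_all (\<lambda>(n, v). v * (n * n) \<le> 11375000000 \<or> n = 10)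
    (zip (map int [1..<40]) (tl (column 39 39)))"
  by code_simp

lemma compatible_prob_le_39:
  assumes "1 \<le> n" "n \<le> 39" "n \<noteq> 10"
  shows "compatible_prob n n * (real n)\<^sup>2 \<le> 11375 / 1000"
proof -
  define v where "v = column 39 39 ! n"
  have len: "length (tl (column 39 39)) = 39" using column[of 39 39] by simp
  have v: "v = tl (column 39 39) ! (n - 1)" using assms(1,2) len by (simp add: v_def nth_tl)
  have "(int n, v) \<in> set (zip (map int [1..<40]) (tl (column 39 39)))"
    unfolding in_set_zip by (rule exI[of _ "n - 1"]) (use assms len v in \<open>simp del: upt_Suc\<close>)
  then have "v * (int n * int n) \<le> 11375000000"
    using column_39_small assms(3) unfolding list_all_iff by fastforce
  then have "real_of_int (v * (int n * int n)) \<le> real_of_int 11375000000" by (simp only: of_int_le_iff)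
  then have "of_int v * (real n)\<^sup>2 \<le> 11375000000" by (simp add: power2_eq_square)
  moreover have "compatible_prob n n * 1000000000 \<le> of_int v"
    using column_nth[OF assms(2), of 39] compatible_prob_large[OF assms(2)] by (simp add: v_def)
  then have "compatible_prob n n * 1000000000 * (real n)\<^sup>2 \<le> of_int v * (real n)\<^sup>2"
    by (rule mult_right_mono) simp
  ultimately show ?thesis by linarith
qed


section \<open>The contribution of large blocks\<close>

text \<open>The contribution \<open>1 / (a ^ i * fact i)\<close> of \<open>i\<close> parts \<open>a\<close> of total mass \<open>L = a * i\<close>.\<close>

definition block_factor :: "nat \<Rightarrow> nat \<Rightarrow> real" where
  "block_factor L i = real i ^ i / (fact i * real L ^ i)"

text \<open>The ratio of consecutive values of \<open>i ^ i / fact i\<close> is \<open>(1 + 1 / i) ^ i\<close>, which is less than 3.\<close>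

lemma power_self_le_fact:
  assumes "2 \<le> i"
  shows "real i ^ i \<le> 2 * 3 ^ (i - 2) * fact i"
  using assms
proof (induction i rule: dec_induct)
  case (step k)
  have "(1 + 1 / real k) ^ k \<le> exp 1"
    using exp_ge_one_plus_x_over_n_power_n[of k 1] step by simp
  also have "\<dots> \<le> 3" by (rule exp_le)
  finally have e: "(1 + 1 / real k) ^ k \<le> 3" .
  have "real (Suc k) = real k * (1 + 1 / real k)" using step by (simp add: field_simps)
  then have "real (Suc k) ^ k = real k ^ k * (1 + 1 / real k) ^ k" by (simp only: power_mult_distrib)
  also have "\<dots> \<le> (2 * 3 ^ (k - 2) * fact k) * 3" using step.IH e by (intro mult_mono) auto
  finally have "real (Suc k) * real (Suc k) ^ k \<le> real (Suc k) * ((2 * 3 ^ (k - 2) * fact k) * 3)"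
    by (intro mult_left_mono) auto
  also have "\<dots> = 2 * 3 ^ (Suc k - 2) * fact (Suc k)"
  proof -
    obtain j where "k = j + 2" using step(1) by (metis add.commute le_add_diff_inverse)
    then show ?thesis by simp
  qed
  finally show ?case by simp
qed simp

text \<open>The term for \<open>i = 1\<close> is \<open>1 / L\<close>; the others are dominated by a geometric series with ratio \<open>3 / L\<close>
  and first term \<open>2 / L\<^sup>2\<close>.\<close>

lemma sum_block_factor_le:
  assumes "12 \<le> L"
  shows "(\<Sum>i=1..L. block_factor L i) \<le> (1 + 8 / (3 * real L)) / real L"
proof -
  define q where "q = 3 / real L"
  have q: "0 \<le> q" "q \<le> 1 / 4" using assms by (auto simp: q_def field_simps)
  have factor: "block_factor L i \<le> 2 / (real L)\<^sup>2 * q ^ (i - 2)" if "i \<in> {2..L}" for i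
  proof -
    have "block_factor L i \<le> (2 * 3 ^ (i - 2) * fact i) / (fact i * real L ^ i)"
      unfolding block_factor_def using power_self_le_fact[of i] that by (intro divide_right_mono) auto
    also have "\<dots> = 2 * 3 ^ (i - 2) / real L ^ i" by simp
    also have "real L ^ i = (real L)\<^sup>2 * real L ^ (i - 2)"
      using that by (metis atLeastAtMost_iff le_add_diff_inverse power_add)
    finally show ?thesis by (simp add: q_def power_divide)
  qed
  have "(\<Sum>j\<in>{..L - 2}. q ^ j) \<le> (\<Sum>j. q ^ j)"
    using q by (intro sum_le_suminf summable_geometric) auto
  also have "\<dots> = 1 / (1 - q)" using q by (intro suminf_geometric) auto
  also have "\<dots> \<le> 1 / (3 / 4)" using q by (intro divide_left_mono) auto
  finally have geo: "(\<Sum>j\<in>{..L - 2}. q ^ j) \<le> 4 / 3" by simp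
  have "(\<Sum>i=1..L. block_factor L i) = block_factor L 1 + (\<Sum>i=2..L. block_factor L i)"
    using assms by (subst sum.atLeast_Suc_atMost) (auto simp: numeral_2_eq_2)
  also have "(\<Sum>i=2..L. block_factor L i) \<le> (\<Sum>i=2..L. 2 / (real L)\<^sup>2 * q ^ (i - 2))"
    by (intro sum_mono factor)
  also have "\<dots> = 2 / (real L)\<^sup>2 * (\<Sum>j\<in>{..L - 2}. q ^ j)"
    unfolding sum_distrib_left
    by (rule sum.reindex_bij_witness[of _ "\<lambda>j. j + 2" "\<lambda>i. i - 2"]) (use assms in auto)
  also have "\<dots> \<le> 2 / (real L)\<^sup>2 * (4 / 3)" using geo by (intro mult_left_mono) auto
  also have "block_factor L 1 + 2 / (real L)\<^sup>2 * (4 / 3) = (1 + 8 / (3 * real L)) / real L"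
    using assms by (simp add: block_factor_def field_simps power2_eq_square)
  finally show ?thesis by simp
qed

lemma block_weight_eq_factors:
  assumes "0 < a" "0 < b" "lcm a b = L"
  shows "block_weight a b = block_factor L (L div a) * block_factor L (L div b)"
proof -
  have "1 / (real c ^ (L div c) * fact (L div c)) = block_factor L (L div c)" if c: "0 < c" "c dvd L" "0 < L" for c
  proof -
    obtain i where i: "L = c * i" using c(2) by auto
    have "0 < i" using c(3) i by simp
    then show ?thesis using c(1) by (simp add: block_factor_def i power_mult_distrib)
  qed
  moreover have "0 < L" "a dvd L" "b dvd L" using assms lcm_pos_nat[of a b] by auto
  moreover have "block_weight a b = 1 / (real a ^ (L div a) * fact (L div a)) * (1 / (real b ^ (L div b) * fact (L div b)))"
    by (simp add: block_weight_def assms(3))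
  ultimately show ?thesis using assms by simp
qed

text \<open>A block of size \<open>L\<close> is determined by the two multiplicities \<open>L div a\<close> and \<open>L div b\<close>, and its weight
  is a product, so all blocks of this size together weigh at most the square of a sum of factors.\<close>

lemma sum_block_weight_lcm_le:
  assumes "12 \<le> L"
  shows "(\<Sum>(a, b)\<in>{x \<in> large_blocks n n 11. (case x of (a, b) \<Rightarrow> lcm a b) = L}. block_weight a b)
    \<le> (1 + 6 / real L) / (real L)\<^sup>2"
proof -
  define S where "S = {x \<in> large_blocks n n 11. (case x of (a, b) \<Rightarrow> lcm a b) = L}"
  define f where "f = (\<lambda>(a, b). (L div a, L div b))"
  let ?F = "\<lambda>(i, j). block_factor L i * block_factor L j"
  have mem: "0 < a" "0 < b" "lcm a b = L" "a dvd L" "b dvd L" if "(a, b) \<in> S" for a b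
    using that by (auto simp: S_def large_blocks_def)
  have dvd_div_div_self: "L div (L div c) = c" if c: "c dvd L" for c
  proof -
    obtain i where "L = c * i" using c by blast
    then show ?thesis using assms by (cases "c = 0"; cases "i = 0") auto
  qed
  have "inj_on f S"
  proof (rule inj_onI)
    fix x y assume xy: "x \<in> S" "y \<in> S" "f x = f y"
    obtain a b c d where x: "x = (a, b)" and y: "y = (c, d)" by (cases x; cases y)
    have "a = L div (L div a)" "c = L div (L div c)" "b = L div (L div b)" "d = L div (L div d)"
      using mem(4,5)[of a b] mem(4,5)[of c d] xy(1,2)
      by (simp_all add: x y dvd_div_div_self)
    then show "x = y" using xy(3) by (simp add: x y f_def)
  qed
  have "(\<Sum>(a, b)\<in>S. block_weight a b) = (\<Sum>x\<in>S. ?F (f x))"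
    using mem by (intro sum.cong) (auto simp: f_def block_weight_eq_factors)
  also have "\<dots> = (\<Sum>y\<in>f ` S. ?F y)" using \<open>inj_on f S\<close> by (simp add: sum.reindex)
  also have "\<dots> \<le> (\<Sum>y\<in>{1..L} \<times> {1..L}. ?F y)"
  proof (rule sum_mono2)
    show "f ` S \<subseteq> {1..L} \<times> {1..L}"
    proof
      fix y assume "y \<in> f ` S"
      then obtain a b where "(a, b) \<in> S" "y = (L div a, L div b)" by (auto simp: f_def)
      then show "y \<in> {1..L} \<times> {1..L}"
        using mem[of a b] assms by (auto simp: Suc_le_eq div_greater_zero_iff dvd_imp_le)
    qed
  qed (auto simp: block_factor_def)
  also have "\<dots> = (\<Sum>i=1..L. block_factor L i)\<^sup>2"
    by (simp add: power2_eq_square sum_product sum.cartesian_product)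
  also have "\<dots> \<le> ((1 + 8 / (3 * real L)) / real L)\<^sup>2"
    by (intro power_mono sum_block_factor_le[OF assms] sum_nonneg) (simp add: block_factor_def)
  also have "\<dots> = (1 + 8 / (3 * real L))\<^sup>2 / (real L)\<^sup>2" by (simp add: power_divide)
  also have "\<dots> \<le> (1 + 6 / real L) / (real L)\<^sup>2"
  proof (rule divide_right_mono)
    show "(1 + 8 / (3 * real L))\<^sup>2 \<le> 1 + 6 / real L"
      using assms by (simp add: power2_eq_square field_simps)
  qed simp
  finally show ?thesis by (simp add: S_def)
qed

text \<open>The block inequality with the blocks grouped by their size.  Short cycles are those of length at
  most 11, since \<open>L \<ge> 12\<close> makes the bound \<open>6 / L\<close> for the relative contribution of the smaller
  blocks valid.\<close>

lemma compatible_prob_large_cycle: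
  "compatible_prob n n \<le> (bounded_prob n 11)\<^sup>2
    + (\<Sum>L=12..n. (1 + 6 / real L) / (real L)\<^sup>2 * compatible_prob (n - L) (n - L))"
proof -
  define S where "S = large_blocks n n 11"
  let ?l = "\<lambda>(a, b). lcm a b"
  let ?h = "\<lambda>(a, b). block_weight a b * compatible_prob (n - lcm a b) n"
  have "?l ` S \<subseteq> {12..n}"
  proof
    fix L assume "L \<in> ?l ` S"
    then obtain a b where ab: "(a, b) \<in> S" "L = lcm a b" by auto
    then have "0 < a" "0 < b" by (auto simp: S_def large_blocks_def)
    then have "0 < lcm a b" by (rule lcm_pos_nat)
    then have "a \<le> lcm a b" "b \<le> lcm a b" by (simp_all add: dvd_imp_le)
    then show "L \<in> {12..n}" using ab by (auto simp: S_def large_blocks_def)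
  qed
  then have "sum ?h S = (\<Sum>L=12..n. \<Sum>x\<in>{x \<in> S. ?l x = L}. ?h x)"
    by (intro sum.group[symmetric]) (auto simp: S_def finite_large_blocks)
  also have "\<dots> \<le> (\<Sum>L=12..n. (1 + 6 / real L) / (real L)\<^sup>2 * compatible_prob (n - L) (n - L))"
  proof (intro sum_mono)
    fix L assume L: "L \<in> {12..n}"
    have "(\<Sum>x\<in>{x \<in> S. ?l x = L}. ?h x)
      = (\<Sum>(a, b)\<in>{x \<in> S. ?l x = L}. block_weight a b) * compatible_prob (n - L) (n - L)"
      unfolding sum_distrib_right using compatible_prob_large[of "n - L" n] by (intro sum.cong) auto
    also have "\<dots> \<le> (1 + 6 / real L) / (real L)\<^sup>2 * compatible_prob (n - L) (n - L)"
      unfolding S_def using L by (intro mult_right_mono sum_block_weight_lcm_le compatible_prob_nonneg) auto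
    finally show "(\<Sum>x\<in>{x \<in> S. ?l x = L}. ?h x)
      \<le> (1 + 6 / real L) / (real L)\<^sup>2 * compatible_prob (n - L) (n - L)" .
  qed
  finally show ?thesis
    using compatible_prob_remove_block[of n n 11] compatible_prob_le_square[of n 11] unfolding S_def by linarith
qed

section \<open>Degrees from 40 to 79\<close>

text \<open>Up to degree 10 these are the enumerated bounds, from degree 11 on the bounds that the induction
  provides.  The last degree is \<open>67 = 79 - 12\<close>, the largest one that remains after a block is removed.\<close>

definition prob_bounds :: "int list" where
  "prob_bounds = [1000000000, 1000000000, 1000000000, 666666667, 458333334, 391666667, 291666667,
    225297620, 173998016, 139512787, 114467652] @ map (\<lambda>m. div_up 11375000000 (int m * int m)) [11..<68]"

text \<open>The bound \<open>(1 + 6 / L) / L\<^sup>2\<close> for blocks of size \<open>L\<close>, scaled and rounded up.\<close>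

definition large_block_bound :: "nat \<Rightarrow> int" where
  "large_block_bound L = (let l = int L in div_up ((l + 6) * 1000000000) (l * l * l))"

primrec dot :: "int list \<Rightarrow> int list \<Rightarrow> int" where
  "dot [] ys = 0"
| "dot (x # xs) ys = (case ys of [] \<Rightarrow> 0 | y # ys' \<Rightarrow> x * y + dot xs ys')"

text \<open>The list \<open>G\<close> holds the block bounds for the sizes below \<open>n\<close> down to 12, so that the convolution
  with the bounds in \<open>U\<close> for degrees 0, 1, and so on is a dot product.  As both factors are scaled,
  the sum is in units of the square of the scale.\<close>

primrec check_degrees :: "int list \<Rightarrow> nat \<Rightarrow> int list \<Rightarrow> int list \<Rightarrow> bool" where
  "check_degrees [] n G U = True"
| "check_degrees (s # ss) n G U =
    (if int n * int n * (s * s + dot (large_block_bound n # G) U) \<le> 11375000000000000000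
     then check_degrees ss (Suc n) (large_block_bound n # G) U else False)"

lemma check_degrees_eval:
  "check_degrees (drop 40 (rev (bounded_column_rev 11 79))) 40
    (map large_block_bound (rev [12..<40])) prob_bounds"
  by code_simp

lemma dot_conv_sum: "dot xs ys = (\<Sum>i<min (length xs) (length ys). xs ! i * ys ! i)"
proof (induction xs arbitrary: ys)
  case (Cons x xs)
  then show ?case by (cases ys) (simp_all add: sum.lessThan_Suc_shift del: sum.lessThan_Suc)
qed simp

lemma check_degrees:
  assumes "check_degrees ss n (map large_block_bound (rev [12..<n])) U" "12 \<le> n" "i < length ss"
  shows "int (n + i) * int (n + i) * (ss ! i * ss ! i + dot (map large_block_bound (rev [12..<Suc (n + i)])) U)
    \<le> 11375000000000000000"
  using assms
proof (induction ss arbitrary: n i)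
  case (Cons s ss)
  have G: "large_block_bound n # map large_block_bound (rev [12..<n]) = map large_block_bound (rev [12..<Suc n])"
    using Cons.prems(2) by simp
  have now: "int n * int n * (s * s + dot (map large_block_bound (rev [12..<Suc n])) U) \<le> 11375000000000000000"
    and rest: "check_degrees ss (Suc n) (map large_block_bound (rev [12..<Suc n])) U"
    using Cons.prems(1) unfolding check_degrees.simps G by (auto split: if_splits)
  show ?case
  proof (cases i)
    case 0
    then show ?thesis using now by simp
  next
    case (Suc j)
    then show ?thesis using Cons.IH[OF rest, of j] Cons.prems(2,3) by simp
  qed
qed simp

lemma prob_bounds:
  assumes "m < 68" "11 \<le> m \<Longrightarrow> compatible_prob m m * (real m)\<^sup>2 \<le> 11375 / 1000"
  shows "compatible_prob m m * 1000000000 \<le> of_int (prob_bounds ! m)"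
proof (cases "m < 11")
  case True
  then have "m = 0 \<or> m = 1 \<or> m = 2 \<or> m = 3 \<or> m = 4 \<or> m = 5 \<or> m = 6 \<or> m = 7 \<or> m = 8 \<or> m = 9 \<or> m = 10"
    by presburger
  then show ?thesis
    using enumerated_1_1 enumerated_2_2 enumerated_3_3 enumerated_4_4 enumerated_5_5 enumerated_6_6
      enumerated_7_7 enumerated_8_8 enumerated_9_9 enumerated_10_10 compatible_prob_0[of 0]
    by (auto simp: prob_bounds_def nth_append)
next
  case False
  then have m: "11 \<le> m" by simp
  have "prob_bounds ! m = div_up 11375000000 (int m * int m)"
  proof -
    obtain j where j: "m = 11 + j" using m le_Suc_ex by blast
    have "prob_bounds ! (11 + j) = map (\<lambda>m. div_up 11375000000 (int m * int m)) [11..<68] ! j"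
      using nth_append_length_plus[of "[1000000000, 1000000000, 1000000000, 666666667, 458333334, 391666667,
        291666667, 225297620, 173998016, 139512787, 114467652]"] by (simp add: prob_bounds_def del: upt_rec_numeral)
    also have "\<dots> = div_up 11375000000 (int ([11..<68] ! j) * int ([11..<68] ! j))"
      using assms(1) j by (intro nth_map) (simp del: upt_rec_numeral)
    also have "[11..<68] ! j = m" using assms(1) j by (subst nth_upt) simp_all
    finally show ?thesis by (simp only: j)
  qed
  moreover have "compatible_prob m m * 1000000000 \<le> of_int 11375000000 / of_int (int m * int m)"
    using assms(2)[OF m] m by (simp add: field_simps power2_eq_square)
  moreover have "\<dots> \<le> of_int (div_up 11375000000 (int m * int m))"
    using m by (intro div_up_ge) simp
  ultimately show ?thesis by simp
qed

lemma compatible_prob_le_79: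
  assumes n: "40 \<le> n" "n \<le> 79"
    and IH: "\<And>m. 11 \<le> m \<Longrightarrow> m < n \<Longrightarrow> compatible_prob m m * (real m)\<^sup>2 \<le> 11375 / 1000"
  shows "compatible_prob n n * (real n)\<^sup>2 \<le> 11375 / 1000"
proof -
  define ss where "ss = drop 40 (rev (bounded_column_rev 11 79))"
  define s where "s = ss ! (n - 40)"
  define G where "G = map large_block_bound (rev [12..<Suc n])"
  have len: "length ss = 40" "length G = n - 11" "length prob_bounds = 68"
    using n by (simp_all add: ss_def G_def prob_bounds_def del: upt_Suc)
  have s: "bounded_prob n 11 * 1000000000 \<le> of_int s"
    using bounded_column_rev[of 11 79] n by (simp add: bounds_def s_def ss_def)
  have sq: "(bounded_prob n 11)\<^sup>2 * 1000000000000000000 \<le> of_int (s * s)"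
  proof -
    have "(bounded_prob n 11)\<^sup>2 * 1000000000000000000 = (bounded_prob n 11 * 1000000000) * (bounded_prob n 11 * 1000000000)"
      by (simp add: power2_eq_square)
    also have "\<dots> \<le> of_int s * of_int s"
      using s bounded_prob_nonneg[of n 11] by (intro mult_mono) auto
    finally show ?thesis by simp
  qed
  have "(\<Sum>L=12..n. (1 + 6 / real L) / (real L)\<^sup>2 * compatible_prob (n - L) (n - L)) * 1000000000000000000
    = (\<Sum>m<n - 11. ((1 + 6 / real (n - m)) / (real (n - m))\<^sup>2 * 1000000000) * (compatible_prob m m * 1000000000))"
    unfolding sum_distrib_right
    by (rule sum.reindex_bij_witness[of _ "\<lambda>m. n - m" "\<lambda>L. n - L"]) (use n in auto)
  also have "\<dots> \<le> (\<Sum>m<n - 11. of_int (G ! m) * of_int (prob_bounds ! m))"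
  proof (intro sum_mono mult_mono)
    fix m assume m: "m \<in> {..<n - 11}"
    define l where "l = int (n - m)"
    have l: "0 < l" "real (n - m) = of_int l" using m by (auto simp: l_def)
    have "G ! m = div_up ((l + 6) * 1000000000) (l * l * l)"
      using m n by (simp add: G_def rev_nth large_block_bound_def Let_def l_def del: upt_Suc)
    moreover have "(1 + 6 / real (n - m)) / (real (n - m))\<^sup>2 * 1000000000 = of_int ((l + 6) * 1000000000) / of_int (l * l * l)"
      unfolding l(2) using l(1) by (simp add: field_simps power2_eq_square)
    ultimately show "(1 + 6 / real (n - m)) / (real (n - m))\<^sup>2 * 1000000000 \<le> of_int (G ! m)"
      using div_up_ge[of "l * l * l" "(l + 6) * 1000000000"] l(1) by simp
    then show "0 \<le> real_of_int (G ! m)" by (rule order_trans[rotated]) simp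
    show "compatible_prob m m * 1000000000 \<le> of_int (prob_bounds ! m)"
      using m n IH by (intro prob_bounds) auto
  qed (simp add: compatible_prob_nonneg)
  also have "\<dots> = of_int (dot G prob_bounds)"
  proof -
    have "min (n - 11) 68 = n - 11" using n by simp
    then show ?thesis unfolding dot_conv_sum len(2,3) by simp
  qed
  finally have "compatible_prob n n * 1000000000000000000 \<le> of_int (s * s + dot G prob_bounds)"
    using sq compatible_prob_large_cycle[of n] by simp
  then have "compatible_prob n n * 1000000000000000000 * (real n)\<^sup>2 \<le> of_int (s * s + dot G prob_bounds) * (real n)\<^sup>2"
    by (rule mult_right_mono) simp
  also have "\<dots> = of_int (int n * int n * (s * s + dot G prob_bounds))" by (simp add: power2_eq_square)
  also have "\<dots> \<le> of_int 11375000000000000000"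
  proof -
    have "40 + (n - 40) = n" using n by simp
    then show ?thesis
      using check_degrees[OF check_degrees_eval, of "n - 40"] n len(1)
      unfolding of_int_le_iff ss_def[symmetric] s_def[symmetric] by (simp only: s_def G_def)
  qed
  finally show ?thesis by simp
qed

section \<open>Degrees from 80\<close>

text \<open>Telescoping, as \<open>1 / (m + 1)\<^sup>2 \<le> 1 / m - 1 / (m + 1)\<close>.\<close>

lemma sum_inverse_squares_le:
  assumes "0 < a" "a \<le> b"
  shows "(\<Sum>m=Suc a..b. 1 / (real m)\<^sup>2) \<le> 1 / real a"
proof -
  have "(\<Sum>m=Suc a..b. 1 / (real m)\<^sup>2) \<le> 1 / real a - 1 / real b"
    using assms(2)
  proof (induction b rule: dec_induct)
    case (step c)
    have c: "0 < real c" using step(1) assms(1) by simp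
    have "1 / (real (Suc c))\<^sup>2 \<le> 1 / (real c * real (Suc c))"
      unfolding power2_eq_square using c by (intro divide_left_mono mult_right_mono) auto
    also have "\<dots> = 1 / real c - 1 / real (Suc c)" using c by (simp add: divide_simps)
    finally show ?case using step by simp
  qed simp
  also have "\<dots> \<le> 1 / real a" by simp
  finally show ?thesis .
qed

text \<open>The sum grows like the logarithm of \<open>n\<close>, and already at \<open>n = 80\<close> each step adds less than the
  slope of the linear bound, which is chosen just above the value at \<open>n = 80\<close>.\<close>

lemma harmonic_segment_le:
  assumes "80 \<le> n"
  shows "(\<Sum>m=11..n - 11. 1 / real m) \<le> 24 / 1000 * real n"
  using assms
proof (induction n rule: dec_induct)
  case base
  have "(\<Sum>m\<leftarrow>[11..<70]. div_up 1000000 (int m)) \<le> 1920000" by code_simp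
  then have *: "real_of_int (\<Sum>m\<leftarrow>[11..<70]. div_up 1000000 (int m)) \<le> 1920000" by linarith
  have "(\<Sum>m=11..69. 1 / real m) * 1000000 = (\<Sum>m=11..69. of_int 1000000 / of_int (int m))"
    by (simp add: sum_distrib_right)
  also have "\<dots> \<le> (\<Sum>m=11..69. of_int (div_up 1000000 (int m)))"
    by (intro sum_mono div_up_ge) auto
  also have "\<dots> = real_of_int (\<Sum>m\<leftarrow>[11..<70]. div_up 1000000 (int m))"
    by (simp only: sum_list_distinct_conv_sum_set distinct_upt set_upt of_int_sum)
      (rule sum.cong, auto)
  also note *
  finally show ?case by simp
next
  case (step n)
  have "Suc n - 11 = Suc (n - 11)" using step by simp
  then have "(\<Sum>m=11..Suc n - 11. 1 / real m) = (\<Sum>m=11..n - 11. 1 / real m) + 1 / real (Suc (n - 11))"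
    using step by simp
  also have "1 / real (Suc (n - 11)) \<le> 24 / 1000" using step by (simp add: field_simps)
  finally show ?case using step by simp
qed

text \<open>In the recursion the window of summands moves by one step, so \<open>n * bounded_prob n k\<close> changes by the
  difference of two earlier probabilities.  Monotonicity of the probabilities and of these
  products follow together.\<close>

lemma bounded_prob_Suc_le: "bounded_prob (Suc n) k \<le> bounded_prob n k"
  and bounded_prob_Suc_mult_le: "k \<le> n \<Longrightarrow> real (Suc n) * bounded_prob (Suc n) k \<le> real n * bounded_prob n k"
proof -
  let ?P = "\<lambda>n. bounded_prob n k"
  have small: "?P n = 1" if "n \<le> k" for n
    using that
  proof (induction n rule: less_induct)
    case (less n)
    show ?case
    proof (cases "n = 0")
      case False
      have "real n * ?P n = (\<Sum>a=1..n. ?P (n - a))" using bounded_prob_rec[of n k] less.prems by (simp add: min_def)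
      also have "\<dots> = (\<Sum>a=1..n. 1)" using less by (intro sum.cong) auto
      finally show ?thesis using False by simp
    qed (simp add: bounded_prob_0)
  qed
  have shift: "real (Suc n) * ?P (Suc n) = real n * ?P n + ?P n - ?P (n - k)" if "k \<le> n" "0 < k" for n
  proof -
    have "real (Suc n) * ?P (Suc n) = (\<Sum>a=1..k. ?P (Suc n - a))"
      using bounded_prob_rec[of "Suc n" k] that by (simp add: min_def)
    also have "\<dots> = (\<Sum>a=0..k - 1. ?P (n - a))"
      by (rule sum.reindex_bij_witness[of _ Suc "\<lambda>a. a - 1"]) (use that in auto)
    also have "\<dots> + ?P (n - k) = (\<Sum>a=0..k. ?P (n - a))"
      using that by (cases k) auto
    also have "\<dots> = ?P n + (\<Sum>a=1..k. ?P (n - a))" by (subst sum.atLeast_Suc_atMost) auto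
    also have "(\<Sum>a=1..k. ?P (n - a)) = real n * ?P n"
      using bounded_prob_rec[of n k] that by (simp add: min_def)
    finally show ?thesis by simp
  qed
  have dec: "?P (Suc n) \<le> ?P n" for n
  proof (induction n rule: less_induct)
    case (less n)
    consider "Suc n \<le> k" | "k \<le> n" "0 < k" | "k = 0" by linarith
    then show ?case
    proof cases
      case 1
      then show ?thesis using small[of n] small[of "Suc n"] by simp
    next
      case 2
      have "?P n \<le> ?P (n - i)" if "i \<le> n" for i
        using that
      proof (induction i)
        case (Suc i)
        have "?P (Suc (n - Suc i)) \<le> ?P (n - Suc i)" using Suc.prems by (intro less.IH) simp
        moreover have "Suc (n - Suc i) = n - i" using Suc.prems by simp
        ultimately show ?case using Suc by simp
      qed simp
      then have "?P n \<le> ?P (n - k)" using 2 by simp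
      then have "real (Suc n) * ?P (Suc n) \<le> real n * ?P n" using shift[OF 2] by simp
      also have "\<dots> \<le> real (Suc n) * ?P n" by (intro mult_right_mono bounded_prob_nonneg) simp
      finally show ?thesis by simp
    next
      case 3
      then show ?thesis using bounded_prob_nonneg[of n 0] by (simp add: bounded_prob_def types_0_right)
    qed
  qed
  then show "bounded_prob (Suc n) k \<le> bounded_prob n k" .
  show "real (Suc n) * bounded_prob (Suc n) k \<le> real n * bounded_prob n k" if "k \<le> n"
  proof (cases "k = 0")
    case True
    then show ?thesis using bounded_prob_nonneg[of n 0] by (simp add: bounded_prob_def types_0_right)
  next
    case False
    have "?P n \<le> ?P (n - k)"
      by (rule lift_Suc_antimono_le[of ?P]) (use dec in auto)
    then show ?thesis using shift[OF that] False by simp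
  qed
qed

lemma bounded_prob_80_eval: "rev (bounded_column_rev 11 80) ! 80 \<le> 100000"
  by code_simp

lemma bounded_prob_80_le:
  assumes "80 \<le> n"
  shows "real n * bounded_prob n 11 \<le> 1 / 100"
  using assms
proof (induction n rule: dec_induct)
  case base
  have "bounded_prob 80 11 * 1000000000 \<le> of_int (rev (bounded_column_rev 11 80) ! 80)"
    using bounded_column_rev[of 11 80] by (simp add: bounds_def)
  also have "\<dots> \<le> real_of_int 100000" using bounded_prob_80_eval by (simp only: of_int_le_iff)
  finally show ?case by simp
next
  case (step k)
  then show ?case using bounded_prob_Suc_mult_le[of 11 k] by simp
qed

text \<open>In the sum over the degree \<open>m = n - L\<close> that remains after removing a block, the main contribution
  comes from small \<open>m\<close>, where \<open>(n / (n - m))\<^sup>2\<close> is close to 1 and decreases in \<open>n\<close>.  For larger \<open>m\<close>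
  the induction hypothesis gives terms \<open>(n / (m * (n - m)))\<^sup>2 = (1 / m + 1 / (n - m))\<^sup>2\<close>; the squares sum
  to at most \<open>1 / 10 + 1 / 11\<close> and the mixed terms to a multiple of \<open>log n / n\<close>.\<close>

lemma compatible_prob_from_80:
  assumes n: "80 \<le> n"
    and IH: "\<And>m. 11 \<le> m \<Longrightarrow> m < n \<Longrightarrow> compatible_prob m m * (real m)\<^sup>2 \<le> 11375 / 1000"
  shows "compatible_prob n n * (real n)\<^sup>2 \<le> 11375 / 1000"
proof -
  define \<rho> where "\<rho> m = compatible_prob m m" for m
  define h where "h m = (real n / real (n - m))\<^sup>2 * (1 + 6 / real (n - m))" for m
  have h_nonneg: "0 \<le> h m" for m by (simp add: h_def)
  have "\<rho> n \<le> (bounded_prob n 11)\<^sup>2 + (\<Sum>L=12..n. (1 + 6 / real L) / (real L)\<^sup>2 * \<rho> (n - L))"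
    unfolding \<rho>_def by (rule compatible_prob_large_cycle)
  then have "\<rho> n * (real n)\<^sup>2 \<le> ((bounded_prob n 11)\<^sup>2
      + (\<Sum>L=12..n. (1 + 6 / real L) / (real L)\<^sup>2 * \<rho> (n - L))) * (real n)\<^sup>2"
    by (rule mult_right_mono) simp
  also have "\<dots> = (real n * bounded_prob n 11)\<^sup>2
      + (\<Sum>L=12..n. (real n)\<^sup>2 * ((1 + 6 / real L) / (real L)\<^sup>2 * \<rho> (n - L)))"
    unfolding distrib_right power_mult_distrib sum_distrib_left[symmetric] by (simp only: mult.commute)
  also have "(\<Sum>L=12..n. (real n)\<^sup>2 * ((1 + 6 / real L) / (real L)\<^sup>2 * \<rho> (n - L))) = (\<Sum>m=0..n - 12. h m * \<rho> m)"
    by (rule sum.reindex_bij_witness[of _ "\<lambda>m. n - m" "\<lambda>L. n - L"])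
      (use n in \<open>auto simp: h_def power_divide\<close>)
  also have "{0..n - 12} = {0..10} \<union> {11..n - 12}" using n by auto
  also have "(\<Sum>m\<in>{0..10} \<union> {11..n - 12}. h m * \<rho> m) = (\<Sum>m=0..10. h m * \<rho> m) + (\<Sum>m=11..n - 12. h m * \<rho> m)"
    by (rule sum.union_disjoint) auto
  finally have main: "\<rho> n * (real n)\<^sup>2 \<le> (real n * bounded_prob n 11)\<^sup>2
    + ((\<Sum>m=0..10. h m * \<rho> m) + (\<Sum>m=11..n - 12. h m * \<rho> m))" .
  have sq: "(real n * bounded_prob n 11)\<^sup>2 \<le> (1 / 100)\<^sup>2"
    by (intro power_mono bounded_prob_80_le n) (simp add: bounded_prob_nonneg)
  have first: "(\<Sum>m=0..10. h m * \<rho> m) \<le> 6368 / 1000"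
  proof -
    have range: "{0..10::nat} = {0, 1, 2, 3, 4, 5, 6, 7, 8, 9, 10}"
      by (rule Set.set_eqI, simp only: atLeastAtMost_iff insert_iff empty_iff, presburger)
    \<comment> \<open>The value of \<open>h m\<close> at \<open>n = 80\<close>.\<close>
    define g where "g m = (80 / real (80 - m))\<^sup>2 * (1 + 6 / real (80 - m))" for m
    have "(\<Sum>m=0..10. h m * \<rho> m) \<le> (\<Sum>m=0..10. g m * (of_int (prob_bounds ! m) / 1000000000))"
    proof (intro sum_mono mult_mono)
      fix m :: nat assume m: "m \<in> {0..10}"
      have "real n / real (n - m) \<le> 80 / real (80 - m)"
      proof -
        have "real n * real (80 - m) \<le> 80 * real (n - m)"
          using m n mult_right_mono[of 80 "real n" "real m"] by (simp add: of_nat_diff algebra_simps)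
        then show ?thesis using m n by (simp add: field_simps)
      qed
      moreover have "6 / real (n - m) \<le> 6 / real (80 - m)"
        using m n by (intro divide_left_mono) (auto simp: of_nat_diff)
      ultimately show "h m \<le> g m" unfolding h_def g_def by (intro mult_mono power_mono) auto
      show "\<rho> m \<le> of_int (prob_bounds ! m) / 1000000000"
        using prob_bounds[of m] m unfolding \<rho>_def by simp
    qed (simp_all add: g_def \<rho>_def compatible_prob_nonneg)
    also have "\<dots> \<le> 6368 / 1000"
      unfolding range by (simp add: g_def prob_bounds_def nth_append power2_eq_square)
    finally show ?thesis .
  qed
  have second: "(\<Sum>m=11..n - 12. h m * \<rho> m) \<le> 11375 / 1000 * (3 / 2) * (1 / 10 + 1 / 11 + 96 / 1000)"
  proof -
    let ?t = "\<lambda>m. 1 / (real m)\<^sup>2 + 1 / (real (n - m))\<^sup>2 + 2 / real n * (1 / real m + 1 / real (n - m))"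
    have "(\<Sum>m=11..n - 12. h m * \<rho> m) \<le> (\<Sum>m=11..n - 12. 11375 / 1000 * (3 / 2) * ?t m)"
    proof (rule sum_mono)
      fix m assume m: "m \<in> {11..n - 12}"
      define l where "l = n - m"
      have l: "12 \<le> l" "0 < m" "real n = real m + real l" using m n by (auto simp: l_def)
      have "\<rho> m \<le> 11375 / 1000 / (real m)\<^sup>2"
      proof -
        have "11 \<le> m" "m < n" using m n by auto
        from IH[OF this] show ?thesis using l(2) unfolding \<rho>_def by (simp add: field_simps)
      qed
      moreover have "1 + 6 / real l \<le> 3 / 2" using l by (simp add: field_simps)
      then have "h m \<le> (real n / real l)\<^sup>2 * (3 / 2)" unfolding h_def l_def[symmetric] by (intro mult_left_mono) auto
      ultimately have "h m * \<rho> m \<le> ((real n / real l)\<^sup>2 * (3 / 2)) * (11375 / 1000 / (real m)\<^sup>2)"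
        using h_nonneg[of m] by (intro mult_mono) (auto simp: \<rho>_def compatible_prob_nonneg)
      also have "\<dots> = 11375 / 1000 * (3 / 2) * (real n / (real m * real l))\<^sup>2"
        by (simp add: power_divide power_mult_distrib)
      also have "(real n / (real m * real l))\<^sup>2 = ?t m"
      proof -
        have "real n / (real m * real l) = 1 / real m + 1 / real l" using l by (simp add: field_simps)
        then have "(real n / (real m * real l))\<^sup>2 = (1 / real m + 1 / real l)\<^sup>2" by simp
        also have "\<dots> = 1 / (real m)\<^sup>2 + 1 / (real l)\<^sup>2 + 2 * (1 / (real m * real l))"
          by (simp add: power2_sum power_divide)
        also have "1 / (real m * real l) = 1 / real n * (1 / real m + 1 / real l)"
          using l by (simp add: divide_simps) (simp add: algebra_simps)?
        finally show ?thesis by (simp add: l_def)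
      qed
      finally show "h m * \<rho> m \<le> 11375 / 1000 * (3 / 2) * ?t m" .
    qed
    also have "\<dots> = 11375 / 1000 * (3 / 2) * ((\<Sum>m=11..n - 12. 1 / (real m)\<^sup>2) + (\<Sum>m=11..n - 12. 1 / (real (n - m))\<^sup>2)
        + 2 / real n * ((\<Sum>m=11..n - 12. 1 / real m) + (\<Sum>m=11..n - 12. 1 / real (n - m))))"
      unfolding sum_distrib_left[symmetric] sum.distrib ..
    also have "\<dots> \<le> 11375 / 1000 * (3 / 2) * (1 / 10 + 1 / 11 + 96 / 1000)"
    proof (rule mult_left_mono)
      have "(\<Sum>m=11..n - 12. 1 / (real m)\<^sup>2) \<le> 1 / 10"
        using sum_inverse_squares_le[of 10 "n - 12"] n by simp
      moreover have "(\<Sum>m=11..n - 12. 1 / (real (n - m))\<^sup>2) = (\<Sum>l=12..n - 11. 1 / (real l)\<^sup>2)"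
        by (rule sum.reindex_bij_witness[of _ "\<lambda>l. n - l" "\<lambda>m. n - m"]) (use n in auto)
      moreover have "(\<Sum>l=12..n - 11. 1 / (real l)\<^sup>2) \<le> 1 / 11"
        using sum_inverse_squares_le[of 11 "n - 11"] n by simp
      moreover have "(\<Sum>m=11..n - 12. 1 / real m) \<le> 24 / 1000 * real n"
      proof -
        have "(\<Sum>m=11..n - 12. 1 / real m) \<le> (\<Sum>m=11..n - 11. 1 / real m)" by (rule sum_mono2) auto
        then show ?thesis using harmonic_segment_le[OF n] by simp
      qed
      moreover have "(\<Sum>m=11..n - 12. 1 / real (n - m)) \<le> 24 / 1000 * real n"
      proof -
        have "(\<Sum>m=11..n - 12. 1 / real (n - m)) = (\<Sum>l=12..n - 11. 1 / real l)"
          by (rule sum.reindex_bij_witness[of _ "\<lambda>l. n - l" "\<lambda>m. n - m"]) (use n in auto)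
        also have "\<dots> \<le> (\<Sum>l=11..n - 11. 1 / real l)" by (rule sum_mono2) auto
        finally show ?thesis using harmonic_segment_le[OF n] by simp
      qed
      ultimately have "2 / real n * ((\<Sum>m=11..n - 12. 1 / real m) + (\<Sum>m=11..n - 12. 1 / real (n - m)))
          \<le> 2 / real n * (48 / 1000 * real n)"
        by (intro mult_left_mono) auto
      also have "\<dots> = 96 / 1000" using n by simp
      finally have "2 / real n * ((\<Sum>m=11..n - 12. 1 / real m) + (\<Sum>m=11..n - 12. 1 / real (n - m))) \<le> 96 / 1000" .
      with \<open>(\<Sum>m=11..n - 12. 1 / (real m)\<^sup>2) \<le> 1 / 10\<close> \<open>(\<Sum>l=12..n - 11. 1 / (real l)\<^sup>2) \<le> 1 / 11\<close>
        \<open>(\<Sum>m=11..n - 12. 1 / (real (n - m))\<^sup>2) = (\<Sum>l=12..n - 11. 1 / (real l)\<^sup>2)\<close>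
      show "(\<Sum>m=11..n - 12. 1 / (real m)\<^sup>2) + (\<Sum>m=11..n - 12. 1 / (real (n - m))\<^sup>2)
        + 2 / real n * ((\<Sum>m=11..n - 12. 1 / real m) + (\<Sum>m=11..n - 12. 1 / real (n - m)))
        \<le> 1 / 10 + 1 / 11 + 96 / 1000" by linarith
    qed simp
    finally show ?thesis .
  qed
  \<comment> \<open>The three constants add up to about 11.263.\<close>
  have "\<rho> n * (real n)\<^sup>2 \<le> (1 / 100)\<^sup>2 + (6368 / 1000 + 11375 / 1000 * (3 / 2) * (1 / 10 + 1 / 11 + 96 / 1000))"
    using main sq first second by linarith
  also have "\<dots> \<le> 11375 / 1000" by (simp add: power2_eq_square)
  finally show ?thesis by (simp add: \<rho>_def)
qed

lemma compatible_prob_le: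
  assumes "1 \<le> n" "n \<noteq> 10"
  shows "compatible_prob n n * (real n)\<^sup>2 \<le> 11375 / 1000"
  using assms
proof (induction n rule: less_induct)
  case (less n)
  consider "n \<le> 39" | "40 \<le> n" "n \<le> 79" | "80 \<le> n" by linarith
  then show ?case
  proof cases
    case 1
    then show ?thesis using less.prems by (intro compatible_prob_le_39)
  next
    case 2
    show ?thesis by (rule compatible_prob_le_79[OF 2], rule less.IH) simp_all
  next
    case 3
    show ?thesis by (rule compatible_prob_from_80[OF 3], rule less.IH) simp_all
  qed
qed

theorem theorem1p6:
  fixes n :: nat
  assumes "n \<ge> 1"
  shows "rho (sym_group n) \<le> C_rho / (real n)\<^sup>2"
proof (cases "n = 10")
  case True
  then show ?thesis by (simp add: C_rho_def power2_eq_square)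
next
  case False
  \<comment> \<open>The bound 11.375 separates degree 10 from all other degrees.\<close>
  have "11375 / 1000 \<le> C_rho"
    using compatible_prob_10_lower by (simp add: C_rho_def rho_sym_group)
  then have "rho (sym_group n) * (real n)\<^sup>2 \<le> C_rho"
    using compatible_prob_le[OF assms False] by (simp add: rho_sym_group)
  then show ?thesis using assms by (simp add: field_simps)
qed

end
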